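(* Let $X$ be a finite $T_0$-space and let $\mathcal{V}$ be a basis-like open cover of $X$ with a finite number of elements. Regard $\mathcal{V}$ as a finite poset with the inclusion order. Then there is a spectral sequence $$E^2_{p,q}=H_p(\mathcal{V};\mathcal{H}_q)\Rightarrow H_{p+q}(X;\mathbb{Z})$$ where the functor $\mathcal{H}_q\colon \mathcal{V}\to \mathrm{Ab}$ is defined by $\mathcal{H}_q(V)=H_q(V;\mathbb{Z})$ (with morphisms induced by the inclusion maps).
   Context: $\mathrm{Ab}$ is the category of abelian groups. Finite $T_0$-spaces are identified with finite posets: for a finite $T_0$-space $X$, $x\le y$ iff $x$ belongs to the minimal open set containing $y$; the open sets are the down-sets. An open cover $\mathcal{V}$ of $X$ is basis-like if whenever $V_1,V_2\in\mathcal{V}$ and $x\in V_1\cap V_2$ there is $W\in\mathcal{V}$ with $x\in W\subseteq V_1\cap V_2$. A poset is regarded as a small category with a unique morphism $x\to y$ iff $x\le y$; functors are covariant. For a poset $X$ and $n\ge 0$, $\mathrm{Ch}_n(X)$ is the set of totally ordered subsets of $X$ of cardinality $n+1$. For a functor $\mathcal{F}\colon X\to\mathrm{Ab}$, $H_n(X;\mathcal{F})$ is the homology of the chain complex $C(X;\mathcal{F})$ with $C_n(X;\mathcal{F})=\bigoplus_{\sigma\in \mathrm{Ch}_n(X)}\mathcal{F}(\min\sigma)$ for $n\geq 0$ (and $0$ for $n<0$), whose differential for $n\geq 1$ is given, for $\sigma=\{\sigma_0<\dots<\sigma_n\}$ and $g\in\mathcal{F}(\sigma_0)$, by $d(g\sigma)=\mathcal{F}(\sigma_0<\sigma_1)(g)\,(\sigma-\{\sigma_0\})+\sum_{i=1}^n(-1)^i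 g\,(\sigma-\{\sigma_i\})$. $H_n(X;\mathbb{Z})$ is the case of the constant functor $\mathbb{Z}$ with identity maps, i.e. the integral simplicial homology of the order complex of $X$ (equivalently, the singular homology of the space $X$). Spectral sequences are (first-quadrant) homological spectral sequences. *)

theory Defs
  imports "HOL-Analysis.Abstract_Topological_Spaces" "HOL-Algebra.Product_Groups"
    "HOL-Algebra.FiniteProduct"
begin

text \<open>Abelian groups are the (multiplicatively written) \<^term>\<open>comm_group\<close>s of HOL-Algebra;
  a poset is given by its order relation r, with underlying set \<^term>\<open>Field r\<close>
  and \<^term>\<open>(x, y) \<in> r\<close> meaning that x is below y.\<close>

subsection \<open>Finite spaces and covers as posets\<close>

definition minimal_open :: "'a topology \<Rightarrow> 'a \<Rightarrow> 'a set" where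
  "minimal_open X y = \<Inter>{U. openin X U \<and> y \<in> U}"

definition space_order :: "'a topology \<Rightarrow> 'a rel" where
  "space_order X = {(x, y). y \<in> topspace X \<and> x \<in> minimal_open X y}"

definition inclusion_order :: "'a set set \<Rightarrow> 'a set rel" where
  "inclusion_order \<V> = {(V, W). V \<in> \<V> \<and> W \<in> \<V> \<and> V \<subseteq> W}"

definition open_cover :: "'a topology \<Rightarrow> 'a set set \<Rightarrow> bool" where
  "open_cover X \<V> \<longleftrightarrow> (\<forall>V\<in>\<V>. openin X V) \<and> \<Union>\<V> = topspace X"

definition basis_like :: "'a set set \<Rightarrow> bool" where
  "basis_like \<V> \<longleftrightarrow>
     (\<forall>V1\<in>\<V>. \<forall>V2\<in>\<V>. \<forall>x\<in>V1 \<inter> V2. \<exists>W\<in>\<V>. x \<in> W \<and> W \<subseteq> V1 \<inter> V2)"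

subsection \<open>Functors from a poset to abelian groups\<close>

record ('a, 'g) poset_functor =
  obj :: "'a \<Rightarrow> 'g monoid"
  mor :: "'a \<Rightarrow> 'a \<Rightarrow> 'g \<Rightarrow> 'g"

definition is_functor :: "'a rel \<Rightarrow> ('a, 'g) poset_functor \<Rightarrow> bool" where
  "is_functor r F \<longleftrightarrow>
     (\<forall>x\<in>Field r. comm_group (obj F x)) \<and>
     (\<forall>(x, y)\<in>r. mor F x y \<in> hom (obj F x) (obj F y)) \<and>
     (\<forall>x\<in>Field r. \<forall>g\<in>carrier (obj F x). mor F x x g = g) \<and>
     (\<forall>(x, y)\<in>r. \<forall>z. (y, z) \<in> r \<longrightarrow>
        (\<forall>g\<in>carrier (obj F x). mor F x z g = mor F y z (mor F x y g)))"

definition constant_Z :: "('a, int) poset_functor" where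
  "constant_Z = \<lparr>obj = \<lambda>_. integer_group, mor = \<lambda>_ _. id\<rparr>"

subsection \<open>Homology of a poset with coefficients in a functor\<close>

definition Ch :: "'a rel \<Rightarrow> int \<Rightarrow> 'a set set" where
  "Ch r n = {\<sigma> \<in> Chains r. 0 \<le> n \<and> int (card \<sigma>) = n + 1}"

text \<open>The vertex \<open>\<sigma>\<^sub>i\<close> of a finite chain is the one with exactly i
  vertices strictly below it; in particular \<open>\<sigma>\<^sub>0\<close> is the minimum.\<close>

definition vertex :: "'a rel \<Rightarrow> 'a set \<Rightarrow> nat \<Rightarrow> 'a" where
  "vertex r \<sigma> i = (THE x. x \<in> \<sigma> \<and> card {y \<in> \<sigma>. y \<noteq> x \<and> (y, x) \<in> r} = i)"

definition chain_grp :: "'a rel \<Rightarrow> ('a, 'g) poset_functor \<Rightarrow> int \<Rightarrow> ('a set \<Rightarrow> 'g) monoid" where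
  "chain_grp r F n = sum_group (Ch r n) (\<lambda>\<sigma>. obj F (vertex r \<sigma> 0))"

text \<open>\<open>gen r F n g \<sigma>\<close> is the n-chain written \<open>g \<sigma>\<close>.\<close>

definition gen :: "'a rel \<Rightarrow> ('a, 'g) poset_functor \<Rightarrow> int \<Rightarrow> 'g \<Rightarrow> 'a set \<Rightarrow> 'a set \<Rightarrow> 'g" where
  "gen r F n g \<sigma> = (\<lambda>\<tau>\<in>Ch r n. if \<tau> = \<sigma> then g else \<one>\<^bsub>obj F (vertex r \<tau> 0)\<^esub>)"

definition d_gen :: "'a rel \<Rightarrow> ('a, 'g) poset_functor \<Rightarrow> int \<Rightarrow> 'g \<Rightarrow> 'a set \<Rightarrow> 'a set \<Rightarrow> 'g" where
  "d_gen r F n g \<sigma> =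
     gen r F (n - 1) (mor F (vertex r \<sigma> 0) (vertex r \<sigma> 1) g) (\<sigma> - {vertex r \<sigma> 0})
     \<otimes>\<^bsub>chain_grp r F (n - 1)\<^esub>
     finprod (chain_grp r F (n - 1))
       (\<lambda>i. gen r F (n - 1) g (\<sigma> - {vertex r \<sigma> i}) [^]\<^bsub>chain_grp r F (n - 1)\<^esub> ((-1) ^ i :: int))
       {1..nat n}"

text \<open>The additive extension of \<^const>\<open>d_gen\<close> to all chains. For \<open>n \<le> 0\<close> the target group is
  trivial, so no separate clause is needed there.\<close>

definition boundary ::
    "'a rel \<Rightarrow> ('a, 'g) poset_functor \<Rightarrow> int \<Rightarrow> ('a set \<Rightarrow> 'g) \<Rightarrow> 'a set \<Rightarrow> 'g" where
  "boundary r F n c =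
     finprod (chain_grp r F (n - 1)) (\<lambda>\<sigma>. d_gen r F n (c \<sigma>) \<sigma>)
       {\<sigma> \<in> Ch r n. c \<sigma> \<noteq> \<one>\<^bsub>obj F (vertex r \<sigma> 0)\<^esub>}"

text \<open>The homology at the middle term of \<open>A \<rightarrow> B \<rightarrow> C\<close>.\<close>

definition homology_at ::
    "'a monoid \<Rightarrow> ('a \<Rightarrow> 'b) \<Rightarrow> 'b monoid \<Rightarrow> ('b \<Rightarrow> 'c) \<Rightarrow> 'c monoid \<Rightarrow> 'b set monoid" where
  "homology_at A f B g C = B\<lparr>carrier := kernel B C g\<rparr> Mod (f ` carrier A)"

definition poset_homology ::
    "int \<Rightarrow> 'a rel \<Rightarrow> ('a, 'g) poset_functor \<Rightarrow> ('a set \<Rightarrow> 'g) set monoid" where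
  "poset_homology n r F =
     homology_at (chain_grp r F (n + 1)) (boundary r F (n + 1))
                 (chain_grp r F n) (boundary r F n) (chain_grp r F (n - 1))"

definition space_homology :: "int \<Rightarrow> 'a topology \<Rightarrow> ('a set \<Rightarrow> int) set monoid" where
  "space_homology n X = poset_homology n (space_order X) constant_Z"

subsection \<open>The functor of homology groups of the members of a cover\<close>

text \<open>The chain map induced by the inclusion of a subposet s into r: extension by zero.\<close>

definition extend_chain :: "int \<Rightarrow> 'a rel \<Rightarrow> 'a rel \<Rightarrow> ('a set \<Rightarrow> int) \<Rightarrow> 'a set \<Rightarrow> int" where
  "extend_chain n s r c = (\<lambda>\<sigma>\<in>Ch r n. if \<sigma> \<in> Ch s n then c \<sigma> else 0)"

text \<open>The image of a homology class A, i.e. of a coset of the boundaries, is the coset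
  containing the extensions of all representatives of A: their set, saturated by the boundaries
  of the larger poset.\<close>

definition inclusion_induced ::
    "int \<Rightarrow> 'a rel \<Rightarrow> 'a rel \<Rightarrow> ('a set \<Rightarrow> int) set \<Rightarrow> ('a set \<Rightarrow> int) set" where
  "inclusion_induced n s r A =
     (boundary r constant_Z (n + 1) ` carrier (chain_grp r constant_Z (n + 1)))
     <#>\<^bsub>chain_grp r constant_Z n\<^esub> (extend_chain n s r ` A)"

definition homology_functor ::
    "'a topology \<Rightarrow> int \<Rightarrow> ('a set, ('a set \<Rightarrow> int) set) poset_functor" where
  "homology_functor X q =
     \<lparr>obj = \<lambda>V. space_homology q (subtopology X V),
      mor = \<lambda>V W. inclusion_induced q (space_order (subtopology X V))
                                      (space_order (subtopology X W))\<rparr>"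

subsection \<open>First-quadrant homological spectral sequences\<close>

text \<open>Pages are \<open>E r p q\<close> for \<open>r \<ge> r0\<close>, with
  \<open>d r p q : E r p q \<rightarrow> E r (p - r) (q + r - 1)\<close>. Since HOL has no quantification over types,
  an existence claim must name the common element type of the pages; for the spectral sequence of a
  cover we take sets of integer-valued functions on pairs (chain of members of the cover, chain of
  points), which contain all cosets in the total complex of the associated double complex.\<close>

locale spectral_sequence =
  fixes r0 :: nat
    and E :: "nat \<Rightarrow> int \<Rightarrow> int \<Rightarrow> 'e monoid"
    and d :: "nat \<Rightarrow> int \<Rightarrow> int \<Rightarrow> 'e \<Rightarrow> 'e"
  assumes page_comm_group: "r0 \<le> r \<Longrightarrow> comm_group (E r p q)"
    and first_quadrant: "r0 \<le> r \<Longrightarrow> p < 0 \<or> q < 0 \<Longrightarrow> trivial_group (E r p q)"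
    and differential_hom:
      "r0 \<le> r \<Longrightarrow> d r p q \<in> hom (E r p q) (E r (p - int r) (q + int r - 1))"
    and differential_square:
      "r0 \<le> r \<Longrightarrow> x \<in> carrier (E r p q) \<Longrightarrow>
         d r (p - int r) (q + int r - 1) (d r p q x)
           = \<one>\<^bsub>E r (p - 2 * int r) (q + 2 * int r - 2)\<^esub>"
    and next_page:
      "r0 \<le> r \<Longrightarrow>
         E (Suc r) p q \<cong>
         homology_at (E r (p + int r) (q - int r + 1)) (d r (p + int r) (q - int r + 1))
                     (E r p q) (d r p q) (E r (p - int r) (q + int r - 1))"

text \<open>Convergence. In a first-quadrant spectral sequence all differentials into and out of
  position (p, q) vanish on the pages with \<open>r > p\<close> and \<open>r > q + 1\<close>, so each of these pages is
  the limit term at (p, q). The filtration of H n satisfies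
  \<open>0 = F\<^bsub>-1\<^esub> \<subseteq> F\<^bsub>0\<^esub> \<subseteq> \<dots> \<subseteq> F\<^bsub>n\<^esub> = H n\<close>.\<close>

definition converges_to ::
    "nat \<Rightarrow> (nat \<Rightarrow> int \<Rightarrow> int \<Rightarrow> 'e monoid) \<Rightarrow> (int \<Rightarrow> 'h monoid) \<Rightarrow> bool" where
  "converges_to r0 E H \<longleftrightarrow>
     (\<exists>Fil :: int \<Rightarrow> int \<Rightarrow> 'h set.
        (\<forall>n p. subgroup (Fil n p) (H n)) \<and>
        (\<forall>n p. Fil n p \<subseteq> Fil n (p + 1)) \<and>
        (\<forall>n p. p < 0 \<longrightarrow> Fil n p = {\<one>\<^bsub>H n\<^esub>}) \<and>
        (\<forall>n p. n \<le> p \<longrightarrow> Fil n p = carrier (H n)) \<and>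
        (\<forall>r p q. r0 \<le> r \<and> p < int r \<and> q + 1 < int r \<longrightarrow>
           E r p q \<cong> (H (p + q))\<lparr>carrier := Fil (p + q) p\<rparr> Mod Fil (p + q) (p - 1)))"

end

theory Submission
  imports Defs "HOL-Library.Function_Algebras"
begin

text \<open>Let C be the double complex with basis the pairs of a chain \<open>\<sigma>\<close> of members of the cover and a
  chain \<open>\<tau>\<close> of points contained in all members of \<open>\<sigma>\<close>, graded by the dimensions of \<open>\<sigma>\<close> and \<open>\<tau>\<close>.
  The spectral sequence is that of the total complex filtered by the dimension of \<open>\<sigma>\<close>: taking
  homology first in the direction of \<open>\<tau>\<close> gives the sum of the groups \<open>H\<^sub>q(min \<sigma>)\<close>, so its second page is
  \<open>H\<^sub>p(\<V>; \<H>\<^sub>q)\<close>. In the other direction, for fixed \<open>\<tau>\<close> the members of the cover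
  containing \<open>\<tau>\<close> are those containing \<open>max \<tau>\<close>; since the cover is finite and basis-like they have a
  least element, so they form a cone. Hence the total complex has the homology of the space.\<close>

section \<open>Presentations of abelian groups\<close>

text \<open>Pages, homology groups and coefficient groups have unrelated carriers: cosets, cosets of
  cosets and so on. Each group is therefore described by a numerator \<open>Z\<close>, a denominator
  \<open>B\<close> and a map \<open>\<pi>\<close>, with \<open>Z\<close> and \<open>B\<close> inside
  an additive type of functions; an isomorphism becomes a comparison of numerators and denominators.
  Extension by zero makes chains of a smaller member of the cover literally chains of a larger one,
  so H_q acts on representatives as an inclusion. The face opposite to min \<sigma> carries another
  coefficient group, but its representative is unchanged. The comparison with the space uses pairs
  with empty \<sigma>, a copy of the chains of X in dimension -1. For fixed \<tau> one then has the
  augmented complex of a cone, but its apex depends on \<tau>, so these contractions do not commute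
  with the boundary in \<tau>. Acyclicity of the augmented total complex comes from repeated
  correction, the dimension of \<tau> dropping each time.\<close>

definition subg :: "'b::ab_group_add set \<Rightarrow> bool" where
  "subg A \<longleftrightarrow> 0 \<in> A \<and> (\<forall>x\<in>A. \<forall>y\<in>A. x - y \<in> A)"

definition additive_group :: "'b::ab_group_add set \<Rightarrow> 'b monoid" where
  "additive_group A = \<lparr>carrier = A, monoid.mult = (+), one = 0\<rparr>"

lemma additive_group_simps [simp]:
  "carrier (additive_group A) = A"
  "x \<otimes>\<^bsub>additive_group A\<^esub> y = x + y"
  "\<one>\<^bsub>additive_group A\<^esub> = 0"
  by (simp_all add: additive_group_def)

lemma subg_zero: "subg A \<Longrightarrow> 0 \<in> A"
  and subg_diff: "subg A \<Longrightarrow> x \<in> A \<Longrightarrow> y \<in> A \<Longrightarrow> x - y \<in> A"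
  by (auto simp: subg_def)

lemma subg_uminus: "subg A \<Longrightarrow> x \<in> A \<Longrightarrow> - x \<in> A"
  by (metis subg_def diff_0)

lemma subg_add: "subg A \<Longrightarrow> x \<in> A \<Longrightarrow> y \<in> A \<Longrightarrow> x + y \<in> A"
  by (metis subg_def diff_0 diff_minus_eq_add)

lemma subg_sum: "subg A \<Longrightarrow> (\<And>i. i \<in> I \<Longrightarrow> f i \<in> A) \<Longrightarrow> sum f I \<in> A"
  by (induction I rule: infinite_finite_induct) (auto simp: subg_zero subg_add)

lemma comm_group_additive_group: "subg A \<Longrightarrow> comm_group (additive_group A)"
  by (rule comm_groupI)
    (auto simp: subg_zero subg_add add_ac intro: bexI[of _ "- x" for x] subg_uminus)

text \<open>That is, \<pi> induces an isomorphism from Z/B to G. Nothing is asked of \<pi> outside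
  \<open>Z\<close>, so the same \<pi> serves for every smaller numerator.\<close>

definition presents :: "'b::ab_group_add set \<Rightarrow> 'b set \<Rightarrow> ('b \<Rightarrow> 'g) \<Rightarrow> 'g monoid \<Rightarrow> bool" where
  "presents Z B \<pi> G \<longleftrightarrow> subg Z \<and> B \<subseteq> Z \<and> comm_group G \<and> \<pi> ` Z = carrier G \<and>
     (\<forall>x\<in>Z. \<forall>y\<in>Z. \<pi> (x + y) = \<pi> x \<otimes>\<^bsub>G\<^esub> \<pi> y) \<and> (\<forall>x\<in>Z. \<pi> x = \<one>\<^bsub>G\<^esub> \<longleftrightarrow> x \<in> B)"

lemma presentsD:
  assumes "presents Z B \<pi> G"
  shows "subg Z" "B \<subseteq> Z" "comm_group G" "group G" "\<pi> ` Z = carrier G"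
    "\<And>x. x \<in> Z \<Longrightarrow> \<pi> x \<in> carrier G"
    "\<And>x y. x \<in> Z \<Longrightarrow> y \<in> Z \<Longrightarrow> \<pi> (x + y) = \<pi> x \<otimes>\<^bsub>G\<^esub> \<pi> y"
    "\<And>x. x \<in> Z \<Longrightarrow> \<pi> x = \<one>\<^bsub>G\<^esub> \<longleftrightarrow> x \<in> B"
  using assms by (auto simp: presents_def comm_group_def)

lemma presents_zero: "presents Z B \<pi> G \<Longrightarrow> \<pi> 0 = \<one>\<^bsub>G\<^esub>"
  using presentsD(4,6)[of Z B \<pi> G] presentsD(7)[of Z B \<pi> G 0 0]
  by (metis add_0 group.l_cancel_one' presentsD(1) subg_zero)

lemma presents_diff:
  assumes p: "presents Z B \<pi> G" and x: "x \<in> Z" and y: "y \<in> Z"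
  shows "\<pi> (x - y) = \<pi> x \<otimes>\<^bsub>G\<^esub> inv\<^bsub>G\<^esub> \<pi> y"
proof -
  interpret G: comm_group G by (rule presentsD(3)[OF p])
  have d: "x - y \<in> Z" using presentsD(1)[OF p] x y by (rule subg_diff)
  have "\<pi> x = \<pi> (x - y) \<otimes>\<^bsub>G\<^esub> \<pi> y" using presentsD(7)[OF p d y] by simp
  thus ?thesis using presentsD(6)[OF p] d x y by (simp add: G.inv_solve_right)
qed

lemma presents_eq_iff:
  assumes p: "presents Z B \<pi> G" and x: "x \<in> Z" and y: "y \<in> Z"
  shows "\<pi> x = \<pi> y \<longleftrightarrow> x - y \<in> B"
proof -
  interpret G: comm_group G by (rule presentsD(3)[OF p])
  have d: "x - y \<in> Z" using presentsD(1)[OF p] x y by (rule subg_diff)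
  have "x - y \<in> B \<longleftrightarrow> \<pi> x \<otimes>\<^bsub>G\<^esub> inv\<^bsub>G\<^esub> \<pi> y = \<one>\<^bsub>G\<^esub>"
    using presentsD(8)[OF p d] presents_diff[OF p x y] by simp
  also have "\<dots> \<longleftrightarrow> \<pi> x = \<pi> y"
    using presentsD(6)[OF p] x y by (metis G.inv_closed G.inv_equality G.inv_inv G.r_inv)
  finally show ?thesis by simp
qed

lemma presents_subg:
  assumes p: "presents Z B \<pi> G"
  shows "subg B"
  unfolding subg_def
proof (intro conjI ballI)
  show "0 \<in> B" using presents_zero[OF p] presentsD(8)[OF p] presentsD(1)[OF p] subg_zero by blast
  fix x y assume "x \<in> B" "y \<in> B"
  then show "x - y \<in> B"
    using presents_eq_iff[OF p, of x y] presentsD(2,8)[OF p] by (metis subsetD)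
qed

text \<open>Both groups are Z/B; by \<open>presents_eq_iff\<close> the chosen representative of a
  class does not matter in either of them.\<close>

lemma presents_iso:
  assumes p: "presents Z B \<pi> G" and p': "presents Z B \<pi>' G'"
  shows "G \<cong> G'"
proof -
  define h where "h g = \<pi>' (SOME z. z \<in> Z \<and> \<pi> z = g)" for g
  have h: "h (\<pi> z) = \<pi>' z" if z: "z \<in> Z" for z
  proof -
    define w where "w = (SOME w. w \<in> Z \<and> \<pi> w = \<pi> z)"
    have "w \<in> Z \<and> \<pi> w = \<pi> z" unfolding w_def using z by (metis (mono_tags, lifting) someI)
    then show ?thesis using presents_eq_iff[OF p, of w z] presents_eq_iff[OF p', of w z] z
      by (simp add: h_def w_def)
  qed
  have "h \<in> hom G G'"
  proof (rule homI)
    fix x y assume "x \<in> carrier G" "y \<in> carrier G"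
    then obtain a b where a: "a \<in> Z" "x = \<pi> a" and b: "b \<in> Z" "y = \<pi> b"
      using presentsD(5)[OF p] by (metis imageE)
    have "a + b \<in> Z" using a b presentsD(1)[OF p] subg_add by blast
    then show "h x \<in> carrier G'" "h (x \<otimes>\<^bsub>G\<^esub> y) = h x \<otimes>\<^bsub>G'\<^esub> h y"
      using a b h presentsD(6,7)[OF p'] presentsD(7)[OF p] by metis+
  qed
  moreover have "bij_betw h (carrier G) (carrier G')"
    unfolding bij_betw_def presentsD(5)[OF p, symmetric] presentsD(5)[OF p', symmetric]
    using presents_eq_iff[OF p] presents_eq_iff[OF p'] h
    by (auto simp: inj_on_def image_image)
  ultimately show ?thesis unfolding is_iso_def iso_def by blast
qed

text \<open>Dividing once more keeps the numerator and enlarges the denominator to the preimage of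
  \<open>N\<close>, so iterated quotients remain quotients of the same \<open>Z\<close>.\<close>

lemma presents_Mod:
  assumes p: "presents Z B \<pi> G" and N: "subgroup N G"
  shows "presents Z {x\<in>Z. \<pi> x \<in> N} (\<lambda>x. N #>\<^bsub>G\<^esub> \<pi> x) (G Mod N)"
proof -
  interpret G: comm_group G by (rule presentsD(3)[OF p])
  interpret N: normal N G using N by (simp add: G.subgroup_imp_normal)
  show ?thesis unfolding presents_def
  proof (intro conjI ballI)
    show "comm_group (G Mod N)" using N by (rule G.abelian_FactGroup)
    show "(\<lambda>x. N #>\<^bsub>G\<^esub> \<pi> x) ` Z = carrier (G Mod N)"
      unfolding carrier_FactGroup presentsD(5)[OF p, symmetric] by (simp add: image_image)
  next
    fix x y assume "x \<in> Z" "y \<in> Z"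
    then show "N #>\<^bsub>G\<^esub> \<pi> (x + y) = (N #>\<^bsub>G\<^esub> \<pi> x) \<otimes>\<^bsub>G Mod N\<^esub> (N #>\<^bsub>G\<^esub> \<pi> y)"
      using presentsD(6,7)[OF p] by (simp add: N.rcos_sum)
  next
    fix x assume "x \<in> Z"
    then show "(N #>\<^bsub>G\<^esub> \<pi> x = \<one>\<^bsub>G Mod N\<^esub>) = (x \<in> {x \<in> Z. \<pi> x \<in> N})"
      using presentsD(6)[OF p] G.coset_join1[OF _ _ N] G.coset_join2[OF _ N] by auto
  qed (use presentsD[OF p] in auto)
qed

lemma presents_carrier_update:
  assumes p: "presents Z B \<pi> G" and Z': "subg Z'" "Z' \<subseteq> Z"
  shows "subgroup (\<pi> ` Z') G" and "presents Z' (Z' \<inter> B) \<pi> (G\<lparr>carrier := \<pi> ` Z'\<rparr>)"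
proof -
  interpret G: comm_group G by (rule presentsD(3)[OF p])
  show s: "subgroup (\<pi> ` Z') G"
  proof (rule G.subgroupI)
    show "\<pi> ` Z' \<subseteq> carrier G" "\<pi> ` Z' \<noteq> {}" using presentsD(6)[OF p] Z' subg_zero by auto
    fix a b assume "a \<in> \<pi> ` Z'" "b \<in> \<pi> ` Z'"
    then obtain x y where x: "x \<in> Z'" "a = \<pi> x" and y: "y \<in> Z'" "b = \<pi> y" by auto
    show "a \<otimes>\<^bsub>G\<^esub> b \<in> \<pi> ` Z'"
      using x y Z' presentsD(7)[OF p, of x y] subg_add[OF Z'(1), of x y] by (metis image_eqI subsetD)
    have "\<pi> (0 - x) = inv\<^bsub>G\<^esub> a"
      using presents_diff[OF p, of 0 x] presents_zero[OF p] x Z' subg_zero[OF Z'(1)] presentsD(6)[OF p]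
      by (metis G.inv_closed G.l_one subsetD)
    then show "inv\<^bsub>G\<^esub> a \<in> \<pi> ` Z'"
      using x subg_diff[OF Z'(1) subg_zero[OF Z'(1)], of x] by (metis image_eqI)
  qed
  show "presents Z' (Z' \<inter> B) \<pi> (G\<lparr>carrier := \<pi> ` Z'\<rparr>)"
    unfolding presents_def
  proof (intro conjI ballI)
    have "group (G\<lparr>carrier := \<pi> ` Z'\<rparr>)" using s by (rule G.subgroup_imp_group)
    then show "comm_group (G\<lparr>carrier := \<pi> ` Z'\<rparr>)"
      using Z'(2) presentsD(6)[OF p] G.m_comm by (intro group.group_comm_groupI) (auto, blast)
  qed (use presentsD(7,8)[OF p] Z' in auto)
qed

text \<open>First isomorphism theorem for \<alpha> followed by \<pi>, with surjectivity only modulo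
  \<open>B\<close>. It is applied with the identity for the next page, with the leading component
  for the second page and with the augmentation for the total complex.\<close>

lemma presents_pull:
  assumes p: "presents Z B \<pi> G" and Z': "subg Z'"
    and add: "\<And>x y. x \<in> Z' \<Longrightarrow> y \<in> Z' \<Longrightarrow> \<alpha> (x + y) = \<alpha> x + \<alpha> y"
    and into: "\<And>x. x \<in> Z' \<Longrightarrow> \<alpha> x \<in> Z"
    and onto: "\<And>z. z \<in> Z \<Longrightarrow> \<exists>x\<in>Z'. z - \<alpha> x \<in> B"
    and ker: "\<And>x. x \<in> Z' \<Longrightarrow> \<alpha> x \<in> B \<longleftrightarrow> x \<in> B'" and "B' \<subseteq> Z'"
  shows "presents Z' B' (\<lambda>x. \<pi> (\<alpha> x)) G"
  unfolding presents_def
proof (intro conjI ballI)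
  show "(\<lambda>x. \<pi> (\<alpha> x)) ` Z' = carrier G"
  proof (intro equalityI subsetI)
    fix g assume "g \<in> carrier G"
    then obtain z where z: "z \<in> Z" "g = \<pi> z" using presentsD(5)[OF p] by blast
    obtain x where x: "x \<in> Z'" "z - \<alpha> x \<in> B" using onto[OF z(1)] by blast
    have "g = \<pi> (\<alpha> x)" using z(2) x(2) presents_eq_iff[OF p z(1) into[OF x(1)]] by simp
    then show "g \<in> (\<lambda>x. \<pi> (\<alpha> x)) ` Z'" using x(1) by (rule image_eqI)
  qed (use into presentsD(6)[OF p] in blast)
next
  fix x assume x: "x \<in> Z'"
  show "(\<pi> (\<alpha> x) = \<one>\<^bsub>G\<^esub>) = (x \<in> B')"
    using presentsD(8)[OF p into[OF x]] ker[OF x] by simp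
  fix y assume y: "y \<in> Z'"
  show "\<pi> (\<alpha> (x + y)) = \<pi> (\<alpha> x) \<otimes>\<^bsub>G\<^esub> \<pi> (\<alpha> y)"
    using presentsD(7)[OF p into[OF x] into[OF y]] add[OF x y] by simp
qed (use Z' \<open>B' \<subseteq> Z'\<close> presentsD(3)[OF p] in simp_all)

text \<open>The maps f and g act on representatives by \<phi> and \<psi>. A cycle is an element that
  \<psi> takes into the third denominator, a boundary one that agrees with some
  \<open>\<phi> y\<close> modulo the second; so the composite has to vanish only modulo
  \<open>B3\<close>.\<close>

lemma presents_homology_at:
  assumes p1: "presents Z1 B1 \<pi>1 G1" and p2: "presents Z2 B2 \<pi>2 G2" and p3: "presents Z3 B3 \<pi>3 G3"
    and f: "\<And>x. x \<in> Z1 \<Longrightarrow> \<phi> x \<in> Z2 \<and> f (\<pi>1 x) = \<pi>2 (\<phi> x)"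
    and g: "\<And>x. x \<in> Z2 \<Longrightarrow> \<psi> x \<in> Z3 \<and> g (\<pi>2 x) = \<pi>3 (\<psi> x)"
    and f_add: "\<And>x y. x \<in> Z1 \<Longrightarrow> y \<in> Z1 \<Longrightarrow> \<phi> (x - y) = \<phi> x - \<phi> y"
    and g_add: "\<And>x y. x \<in> Z2 \<Longrightarrow> y \<in> Z2 \<Longrightarrow> \<psi> (x - y) = \<psi> x - \<psi> y"
    and gf: "\<And>x. x \<in> Z1 \<Longrightarrow> \<psi> (\<phi> x) \<in> B3"
  shows "presents {x\<in>Z2. \<psi> x \<in> B3} {x\<in>Z2. \<psi> x \<in> B3 \<and> (\<exists>y\<in>Z1. x - \<phi> y \<in> B2)}
    (\<lambda>x. (f ` carrier G1) #>\<^bsub>G2\<^esub> \<pi>2 x) (homology_at G1 f G2 g G3)"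
proof -
  let ?K = "{x\<in>Z2. \<psi> x \<in> B3}"
  note Z1 = presentsD(1)[OF p1] and Z2 = presentsD(1)[OF p2] and B3 = presents_subg[OF p3]
  have "\<psi> 0 = 0" using g_add[of 0 0] Z2 subg_zero by fastforce
  then have K: "subg ?K" using Z2 B3 g_add by (auto simp: subg_def)
  have "\<phi> 0 = 0" using f_add[of 0 0] Z1 subg_zero by fastforce
  have I: "subg (\<phi> ` Z1)" "\<phi> ` Z1 \<subseteq> ?K"
    using f gf f_add \<open>\<phi> 0 = 0\<close> Z1 by (auto simp: subg_def image_iff; metis)+
  have ker: "kernel G2 G3 g = \<pi>2 ` ?K"
    unfolding kernel_def presentsD(5)[OF p2, symmetric] using g presentsD(8)[OF p3] by auto
  have im: "f ` carrier G1 = \<pi>2 ` (\<phi> ` Z1)"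
    unfolding presentsD(5)[OF p1, symmetric] image_image using f by (auto intro!: image_cong)
  have p: "presents ?K (?K \<inter> B2) \<pi>2 (G2\<lparr>carrier := kernel G2 G3 g\<rparr>)" (is "presents _ _ _ ?G")
    unfolding ker by (rule presents_carrier_update(2)[OF p2 K]) auto
  have N: "subgroup (f ` carrier G1) ?G"
    unfolding im by (rule presents_carrier_update(1)[OF p I])
  have eq: "{x \<in> ?K. \<pi>2 x \<in> f ` carrier G1} = {x\<in>Z2. \<psi> x \<in> B3 \<and> (\<exists>y\<in>Z1. x - \<phi> y \<in> B2)}"
    unfolding im using f presents_eq_iff[OF p2] by (auto simp: image_iff)
  show ?thesis using presents_Mod[OF p N] unfolding eq homology_at_def r_coset_def by simp
qed

section \<open>Quotients of subgroups of an additive type and the maps between them\<close>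

definition quot_group :: "'b::ab_group_add set \<Rightarrow> 'b set \<Rightarrow> 'b set monoid" where
  "quot_group Z B = additive_group Z Mod B"

text \<open>This acts on a coset as a set, without a choice of representative. Adding
  \<open>B\<close> fills the image up to a full coset, since \<phi> need not map onto the target
  denominator.\<close>

definition quot_map :: "'b::ab_group_add set \<Rightarrow> ('b \<Rightarrow> 'b) \<Rightarrow> 'b set \<Rightarrow> 'b set" where
  "quot_map B \<phi> A = {b + \<phi> a | a b. a \<in> A \<and> b \<in> B}"

definition add_coset :: "'b::ab_group_add set \<Rightarrow> 'b \<Rightarrow> 'b set" where
  "add_coset B x = {b + x | b. b \<in> B}"

lemma presents_quot_group:
  assumes Z: "subg Z" and B: "subg B" "B \<subseteq> Z"
  shows "presents Z B (add_coset B) (quot_group Z B)"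
proof -
  have p: "presents Z {0} id (additive_group Z)"
    using Z subg_zero by (auto simp: presents_def comm_group_additive_group)
  have "subgroup B (additive_group Z)"
    using presents_carrier_update(1)[OF p B] by simp
  note presents_Mod[OF p this]
  moreover have "{x \<in> Z. id x \<in> B} = B" using B(2) by auto
  moreover have "B #>\<^bsub>additive_group Z\<^esub> id x = add_coset B x" for x
    by (auto simp: r_coset_def add_coset_def)
  ultimately show ?thesis by (simp add: quot_group_def)
qed

lemma quot_map_coset:
  assumes B: "subg B" "subg B'" and xB: "x \<in> Z" "B \<subseteq> Z"
    and add: "\<And>x y. x \<in> Z \<Longrightarrow> y \<in> Z \<Longrightarrow> \<phi> (x + y) = \<phi> x + \<phi> y"
    and BB': "\<And>b. b \<in> B \<Longrightarrow> \<phi> b \<in> B'"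
  shows "quot_map B' \<phi> (add_coset B x) = add_coset B' (\<phi> x)"
proof -
  have *: "\<phi> (b + x) = \<phi> b + \<phi> x" if "b \<in> B" for b using add that xB by blast
  have 0: "\<phi> (0 + x) = \<phi> x" by simp
  show ?thesis unfolding quot_map_def add_coset_def
  proof (intro equalityI subsetI)
    fix y assume "y \<in> {b + \<phi> a |a b. a \<in> {b + x |b. b \<in> B} \<and> b \<in> B'}"
    then obtain b b' where "y = b' + \<phi> (b + x)" "b \<in> B" "b' \<in> B'" by blast
    then have "y = (b' + \<phi> b) + \<phi> x" "b' + \<phi> b \<in> B'"
      using *[of b] BB'[of b] subg_add[OF B(2)] by (simp_all add: add_ac)
    then show "y \<in> {b + \<phi> x |b. b \<in> B'}" by blast
  next
    fix y assume "y \<in> {b + \<phi> x |b. b \<in> B'}"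
    then obtain b' where "y = b' + \<phi> (0 + x)" "b' \<in> B'" by auto
    then show "y \<in> {b + \<phi> a |a b. a \<in> {b + x |b. b \<in> B} \<and> b \<in> B'}"
      using subg_zero[OF B(1)] by blast
  qed
qed

section \<open>Direct sums and simplicial boundaries\<close>

lemma comm_group_sum_group:
  assumes "\<And>i. i \<in> I \<Longrightarrow> comm_group (G i)"
  shows "comm_group (sum_group I G)"
proof -
  have g: "\<And>i. i \<in> I \<Longrightarrow> group (G i)" using assms by (simp add: comm_group_def)
  show ?thesis
  proof (rule group.group_comm_groupI)
    show "group (sum_group I G)" using g by (rule sum_group)
    fix x y assume "x \<in> carrier (sum_group I G)" "y \<in> carrier (sum_group I G)"
    then have "x i \<otimes>\<^bsub>G i\<^esub> y i = y i \<otimes>\<^bsub>G i\<^esub> x i" if "i \<in> I" for i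
      using that assms[OF that]
      by (auto simp: carrier_sum_group g PiE_iff comm_group_def comm_monoid.m_comm)
    then show "x \<otimes>\<^bsub>sum_group I G\<^esub> y = y \<otimes>\<^bsub>sum_group I G\<^esub> x"
      by (auto intro: restrict_ext)
  qed
qed

lemma carrier_sum_group_finite:
  assumes "finite I" "\<And>i. i \<in> I \<Longrightarrow> group (G i)"
  shows "carrier (sum_group I G) = (\<Pi>\<^sub>E i\<in>I. carrier (G i))"
  using assms by (simp add: carrier_sum_group)

lemma finprod_sum_group_apply:
  assumes G: "\<And>i. i \<in> I \<Longrightarrow> comm_group (G i)" and f: "f \<in> A \<rightarrow> carrier (sum_group I G)" and i: "i \<in> I"
  shows "finprod (sum_group I G) f A i = finprod (G i) (\<lambda>a. f a i) A"
proof (cases "finite A")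
  case True
  interpret S: comm_group "sum_group I G" using G by (rule comm_group_sum_group)
  interpret Gi: comm_group "G i" using G i by blast
  have c: "x i \<in> carrier (G i)" if "x \<in> carrier (sum_group I G)" for x
    using that i G by (simp add: carrier_sum_group comm_group_def PiE_iff)
  show ?thesis using True f
  proof (induction A)
    case (insert a A)
    then have fa: "f a \<in> carrier (sum_group I G)" "f \<in> A \<rightarrow> carrier (sum_group I G)" by auto
    have "finprod (sum_group I G) f (insert a A) i = (f a \<otimes>\<^bsub>sum_group I G\<^esub> finprod (sum_group I G) f A) i"
      by (rule arg_cong[OF S.finprod_insert[OF insert.hyps fa(2,1)], of "\<lambda>x. x i"])
    also have "\<dots> = f a i \<otimes>\<^bsub>G i\<^esub> finprod (G i) (\<lambda>a. f a i) A"
      using i insert.IH fa by simp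
    also have "\<dots> = finprod (G i) (\<lambda>a. f a i) (insert a A)"
      using insert.hyps fa c by (subst Gi.finprod_insert) (auto simp: Pi_iff)
    finally show ?case .
  qed (simp add: i)
next
  case False
  then show ?thesis
    using i G by (simp add: comm_monoid.finprod_infinite comm_group_sum_group comm_group.axioms(1))
qed

lemma int_pow_sum_group_apply:
  assumes G: "\<And>i. i \<in> I \<Longrightarrow> comm_group (G i)" and x: "x \<in> carrier (sum_group I G)" and i: "i \<in> I"
  shows "(x [^]\<^bsub>sum_group I G\<^esub> (k::int)) i = x i [^]\<^bsub>G i\<^esub> k"
proof -
  have S: "group (sum_group I G)" and Gi: "group (G i)"
    using comm_group_sum_group[of I G] G i by (auto simp: comm_group_def)
  have "(\<lambda>x. x i) \<in> hom (sum_group I G) (G i)"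
    using i G by (auto simp: hom_def carrier_sum_group comm_group_def PiE_iff)
  from hom_int_pow[OF this x S Gi] show ?thesis .
qed

lemma presents_finprod:
  assumes p: "presents Z B \<pi> G" and u: "\<And>a. a \<in> A \<Longrightarrow> u a \<in> Z"
  shows "finprod G (\<lambda>a. \<pi> (u a)) A = \<pi> (sum u A)"
proof -
  interpret G: comm_group G by (rule presentsD(3)[OF p])
  show ?thesis using u
  proof (induction A rule: infinite_finite_induct)
    case (insert a A)
    then have "sum u A \<in> Z" by (intro subg_sum[OF presentsD(1)[OF p]]) auto
    with insert show ?case using presentsD(6,7)[OF p] by (subst G.finprod_insert) (auto simp: Pi_iff)
  qed (simp_all add: presents_zero[OF p])
qed

text \<open>Elements of \<open>sum_group\<close> are \<open>undefined\<close> off the index set; the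
  representatives are 0 there, so that they form a subgroup of the whole function type. Finiteness
  of \<open>I\<close> removes the finite-support condition.\<close>

lemma presents_sum_group:
  assumes I: "finite I" and p: "\<And>i. i \<in> I \<Longrightarrow> presents (Z i) (B i) (\<pi> i) (G i)"
  shows "presents {u. \<forall>i. if i \<in> I then u i \<in> Z i else u i = 0}
    {u. \<forall>i. if i \<in> I then u i \<in> B i else u i = 0}
    (\<lambda>u. \<lambda>i\<in>I. \<pi> i (u i)) (sum_group I G)"
proof -
  have G: "comm_group (G i)" "group (G i)" if "i \<in> I" for i using presentsD[OF p[OF that]] by auto
  have carr: "carrier (sum_group I G) = (\<Pi>\<^sub>E i\<in>I. carrier (G i))"
    using I G(2) by (rule carrier_sum_group_finite)
  show ?thesis unfolding presents_def
  proof (intro conjI ballI)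
    show "subg {u. \<forall>i. if i \<in> I then u i \<in> Z i else u i = 0}"
      using presentsD(1)[OF p] by (auto simp: subg_def)
    show "{u. \<forall>i. if i \<in> I then u i \<in> B i else u i = 0} \<subseteq> {u. \<forall>i. if i \<in> I then u i \<in> Z i else u i = 0}"
      using presentsD(2)[OF p] by (force split: if_splits)
    show "comm_group (sum_group I G)" using G(1) by (rule comm_group_sum_group)
    show "(\<lambda>u. \<lambda>i\<in>I. \<pi> i (u i)) ` {u. \<forall>i. if i \<in> I then u i \<in> Z i else u i = 0} = carrier (sum_group I G)"
    proof (intro equalityI subsetI)
      fix g assume "g \<in> carrier (sum_group I G)"
      then have g: "g \<in> (\<Pi>\<^sub>E i\<in>I. carrier (G i))" by (simp only: carr)
      have "\<exists>z. (if i \<in> I then z \<in> Z i \<and> g i = \<pi> i z else z = 0)" for i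
        using g presentsD(5)[OF p, of i] by (cases "i \<in> I") (auto simp: PiE_iff image_iff)
      then obtain u where u: "\<And>i. if i \<in> I then u i \<in> Z i \<and> g i = \<pi> i (u i) else u i = 0" by metis
      then have "g = (\<lambda>i\<in>I. \<pi> i (u i))" using g by (auto simp: PiE_iff extensional_def restrict_def)
      then show "g \<in> (\<lambda>u. \<lambda>i\<in>I. \<pi> i (u i)) ` {u. \<forall>i. if i \<in> I then u i \<in> Z i else u i = 0}"
        by (rule image_eqI[where x = u]) (use u in auto)
    next
      fix g assume "g \<in> (\<lambda>u. \<lambda>i\<in>I. \<pi> i (u i)) ` {u. \<forall>i. if i \<in> I then u i \<in> Z i else u i = 0}"
      then obtain u where u: "g = (\<lambda>i\<in>I. \<pi> i (u i))" "\<And>i. if i \<in> I then u i \<in> Z i else u i = 0" by auto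
      have "\<pi> i (u i) \<in> carrier (G i)" if "i \<in> I" for i
        using presentsD(6)[OF p[OF that], of "u i"] u(2)[of i] that by simp
      then show "g \<in> carrier (sum_group I G)" unfolding carr u(1) by auto
    qed
  next
    fix u assume u: "u \<in> {u. \<forall>i. if i \<in> I then u i \<in> Z i else u i = 0}"
    have *: "\<pi> i (u i) = \<one>\<^bsub>G i\<^esub> \<longleftrightarrow> u i \<in> B i" if "i \<in> I" for i
      using presentsD(8)[OF p[OF that], of "u i"] u that by (auto dest!: spec[of _ i])
    have "((\<lambda>i\<in>I. \<pi> i (u i)) = (\<lambda>i\<in>I. \<one>\<^bsub>G i\<^esub>)) \<longleftrightarrow> (\<forall>i\<in>I. \<pi> i (u i) = \<one>\<^bsub>G i\<^esub>)"
      by (auto simp: fun_eq_iff restrict_def)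
    then show "((\<lambda>i\<in>I. \<pi> i (u i)) = \<one>\<^bsub>sum_group I G\<^esub>) = (u \<in> {u. \<forall>i. if i \<in> I then u i \<in> B i else u i = 0})"
      using * u by (auto split: if_splits)
    fix w assume w: "w \<in> {u. \<forall>i. if i \<in> I then u i \<in> Z i else u i = 0}"
    have "\<pi> i (u i + w i) = \<pi> i (u i) \<otimes>\<^bsub>G i\<^esub> \<pi> i (w i)" if "i \<in> I" for i
      using presentsD(7)[OF p[OF that], of "u i" "w i"] u w that by (auto dest!: spec[of _ i])
    then show "(\<lambda>i\<in>I. \<pi> i ((u + w) i)) = (\<lambda>i\<in>I. \<pi> i (u i)) \<otimes>\<^bsub>sum_group I G\<^esub> (\<lambda>i\<in>I. \<pi> i (w i))"
      by (auto simp: fun_eq_iff restrict_def)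
  qed
qed

text \<open>For v outside \<sigma> this is the position that v takes in
  \<open>insert v \<sigma>\<close>, hence the exponent of the sign with which \<sigma> occurs in the
  boundary of that chain.\<close>

definition rank :: "'a rel \<Rightarrow> 'a set \<Rightarrow> 'a \<Rightarrow> nat" where
  "rank r \<sigma> v = card {y \<in> \<sigma>. y \<noteq> v \<and> (y, v) \<in> r}"

definition alt :: "nat \<Rightarrow> 'b::ab_group_add \<Rightarrow> 'b" where
  "alt k x = (if even k then x else - x)"

text \<open>At the empty chain this is the augmentation.\<close>

definition aug_bd :: "'a rel \<Rightarrow> ('a set \<Rightarrow> 'b::ab_group_add) \<Rightarrow> 'a set \<Rightarrow> 'b" where
  "aug_bd r u \<sigma> = (\<Sum>v\<in>Field r - \<sigma>. alt (rank r \<sigma> v) (u (insert v \<sigma>)))"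

text \<open>The boundary is read off at a face: the coefficient at \<sigma> collects the chains with
  one more vertex, so no vertex has to be located and deleted. The value 0 at \<open>{}\<close>
  drops the augmentation.\<close>

definition bd :: "'a rel \<Rightarrow> ('a set \<Rightarrow> 'b::ab_group_add) \<Rightarrow> 'a set \<Rightarrow> 'b" where
  "bd r u \<sigma> = (if \<sigma> = {} then 0 else aug_bd r u \<sigma>)"

lemma alt_simps [simp]:
  "alt k 0 = 0" "alt 0 x = x" "alt (Suc k) x = - alt k x" "alt k (- x) = - alt k x"
  "alt k (alt k x) = x"
  by (auto simp: alt_def)

lemma alt_add: "alt k (x + y) = alt k x + alt k y"
  and alt_diff: "alt k (x - y) = alt k x - alt k y"
  and alt_commute: "alt j (alt k x) = alt k (alt j x)"
  by (auto simp: alt_def)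

lemma alt_sum: "alt k (sum f A) = (\<Sum>a\<in>A. alt k (f a))"
  by (simp add: alt_def sum_negf)

lemma alt_apply [simp]: "alt k f x = alt k (f x)"
  by (auto simp: alt_def)

lemma alt_eq_0_iff [simp]: "alt k x = 0 \<longleftrightarrow> x = 0"
  by (auto simp: alt_def)

lemma subg_alt: "subg A \<Longrightarrow> alt k x \<in> A \<longleftrightarrow> x \<in> A"
  using subg_uminus[of A x] subg_uminus[of A "- x"] by (auto simp: alt_def)

lemma sum_fun_apply: "(\<Sum>a\<in>A. f a) x = (\<Sum>a\<in>A. f a x)"
  by (induction A rule: infinite_finite_induct) auto

lemma aug_bd_add: "aug_bd r (u + w) = aug_bd r u + aug_bd r w"
  and aug_bd_diff: "aug_bd r (u - w) = aug_bd r u - aug_bd r w"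
  by (auto simp: aug_bd_def fun_eq_iff alt_add alt_diff sum.distrib sum_subtractf)

lemma bd_add: "bd r (u + w) = bd r u + bd r w"
  and bd_diff: "bd r (u - w) = bd r u - bd r w"
  by (auto simp: bd_def fun_eq_iff aug_bd_add aug_bd_diff)

section \<open>Chains of a finite poset and the numbering of their vertices\<close>

lemma Chains_subset: "\<tau> \<subseteq> \<sigma> \<Longrightarrow> \<sigma> \<in> Chains r \<Longrightarrow> \<tau> \<in> Chains r"
  by (auto simp: Chains_def)

lemma Chains_Field: "\<sigma> \<in> Chains r \<Longrightarrow> \<sigma> \<subseteq> Field r"
  by (auto simp: Chains_def Field_def)

lemma rank_insert:
  assumes "finite \<sigma>" "w \<notin> \<sigma>" "w \<noteq> v"
  shows "rank r (insert w \<sigma>) v = (if (w, v) \<in> r then Suc (rank r \<sigma> v) else rank r \<sigma> v)"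
proof -
  have "{y \<in> insert w \<sigma>. y \<noteq> v \<and> (y, v) \<in> r} =
      (if (w, v) \<in> r then insert w {y \<in> \<sigma>. y \<noteq> v \<and> (y, v) \<in> r} else {y \<in> \<sigma>. y \<noteq> v \<and> (y, v) \<in> r})"
    using assms by auto
  then show ?thesis using assms by (auto simp: rank_def)
qed

locale finite_poset =
  fixes r :: "'a rel"
  assumes finite_Field [simp]: "finite (Field r)" and po: "Partial_order r"
begin

lemma refl: "x \<in> Field r \<Longrightarrow> (x, x) \<in> r"
  using po by (auto simp: partial_order_on_def preorder_on_def refl_on_def)

lemma antisym: "(x, y) \<in> r \<Longrightarrow> (y, x) \<in> r \<Longrightarrow> x = y"
  using po by (auto simp: partial_order_on_def dest: antisymD)

lemma trans: "(x, y) \<in> r \<Longrightarrow> (y, z) \<in> r \<Longrightarrow> (x, z) \<in> r"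
  using po by (auto simp: partial_order_on_def preorder_on_def dest: transD)

lemma finite_Chains: "\<sigma> \<in> Chains r \<Longrightarrow> finite \<sigma>"
  using Chains_Field finite_subset by fastforce

text \<open>Swapping the two removed vertices changes the sign.\<close>

lemma aug_bd_aug_bd:
  assumes u: "\<And>\<sigma>. u \<sigma> \<noteq> 0 \<Longrightarrow> \<sigma> \<in> Chains r"
  shows "aug_bd r (aug_bd r u) \<sigma> = 0"
proof -
  define g where "g v w = alt (rank r \<sigma> v) (alt (rank r (insert v \<sigma>) w) (u (insert w (insert v \<sigma>))))" for v w
  define P where "P = (SIGMA v:Field r - \<sigma>. Field r - insert v \<sigma>)"
  \<comment> \<open>One order of each comparable pair; swapping gives the other order. An
    incomparable pair lies in no chain, so \<open>u\<close> vanishes on it.\<close>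
  define P1 where "P1 = {p \<in> P. (fst p, snd p) \<in> r}"
  have "aug_bd r (aug_bd r u) \<sigma> = (\<Sum>v\<in>Field r - \<sigma>. \<Sum>w\<in>Field r - insert v \<sigma>. g v w)"
    by (simp add: aug_bd_def g_def alt_sum)
  also have "\<dots> = (\<Sum>p\<in>P. g (fst p) (snd p))"
    unfolding P_def by (subst sum.Sigma) (auto simp: case_prod_beta)
  also have "\<dots> = (\<Sum>p\<in>P1 \<union> prod.swap ` P1. g (fst p) (snd p))"
  proof (rule sum.mono_neutral_right)
    show "finite P" by (simp add: P_def)
    show "P1 \<union> prod.swap ` P1 \<subseteq> P" by (auto simp: P1_def P_def)
    show "\<forall>p\<in>P - (P1 \<union> prod.swap ` P1). g (fst p) (snd p) = 0"
    proof
      fix p assume p: "p \<in> P - (P1 \<union> prod.swap ` P1)"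
      obtain v w where vw: "p = (v, w)" by (cases p)
      have "(w, v) \<in> P" using p vw by (auto simp: P_def)
      then have "(v, w) \<notin> r" "(w, v) \<notin> r" using p vw by (auto simp: P1_def image_iff)
      then have "insert w (insert v \<sigma>) \<notin> Chains r" by (auto simp: Chains_def)
      then show "g (fst p) (snd p) = 0" using u by (auto simp: g_def vw)
    qed
  qed
  also have "\<dots> = (\<Sum>p\<in>P1. g (fst p) (snd p)) + (\<Sum>p\<in>prod.swap ` P1. g (fst p) (snd p))"
  proof (rule sum.union_disjoint)
    have "finite P" by (simp add: P_def)
    then show "finite P1" "finite (prod.swap ` P1)" by (auto simp: P1_def)
    show "P1 \<inter> prod.swap ` P1 = {}" using antisym by (auto simp: P1_def P_def)
  qed
  also have "(\<Sum>p\<in>prod.swap ` P1. g (fst p) (snd p)) = (\<Sum>p\<in>P1. g (snd p) (fst p))"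
    by (subst sum.reindex) (auto intro: inj_onI)
  also have "\<dots> = (\<Sum>p\<in>P1. - g (fst p) (snd p))"
  proof (rule sum.cong)
    fix p assume p: "p \<in> P1"
    obtain v w where vw: "p = (v, w)" by (cases p)
    have *: "v \<noteq> w" "v \<notin> \<sigma>" "w \<notin> \<sigma>" "(v, w) \<in> r" "(w, v) \<notin> r"
      using p vw antisym by (auto simp: P1_def P_def)
    show "g (snd p) (fst p) = - g (fst p) (snd p)"
    proof (cases "insert w (insert v \<sigma>) \<in> Chains r")
      case True
      then have "finite \<sigma>" using finite_Chains by fastforce
      then show ?thesis using * by (simp add: vw g_def rank_insert insert_commute alt_commute)
    next
      case False
      then show ?thesis using u by (force simp: vw g_def insert_commute)
    qed
  qed simp
  finally show ?thesis by (simp add: sum_negf)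
qed

lemma bd_bd:
  assumes u: "\<And>\<sigma>. u \<sigma> \<noteq> 0 \<Longrightarrow> \<sigma> \<in> Chains r"
  shows "bd r (bd r u) \<sigma> = 0"
proof -
  \<comment> \<open>\<open>insert v \<sigma>\<close> is never empty, so the outer operator does not
    see the value at \<open>{}\<close> that \<open>bd\<close> discards.\<close>
  have "aug_bd r (bd r u) \<sigma> = aug_bd r (aug_bd r u) \<sigma>"
    by (simp add: aug_bd_def bd_def)
  moreover have "aug_bd r (aug_bd r u) \<sigma> = 0" using u by (rule aug_bd_aug_bd)
  ultimately show ?thesis by (simp add: bd_def)
qed

lemma rank_inj:
  assumes "\<sigma> \<in> Chains r" "x \<in> \<sigma>" "y \<in> \<sigma>" "rank r \<sigma> x = rank r \<sigma> y"
  shows "x = y"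
proof -
  have *: "rank r \<sigma> x < rank r \<sigma> y" if "x \<in> \<sigma>" "y \<in> \<sigma>" "(x, y) \<in> r" "x \<noteq> y" for x y
    unfolding rank_def
  proof (rule psubset_card_mono)
    show "finite {z \<in> \<sigma>. z \<noteq> y \<and> (z, y) \<in> r}" using finite_Chains assms(1) by auto
    show "{z \<in> \<sigma>. z \<noteq> x \<and> (z, x) \<in> r} \<subset> {z \<in> \<sigma>. z \<noteq> y \<and> (z, y) \<in> r}"
      using that trans antisym by blast
  qed
  show ?thesis using assms *[of x y] *[of y x] by (fastforce simp: Chains_def)
qed

text \<open>An injection into a set of the same size. It makes \<open>vertex\<close> well defined at
  every index below the cardinality.\<close>

lemma rank_bij:
  assumes "\<sigma> \<in> Chains r"
  shows "bij_betw (rank r \<sigma>) \<sigma> {..<card \<sigma>}"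
proof -
  have f: "finite \<sigma>" using finite_Chains assms .
  have i: "inj_on (rank r \<sigma>) \<sigma>" using rank_inj[OF assms] by (auto intro: inj_onI)
  have "rank r \<sigma> x < card \<sigma>" if "x \<in> \<sigma>" for x
    unfolding rank_def using f that by (intro psubset_card_mono) auto
  then have "rank r \<sigma> ` \<sigma> \<subseteq> {..<card \<sigma>}" by auto
  then have "rank r \<sigma> ` \<sigma> = {..<card \<sigma>}"
    by (rule card_subset_eq[rotated]) (auto simp: card_image[OF i])
  with i show ?thesis by (simp add: bij_betw_def)
qed

lemma vertex_eqI:
  assumes "\<sigma> \<in> Chains r" "x \<in> \<sigma>" "rank r \<sigma> x = i"
  shows "vertex r \<sigma> i = x"
  unfolding vertex_def rank_def[symmetric] using assms rank_inj by (intro the_equality) auto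

lemma vertex:
  assumes "\<sigma> \<in> Chains r" "i < card \<sigma>"
  shows "vertex r \<sigma> i \<in> \<sigma>" "rank r \<sigma> (vertex r \<sigma> i) = i"
proof -
  obtain x where "x \<in> \<sigma>" "rank r \<sigma> x = i"
    using rank_bij[OF assms(1)] assms(2) by (metis bij_betw_iff_bijections lessThan_iff)
  then show "vertex r \<sigma> i \<in> \<sigma>" "rank r \<sigma> (vertex r \<sigma> i) = i" using vertex_eqI assms by auto
qed

lemma vertex_0_eqI:
  assumes "\<sigma> \<in> Chains r" "x \<in> \<sigma>" "\<And>y. y \<in> \<sigma> \<Longrightarrow> (x, y) \<in> r"
  shows "vertex r \<sigma> 0 = x"
proof (rule vertex_eqI[OF assms(1,2)])
  have "{y \<in> \<sigma>. y \<noteq> x \<and> (y, x) \<in> r} = {}" using assms antisym by blast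
  then show "rank r \<sigma> x = 0" unfolding rank_def by (simp only: card.empty)
qed

lemma vertex_0:
  assumes "\<sigma> \<in> Chains r" "\<sigma> \<noteq> {}"
  shows "vertex r \<sigma> 0 \<in> \<sigma>" "\<And>y. y \<in> \<sigma> \<Longrightarrow> (vertex r \<sigma> 0, y) \<in> r"
proof -
  have f: "finite \<sigma>" using finite_Chains assms by blast
  then have "0 < card \<sigma>" using assms(2) by (simp add: card_gt_0_iff)
  note v = vertex[OF assms(1) this]
  show "vertex r \<sigma> 0 \<in> \<sigma>" by (rule v)
  have "{y \<in> \<sigma>. y \<noteq> vertex r \<sigma> 0 \<and> (y, vertex r \<sigma> 0) \<in> r} = {}" using v(2) f by (simp add: rank_def)
  then show "(vertex r \<sigma> 0, y) \<in> r" if "y \<in> \<sigma>" for y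
    using that v(1) assms(1) by (cases "y = vertex r \<sigma> 0") (auto simp: Chains_def)
qed

text \<open>Passing to a face can only raise the minimum. This is the arrow along which a covariant
  functor pushes coefficients to the face.\<close>

lemma vertex_0_mono:
  assumes "\<sigma> \<in> Chains r" "\<tau> \<subseteq> \<sigma>" "\<tau> \<noteq> {}"
  shows "(vertex r \<sigma> 0, vertex r \<tau> 0) \<in> r"
  using assms Chains_subset[OF assms(2,1)] by (intro vertex_0) (auto dest: vertex_0(1))

end

section \<open>Homology with coefficients in a presented functor\<close>

lemma Ch_iff: "\<sigma> \<in> Ch r n \<longleftrightarrow> \<sigma> \<in> Chains r \<and> 0 \<le> n \<and> int (card \<sigma>) = n + 1"
  by (auto simp: Ch_def)

text \<open>On representatives every arrow acts as the inclusion of \<open>Z x\<close> into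
  \<open>Z y\<close>, and inclusions compose; the functor laws are inherited from this.\<close>

lemma is_functor_presented:
  assumes p: "\<And>x. x \<in> Field r \<Longrightarrow> presents (Z x) (B x) (\<pi> x) (obj F x)"
    and Z: "\<And>x y. (x, y) \<in> r \<Longrightarrow> Z x \<subseteq> Z y"
    and m: "\<And>x y z. (x, y) \<in> r \<Longrightarrow> z \<in> Z x \<Longrightarrow> mor F x y (\<pi> x z) = \<pi> y z"
    and "Partial_order r"
  shows "is_functor r F"
proof -
  have refl: "(x, x) \<in> r" if "x \<in> Field r" for x
    using assms(4) that by (auto simp: partial_order_on_def preorder_on_def refl_on_def)
  have trans: "(x, z) \<in> r" if "(x, y) \<in> r" "(y, z) \<in> r" for x y z
    using assms(4) that by (auto simp: partial_order_on_def preorder_on_def dest: transD)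
  have lift: "\<exists>z. z \<in> Z x \<and> g = \<pi> x z" if "x \<in> Field r" "g \<in> carrier (obj F x)" for x g
    using presentsD(5)[OF p[OF that(1)]] that(2) by blast
  show ?thesis unfolding is_functor_def
  proof (intro conjI)
    show "\<forall>x\<in>Field r. comm_group (obj F x)" using presentsD(3)[OF p] by blast
    show "\<forall>x\<in>Field r. \<forall>g\<in>carrier (obj F x). mor F x x g = g" using lift m refl by blast
    show "\<forall>(x, y)\<in>r. mor F x y \<in> hom (obj F x) (obj F y)"
    proof clarify
      fix x y assume xy: "(x, y) \<in> r"
      then have x: "x \<in> Field r" and y: "y \<in> Field r" by (auto simp: Field_def)
      show "mor F x y \<in> hom (obj F x) (obj F y)"
      proof (rule homI)
        fix g h assume "g \<in> carrier (obj F x)" "h \<in> carrier (obj F x)"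
        then obtain a b where a: "a \<in> Z x" "g = \<pi> x a" and b: "b \<in> Z x" "h = \<pi> x b"
          using lift[OF x] by metis
        have ab: "a + b \<in> Z x" "a \<in> Z y" "b \<in> Z y"
          using a b Z[OF xy] subg_add[OF presentsD(1)[OF p[OF x]]] by auto
        show "mor F x y (g \<otimes>\<^bsub>obj F x\<^esub> h) = mor F x y g \<otimes>\<^bsub>obj F y\<^esub> mor F x y h"
          using m[OF xy ab(1)] m[OF xy a(1)] m[OF xy b(1)] presentsD(7)[OF p[OF x] a(1) b(1)]
            presentsD(7)[OF p[OF y] ab(2,3)] unfolding a(2) b(2) by simp
        show "mor F x y g \<in> carrier (obj F y)"
          using a ab m[OF xy] presentsD(6)[OF p[OF y]] by simp
      qed
    qed
    show "\<forall>(x, y)\<in>r. \<forall>z. (y, z) \<in> r \<longrightarrow> (\<forall>g\<in>carrier (obj F x). mor F x z g = mor F y z (mor F x y g))"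
    proof clarify
      fix x y z g assume xy: "(x, y) \<in> r" "(y, z) \<in> r" "g \<in> carrier (obj F x)"
      then obtain a where "a \<in> Z x" "g = \<pi> x a" using lift[of x g] by (auto simp: Field_def)
      then show "mor F x z g = mor F y z (mor F x y g)"
        using m[OF xy(1), of a] m[OF xy(2), of a] m[OF trans[OF xy(1,2)], of a] Z[OF xy(1)] by auto
    qed
  qed
qed

lemma presents_alt:
  assumes p: "presents Z B \<pi> G" and x: "x \<in> Z"
  shows "\<pi> (alt k x) = \<pi> x [^]\<^bsub>G\<^esub> ((-1) ^ k :: int)"
proof -
  interpret G: comm_group G by (rule presentsD(3)[OF p])
  have "\<pi> (0 - x) = \<one>\<^bsub>G\<^esub> \<otimes>\<^bsub>G\<^esub> inv\<^bsub>G\<^esub> \<pi> x"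
    using presents_diff[OF p subg_zero[OF presentsD(1)[OF p]] x] by (simp only: presents_zero[OF p])
  then show ?thesis
    using presentsD(6)[OF p x] by (cases "even k") (simp_all add: alt_def G.int_pow_neg)
qed

text \<open>A functor whose values are quotients of subgroups of one common group and whose arrows
  do not change representatives. For such a functor the boundary with coefficients is the plain
  \<open>bd\<close> on representatives.\<close>

locale presented_functor = finite_poset r for r :: "'a rel" +
  fixes F :: "('a, 'g) poset_functor"
    and Z B :: "'a \<Rightarrow> 'b::ab_group_add set"
    and \<pi> :: "'a \<Rightarrow> 'b \<Rightarrow> 'g"
  assumes pres: "\<And>x. x \<in> Field r \<Longrightarrow> presents (Z x) (B x) (\<pi> x) (obj F x)"
    and Z_mono: "\<And>x y. (x, y) \<in> r \<Longrightarrow> Z x \<subseteq> Z y"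
    and mor: "\<And>x y z. (x, y) \<in> r \<Longrightarrow> z \<in> Z x \<Longrightarrow> mor F x y (\<pi> x z) = \<pi> y z"
begin

text \<open>The arrow is a function of classes: b and 0 have the same class over x, hence also over
  y.\<close>

lemma B_mono:
  assumes "(x, y) \<in> r"
  shows "B x \<subseteq> B y"
proof
  fix b assume b: "b \<in> B x"
  have x: "x \<in> Field r" "y \<in> Field r" using assms by (auto simp: Field_def)
  note px = pres[OF x(1)] and py = pres[OF x(2)]
  have Z: "b \<in> Z x" "b \<in> Z y" "0 \<in> Z x"
    using b presentsD(1,2)[OF px] Z_mono[OF assms] by (auto simp: subg_def)
  have "\<pi> y b = mor F x y (\<pi> x b)" using mor[OF assms Z(1)] by simp
  also have "\<dots> = mor F x y (\<pi> x 0)" using b presentsD(8)[OF px Z(1)] presents_zero[OF px] by simp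
  also have "\<dots> = \<one>\<^bsub>obj F y\<^esub>" using mor[OF assms Z(3)] presents_zero[OF py] by simp
  finally show "b \<in> B y" using presentsD(8)[OF py Z(2)] by simp
qed

definition coeff_chains :: "('a \<Rightarrow> 'b set) \<Rightarrow> int \<Rightarrow> ('a set \<Rightarrow> 'b) set" where
  "coeff_chains A n = {u. \<forall>\<sigma>. if \<sigma> \<in> Ch r n then u \<sigma> \<in> A (vertex r \<sigma> 0) else u \<sigma> = 0}"

definition pr :: "int \<Rightarrow> ('a set \<Rightarrow> 'b) \<Rightarrow> 'a set \<Rightarrow> 'g" where
  "pr n u = (\<lambda>\<sigma>\<in>Ch r n. \<pi> (vertex r \<sigma> 0) (u \<sigma>))"

lemma Ch_nonempty: "\<sigma> \<in> Ch r n \<Longrightarrow> \<sigma> \<noteq> {}"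
  by (auto simp: Ch_iff)

lemma Ch_min: "\<sigma> \<in> Ch r n \<Longrightarrow> vertex r \<sigma> 0 \<in> Field r"
  using vertex_0(1)[of \<sigma>] Ch_nonempty[of \<sigma> n] Chains_Field[of \<sigma> r] by (auto simp: Ch_iff)

lemma finite_Ch: "finite (Ch r n)"
proof (rule finite_subset)
  show "Ch r n \<subseteq> Pow (Field r)" using Chains_Field by (fastforce simp: Ch_iff)
qed simp

lemma pres_Ch: "\<sigma> \<in> Ch r n \<Longrightarrow> presents (Z (vertex r \<sigma> 0)) (B (vertex r \<sigma> 0)) (\<pi> (vertex r \<sigma> 0)) (obj F (vertex r \<sigma> 0))"
  by (intro pres Ch_min)

lemma presents_chain_grp: "presents (coeff_chains Z n) (coeff_chains B n) (pr n) (chain_grp r F n)"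
  unfolding coeff_chains_def pr_def[abs_def] chain_grp_def
  by (intro presents_sum_group finite_Ch pres_Ch)

lemma comm_group_obj: "\<sigma> \<in> Ch r n \<Longrightarrow> comm_group (obj F (vertex r \<sigma> 0))"
  using pres_Ch presentsD(3) by blast

text \<open>The empty face has to be excluded because \<open>Ch r (- 1)\<close> is empty and does
  not contain \<open>{}\<close>.\<close>

lemma Ch_insert:
  assumes "insert v \<tau> \<in> Ch r n" "v \<notin> \<tau>" "\<tau> \<noteq> {}"
  shows "\<tau> \<in> Ch r (n - 1)"
proof -
  have "finite (insert v \<tau>)" using assms finite_Chains by (auto simp: Ch_iff)
  moreover have "\<tau> \<in> Chains r" using assms Chains_subset[of \<tau> "insert v \<tau>" r] by (auto simp: Ch_iff)
  ultimately show ?thesis using assms by (auto simp: Ch_iff card_gt_0_iff)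
qed

lemma coeff_chains_insert:
  assumes "u \<in> coeff_chains Z n" "v \<notin> \<tau>" "\<tau> \<noteq> {}"
  shows "u (insert v \<tau>) = 0 \<or> insert v \<tau> \<in> Ch r n \<and> u (insert v \<tau>) \<in> Z (vertex r \<tau> 0)"
proof (cases "insert v \<tau> \<in> Ch r n")
  case True
  have "(vertex r (insert v \<tau>) 0, vertex r \<tau> 0) \<in> r"
    using True assms by (intro vertex_0_mono) (auto simp: Ch_iff)
  then show ?thesis using True assms(1) subsetD[OF Z_mono]
    by (auto simp: coeff_chains_def dest!: spec[of _ "insert v \<tau>"])
qed (use assms in \<open>auto simp: coeff_chains_def\<close>)

lemma bd_coeff_chains:
  assumes u: "u \<in> coeff_chains Z n"
  shows "bd r u \<in> coeff_chains Z (n - 1)"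
  unfolding coeff_chains_def
proof (intro CollectI allI)
  fix \<tau>
  show "if \<tau> \<in> Ch r (n - 1) then bd r u \<tau> \<in> Z (vertex r \<tau> 0) else bd r u \<tau> = 0"
  proof (cases "\<tau> \<in> Ch r (n - 1)")
    case True
    note t = this Ch_nonempty[OF this]
    note s = presentsD(1)[OF pres_Ch[OF True]]
    have "alt (rank r \<tau> v) (u (insert v \<tau>)) \<in> Z (vertex r \<tau> 0)" if "v \<in> Field r - \<tau>" for v
      using coeff_chains_insert[OF u _ t(2), of v] that s by (auto simp: subg_alt subg_zero)
    then show ?thesis using t by (auto simp: bd_def aug_bd_def intro!: subg_sum[OF s])
  next
    case False
    have "u (insert v \<tau>) = 0" if "\<tau> \<noteq> {}" "v \<in> Field r - \<tau>" for v
      using coeff_chains_insert[OF u _ that(1), of v] that Ch_insert[of v \<tau> n] False by auto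
    then show ?thesis using False by (simp add: bd_def aug_bd_def)
  qed
qed

text \<open>This turns the sum over faces of \<sigma> into its coefficient at one face \<tau>. At
  most one v contributes to the right-hand sum. The arrow in the term for the face opposite to the
  minimum is invisible on representatives, so that term has the same shape as the others.\<close>

lemma d_gen_apply:
  assumes \<sigma>: "\<sigma> \<in> Ch r n" and \<tau>: "\<tau> \<in> Ch r (n - 1)" and z: "z \<in> Z (vertex r \<sigma> 0)"
  shows "d_gen r F n (\<pi> (vertex r \<sigma> 0) z) \<sigma> \<in> carrier (chain_grp r F (n - 1))" (is ?A)
    and "d_gen r F n (\<pi> (vertex r \<sigma> 0) z) \<sigma> \<tau> =
      \<pi> (vertex r \<tau> 0) (\<Sum>v\<in>Field r - \<tau>. if \<sigma> = insert v \<tau> then alt (rank r \<tau> v) z else 0)" (is ?B)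
proof -
  let ?v = "vertex r \<sigma>" and ?C = "chain_grp r F (n - 1)" and ?g = "\<pi> (vertex r \<sigma> 0) z"
  have n: "n \<ge> 1" using \<tau> by (auto simp: Ch_iff)
  have \<sigma>C: "\<sigma> \<in> Chains r" and f\<sigma>: "finite \<sigma>" and c\<sigma>: "card \<sigma> = Suc (nat n)"
    using \<sigma> finite_Chains by (auto simp: Ch_iff)
  have face: "\<sigma> - {?v i} \<in> Ch r (n - 1)" if "i \<le> nat n" for i
    using vertex(1)[OF \<sigma>C, of i] that c\<sigma> f\<sigma> n Chains_subset[OF _ \<sigma>C, of "\<sigma> - {?v i}"]
    by (auto simp: Ch_iff)
  have v_inj: "i = j" if "i \<le> nat n" "j \<le> nat n" "?v i = ?v j" for i j
    using vertex(2)[OF \<sigma>C, of i] vertex(2)[OF \<sigma>C, of j] that c\<sigma> by (metis less_Suc_eq_le)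
  have min0: "(?v 0, ?v 1) \<in> r" "vertex r (\<sigma> - {?v 0}) 0 = ?v 1"
  proof -
    have 1: "?v 1 \<in> \<sigma>" "?v 1 \<noteq> ?v 0" using vertex(1)[OF \<sigma>C, of 1] v_inj[of 1 0] c\<sigma> n
      by (auto simp: Suc_le_eq)
    then show "(?v 0, ?v 1) \<in> r" using vertex_0(2)[OF \<sigma>C] by auto
    show "vertex r (\<sigma> - {?v 0}) 0 = ?v 1"
    proof (rule vertex_0_eqI)
      show "\<sigma> - {?v 0} \<in> Chains r" using face[of 0] by (simp add: Ch_iff)
      show "?v 1 \<in> \<sigma> - {?v 0}" using 1 by auto
      fix y assume y: "y \<in> \<sigma> - {?v 0}"
      show "(?v 1, y) \<in> r"
      proof (rule ccontr)
        assume a: "(?v 1, y) \<notin> r"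
        then have "(y, ?v 1) \<in> r" "y \<noteq> ?v 1" using y 1 \<sigma>C refl Chains_Field[OF \<sigma>C] by (auto simp: Chains_def)
        \<comment> \<open>Two distinct vertices strictly below \<open>?v 1\<close> contradict that
          its rank is 1.\<close>
        then have "{?v 0, y} \<subseteq> {x \<in> \<sigma>. x \<noteq> ?v 1 \<and> (x, ?v 1) \<in> r}"
          using y 1 \<open>(?v 0, ?v 1) \<in> r\<close> vertex(1)[OF \<sigma>C, of 0] c\<sigma> by auto
        then have "card {?v 0, y} \<le> rank r \<sigma> (?v 1)" unfolding rank_def using f\<sigma> by (intro card_mono) auto
        then show False using vertex(2)[OF \<sigma>C, of 1] c\<sigma> n y by auto
      qed
    qed
  qed
  have mini: "vertex r (\<sigma> - {?v i}) 0 = ?v 0" if "1 \<le> i" "i \<le> nat n" for i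
  proof (rule vertex_0_eqI)
    show "\<sigma> - {?v i} \<in> Chains r" using face[of i] that by (simp add: Ch_iff)
    show "?v 0 \<in> \<sigma> - {?v i}" using v_inj[of 0 i] that vertex(1)[OF \<sigma>C, of 0] c\<sigma> by auto
  qed (use vertex_0(2)[OF \<sigma>C] in auto)
  have G: "comm_group (obj F (vertex r \<tau> 0))" if "\<tau> \<in> Ch r (n - 1)" for \<tau> using that by (rule comm_group_obj)
  have cC: "comm_group ?C" unfolding chain_grp_def using G by (rule comm_group_sum_group)
  then interpret C: comm_group ?C .
  have carr: "carrier ?C = (\<Pi>\<^sub>E \<tau>\<in>Ch r (n - 1). carrier (obj F (vertex r \<tau> 0)))"
    unfolding chain_grp_def using G by (intro carrier_sum_group_finite finite_Ch) (auto simp: comm_group_def)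
  have gen_carr: "gen r F (n - 1) h \<rho> \<in> carrier ?C" if "h \<in> carrier (obj F (vertex r \<rho> 0))" for h \<rho>
    using that G by (auto simp: carr gen_def comm_group_def group.is_monoid)
  have z1: "z \<in> Z (?v 1)" and mz: "mor F (?v 0) (?v 1) ?g = \<pi> (?v 1) z"
    using z Z_mono[OF min0(1)] mor[OF min0(1) z] by auto
  have v01: "?v 0 \<in> Field r" "?v 1 \<in> Field r" using min0(1) by (auto simp: Field_def)
  have g0: "gen r F (n - 1) (mor F (?v 0) (?v 1) ?g) (\<sigma> - {?v 0}) \<in> carrier ?C"
    unfolding mz by (rule gen_carr, unfold min0) (rule presentsD(6)[OF pres[OF v01(2)] z1])
  have gi: "gen r F (n - 1) ?g (\<sigma> - {?v i}) \<in> carrier ?C" if "1 \<le> i" "i \<le> nat n" for i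
    by (rule gen_carr, unfold mini[OF that]) (rule presentsD(6)[OF pres[OF v01(1)] z])
  have fin: "(\<lambda>i. gen r F (n - 1) ?g (\<sigma> - {?v i}) [^]\<^bsub>?C\<^esub> ((-1) ^ i :: int)) \<in> {1..nat n} \<rightarrow> carrier ?C"
    using gi by auto
  show ?A unfolding d_gen_def using g0 fin by (intro C.m_closed C.finprod_closed)
  let ?G = "obj F (vertex r \<tau> 0)"
  interpret G: comm_group ?G by (rule G[OF \<tau>])
  note p = pres_Ch[OF \<tau>]
  have one: "\<pi> (vertex r \<tau> 0) 0 = \<one>\<^bsub>?G\<^esub>" by (rule presents_zero[OF p])
  let ?a = "if \<tau> = \<sigma> - {?v 0} then \<pi> (?v 1) z else \<one>\<^bsub>?G\<^esub>"
  let ?b = "\<lambda>i. (if \<tau> = \<sigma> - {?v i} then ?g else \<one>\<^bsub>?G\<^esub>) [^]\<^bsub>?G\<^esub> ((-1) ^ i :: int)"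
  have "d_gen r F n ?g \<sigma> \<tau> = ?a \<otimes>\<^bsub>?G\<^esub> finprod ?G ?b {1..nat n}"
  proof -
    have "finprod ?C (\<lambda>i. gen r F (n - 1) ?g (\<sigma> - {?v i}) [^]\<^bsub>?C\<^esub> ((-1) ^ i :: int)) {1..nat n} \<tau>
        = finprod ?G (\<lambda>i. (gen r F (n - 1) ?g (\<sigma> - {?v i}) [^]\<^bsub>?C\<^esub> ((-1) ^ i :: int)) \<tau>) {1..nat n}"
      using G fin \<tau> unfolding chain_grp_def by (intro finprod_sum_group_apply)
    also have "\<dots> = finprod ?G ?b {1..nat n}"
    proof (rule G.finprod_cong')
      have "(gen r F (n - 1) ?g (\<sigma> - {?v i}) [^]\<^bsub>?C\<^esub> ((-1) ^ i :: int)) \<tau> = ?b i"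
        if "i \<in> {1..nat n}" for i
      proof -
        have "(gen r F (n - 1) ?g (\<sigma> - {?v i}) [^]\<^bsub>?C\<^esub> ((-1) ^ i :: int)) \<tau> =
           gen r F (n - 1) ?g (\<sigma> - {?v i}) \<tau> [^]\<^bsub>?G\<^esub> ((-1) ^ i :: int)"
          using G gi[of i] that \<tau> unfolding chain_grp_def by (intro int_pow_sum_group_apply) auto
        also have "gen r F (n - 1) ?g (\<sigma> - {?v i}) \<tau> = (if \<tau> = \<sigma> - {?v i} then ?g else \<one>\<^bsub>?G\<^esub>)"
          using \<tau> by (simp add: gen_def)
        finally show ?thesis .
      qed
      then show "\<And>i. i \<in> {1..nat n} \<Longrightarrow> (gen r F (n - 1) ?g (\<sigma> - {?v i}) [^]\<^bsub>?C\<^esub> ((-1) ^ i :: int)) \<tau> = ?b i" .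
      show "?b \<in> {1..nat n} \<rightarrow> carrier ?G"
        using mini presentsD(6)[OF pres[OF v01(1)] z] by (auto intro!: G.int_pow_closed)
    qed simp
    finally show ?thesis using \<tau> unfolding d_gen_def mz by (simp add: chain_grp_def gen_def)
  qed
  moreover have "?a \<otimes>\<^bsub>?G\<^esub> finprod ?G ?b {1..nat n} = 
      \<pi> (vertex r \<tau> 0) (\<Sum>v\<in>Field r - \<tau>. if \<sigma> = insert v \<tau> then alt (rank r \<tau> v) z else 0)" (is "_ = \<pi> _ ?S")
  proof (cases "\<exists>j\<le>nat n. \<tau> = \<sigma> - {?v j}")
    case True
    then obtain j where j: "j \<le> nat n" "\<tau> = \<sigma> - {?v j}" by blast
    have vj: "?v j \<in> \<sigma>" "rank r \<sigma> (?v j) = j" using vertex[OF \<sigma>C, of j] j c\<sigma> by auto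
    \<comment> \<open>Deleting a vertex leaves the vertices below it in place, so the exponent j in
      \<open>d_gen\<close> is the rank of that vertex over \<tau>.\<close>
    have "{y \<in> \<sigma> - {?v j}. y \<noteq> ?v j \<and> (y, ?v j) \<in> r} = {y \<in> \<sigma>. y \<noteq> ?v j \<and> (y, ?v j) \<in> r}" by auto
    then have rk: "rank r \<tau> (?v j) = j" using vj(2) unfolding j(2) by (simp add: rank_def)
    have "\<sigma> = insert v \<tau> \<longleftrightarrow> v = ?v j" if "v \<in> Field r - \<tau>" for v using vj j that by auto
    then have "?S = (\<Sum>v\<in>Field r - \<tau>. if v = ?v j then alt j z else 0)"
      using rk by (intro sum.cong) auto
    also have "\<dots> = alt j z" using vj(1) Chains_Field[OF \<sigma>C] j(2) by (subst sum.delta) auto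
    finally have S: "?S = alt j z" .
    have eq: "\<tau> = \<sigma> - {?v i} \<longleftrightarrow> i = j" if "i \<le> nat n" for i
      using v_inj[OF that j(1)] j(2) vj(1) vertex(1)[OF \<sigma>C, of i] that c\<sigma> by auto
    show ?thesis
    \<comment> \<open>Only for j = 0 does the minimum change, so that the coefficient moves from
      \<open>?v 0\<close> to \<open>?v 1\<close>; every other face keeps the minimum.\<close>
    proof (cases "j = 0")
      case True
      have "finprod ?G ?b {1..nat n} = finprod ?G (\<lambda>_. \<one>\<^bsub>?G\<^esub>) {1..nat n}"
        using eq True by (intro G.finprod_cong') auto
      then have fp: "finprod ?G ?b {1..nat n} = \<one>\<^bsub>?G\<^esub>" by (simp only: G.finprod_one)
      have a: "?a = \<pi> (vertex r \<tau> 0) z" using True j(2) min0(2) by simp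
      have "z \<in> Z (vertex r \<tau> 0)" using True j(2) min0(2) z1 by simp
      then have "\<pi> (vertex r \<tau> 0) z \<in> carrier ?G" by (rule presentsD(6)[OF p])
      then show ?thesis unfolding S fp a using True by simp
    next
      case False
      have mj: "vertex r \<tau> 0 = ?v 0" using mini[of j] False j by simp
      have gj: "?g \<in> carrier ?G" using presentsD(6)[OF pres[OF v01(1)] z] mj by simp
      have "finprod ?G ?b {1..nat n} = finprod ?G (\<lambda>i. if j = i then ?g [^]\<^bsub>?G\<^esub> ((-1) ^ i :: int) else \<one>\<^bsub>?G\<^esub>) {1..nat n}"
        using eq gj by (intro G.finprod_cong') (auto simp: Pi_iff)
      also have "\<dots> = ?g [^]\<^bsub>?G\<^esub> ((-1) ^ j :: int)"
        using j(1) False G.int_pow_closed[OF gj] by (intro G.finprod_singleton) (auto simp: Pi_iff)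
      also have "\<dots> = \<pi> (?v 0) (alt j z)"
        using presents_alt[OF pres[OF v01(1)] z, of j] mj by simp
      finally have fp: "finprod ?G ?b {1..nat n} = \<pi> (?v 0) (alt j z)" .
      have "alt j z \<in> Z (?v 0)" using subg_alt[OF presentsD(1)[OF pres[OF v01(1)]]] z by blast
      then have "\<pi> (?v 0) (alt j z) \<in> carrier ?G" using presentsD(6)[OF pres[OF v01(1)]] mj by simp
      then have "\<one>\<^bsub>?G\<^esub> \<otimes>\<^bsub>?G\<^esub> \<pi> (?v 0) (alt j z) = \<pi> (?v 0) (alt j z)" by (rule G.l_one)
      moreover have "?a = \<one>\<^bsub>?G\<^esub>" using eq[of 0] False by simp
      ultimately show ?thesis unfolding S fp by (simp only: mj)
    qed
  next
    case False
    have "finprod ?G ?b {1..nat n} = finprod ?G (\<lambda>_. \<one>\<^bsub>?G\<^esub>) {1..nat n}"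
      using False by (intro G.finprod_cong') auto
    then have fp: "finprod ?G ?b {1..nat n} = \<one>\<^bsub>?G\<^esub>" by (simp only: G.finprod_one)
    have "\<sigma> \<noteq> insert v \<tau>" if "v \<in> Field r - \<tau>" for v
    proof
      assume s: "\<sigma> = insert v \<tau>"
      \<comment> \<open>A coface of \<tau> has \<tau> as the face whose index is the rank of the
        inserted vertex; this is excluded in the present case.\<close>
      have "\<tau> = \<sigma> - {?v (rank r \<sigma> v)}" using s that vertex_eqI[OF \<sigma>C, of v] by auto
      moreover have "rank r \<sigma> v \<in> {..<card \<sigma>}" using bij_betw_apply[OF rank_bij[OF \<sigma>C], of v] s by simp
      then have "rank r \<sigma> v \<le> nat n" using c\<sigma> by simp
      ultimately show False using False by blast
    qed
    then have "?S = 0" by (intro sum.neutral) auto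
    moreover have "?a = \<one>\<^bsub>?G\<^esub>" using False by auto
    ultimately show ?thesis unfolding fp by (simp add: one)
  qed
  ultimately show ?B by simp
qed

text \<open>The classes of coefficients form a chain map: \<open>boundary\<close> may be computed as
  \<open>bd\<close> on representatives. Everything later takes place on representatives because of
  this.\<close>

lemma boundary_pr:
  assumes u: "u \<in> coeff_chains Z n"
  shows "boundary r F n (pr n u) = pr (n - 1) (bd r u)"
proof -
  let ?C = "chain_grp r F (n - 1)"
  let ?A = "{\<sigma> \<in> Ch r n. pr n u \<sigma> \<noteq> \<one>\<^bsub>obj F (vertex r \<sigma> 0)\<^esub>}"
  have bu: "pr (n - 1) (bd r u) \<in> carrier ?C"
    by (rule presentsD(6)[OF presents_chain_grp bd_coeff_chains[OF u]])
  have G: "comm_group (obj F (vertex r \<tau> 0))" if "\<tau> \<in> Ch r (n - 1)" for \<tau> using that by (rule comm_group_obj)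
  have cC: "comm_group ?C" unfolding chain_grp_def using G by (rule comm_group_sum_group)
  then interpret C: comm_group ?C .
  have carr: "carrier ?C = (\<Pi>\<^sub>E \<tau>\<in>Ch r (n - 1). carrier (obj F (vertex r \<tau> 0)))"
    unfolding chain_grp_def using G by (intro carrier_sum_group_finite finite_Ch) (auto simp: comm_group_def)
  have uZ: "u \<sigma> \<in> Z (vertex r \<sigma> 0)" if "\<sigma> \<in> Ch r n" for \<sigma> using u that by (auto simp: coeff_chains_def)
  show ?thesis
  proof (cases "Ch r (n - 1) = {}")
    \<comment> \<open>Here \<open>d_gen\<close> may refer to vertices that do not exist, for
      instance the vertex 1 of a point when n = 0. The target group has a single element, which is
      the value of every product, so membership holds all the same.\<close>
    case True
    have "x \<otimes>\<^bsub>?C\<^esub> y \<in> carrier ?C" for x y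
    proof -
      have "x \<otimes>\<^bsub>?C\<^esub> y = (\<lambda>_. undefined)" unfolding chain_grp_def mult_sum_group True by (simp add: restrict_def)
      then show ?thesis unfolding carr True by simp
    qed
    then have "d_gen r F n (pr n u \<sigma>) \<sigma> \<in> carrier ?C" for \<sigma> unfolding d_gen_def .
    then have "boundary r F n (pr n u) \<in> carrier ?C" unfolding boundary_def by (intro C.finprod_closed) auto
    then show ?thesis using bu by (auto simp: carr True)
  next
    case False
    then obtain \<rho> where \<rho>: "\<rho> \<in> Ch r (n - 1)" by blast
    have pu: "pr n u \<sigma> = \<pi> (vertex r \<sigma> 0) (u \<sigma>)" if "\<sigma> \<in> Ch r n" for \<sigma> using that by (simp add: pr_def)
    have dc: "(\<lambda>\<sigma>. d_gen r F n (pr n u \<sigma>) \<sigma>) \<in> ?A \<rightarrow> carrier ?C"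
      using d_gen_apply(1)[OF _ \<rho> uZ] pu by auto
    have "boundary r F n (pr n u) \<tau> = pr (n - 1) (bd r u) \<tau>" if \<tau>: "\<tau> \<in> Ch r (n - 1)" for \<tau>
    proof -
      let ?G = "obj F (vertex r \<tau> 0)"
      interpret G: comm_group ?G using \<tau> by (rule G)
      note p = pres_Ch[OF \<tau>]
      define z where "z \<sigma> = (\<Sum>v\<in>Field r - \<tau>. if \<sigma> = insert v \<tau> then alt (rank r \<tau> v) (u \<sigma>) else 0)" for \<sigma>
      \<comment> \<open>Needed for \<open>A = Z\<close>, so that the coefficients are
        representatives, and for \<open>A = B\<close>, to see that trivial coefficients contribute
        trivially.\<close>
      have zA: "z \<sigma> \<in> A (vertex r \<tau> 0)"
        if "A = Z \<or> A = B" "\<sigma> \<in> Ch r n" "u \<sigma> \<in> A (vertex r \<sigma> 0)" for A \<sigma>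
      proof -
        have s: "subg (A (vertex r \<tau> 0))" using that(1) presentsD(1)[OF p] presents_subg[OF p] by auto
        have "alt (rank r \<tau> v) (u \<sigma>) \<in> A (vertex r \<tau> 0)" if "\<sigma> = insert v \<tau>" for v
        proof -
          have "(vertex r \<sigma> 0, vertex r \<tau> 0) \<in> r"
            using that \<open>\<sigma> \<in> Ch r n\<close> Ch_nonempty[OF \<tau>] by (intro vertex_0_mono) (auto simp: Ch_iff)
          then show ?thesis using subsetD[OF Z_mono] subsetD[OF B_mono] \<open>A = Z \<or> A = B\<close> \<open>u \<sigma> \<in> A (vertex r \<sigma> 0)\<close>
            by (auto simp: subg_alt[OF s])
        qed
        then show ?thesis unfolding z_def by (intro subg_sum[OF s]) (auto simp: subg_zero[OF s])
      qed
      have zZ: "z \<sigma> \<in> Z (vertex r \<tau> 0)" if "\<sigma> \<in> Ch r n" for \<sigma> using zA[of Z \<sigma>] uZ that by auto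
      have "boundary r F n (pr n u) \<tau> = finprod ?G (\<lambda>\<sigma>. d_gen r F n (pr n u \<sigma>) \<sigma> \<tau>) ?A"
        unfolding boundary_def using G dc \<tau> unfolding chain_grp_def by (intro finprod_sum_group_apply)
      also have "\<dots> = finprod ?G (\<lambda>\<sigma>. \<pi> (vertex r \<tau> 0) (z \<sigma>)) ?A"
        using d_gen_apply(2)[OF _ \<tau> uZ] pu zZ presentsD(6)[OF p] unfolding z_def
        by (intro G.finprod_cong') auto
      \<comment> \<open>\<open>boundary\<close> runs only over simplices with nontrivial
        coefficient. At the others \<open>u \<sigma>\<close> lies in the denominator, and by
        \<open>B_mono\<close> so does its contribution at \<tau>.\<close>
      also have "\<dots> = finprod ?G (\<lambda>\<sigma>. \<pi> (vertex r \<tau> 0) (z \<sigma>)) (Ch r n)"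
      proof (rule G.finprod_mono_neutral_cong_left)
        fix \<sigma> assume s: "\<sigma> \<in> Ch r n - ?A"
        then have "u \<sigma> \<in> B (vertex r \<sigma> 0)" using presentsD(8)[OF pres_Ch uZ, of \<sigma> n] pu by auto
        then show "\<pi> (vertex r \<tau> 0) (z \<sigma>) = \<one>\<^bsub>?G\<^esub>"
          using zA[of B \<sigma>] s presentsD(8)[OF p zZ] by auto
      qed (use finite_Ch presentsD(6)[OF p] zZ in auto)
      also have "\<dots> = \<pi> (vertex r \<tau> 0) (\<Sum>\<sigma>\<in>Ch r n. z \<sigma>)" using p zZ by (rule presents_finprod)
      also have "(\<Sum>\<sigma>\<in>Ch r n. z \<sigma>) = bd r u \<tau>"
      proof -
        have "(\<Sum>\<sigma>\<in>Ch r n. z \<sigma>) = (\<Sum>v\<in>Field r - \<tau>. \<Sum>\<sigma>\<in>Ch r n. if \<sigma> = insert v \<tau> then alt (rank r \<tau> v) (u \<sigma>) else 0)"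
          unfolding z_def by (rule sum.swap)
        also have "\<dots> = (\<Sum>v\<in>Field r - \<tau>. alt (rank r \<tau> v) (u (insert v \<tau>)))"
          using finite_Ch u by (intro sum.cong) (auto simp: coeff_chains_def)
        finally show ?thesis using Ch_nonempty[OF \<tau>] by (simp add: bd_def aug_bd_def)
      qed
      also have "\<pi> (vertex r \<tau> 0) (bd r u \<tau>) = pr (n - 1) (bd r u) \<tau>" using \<tau> by (simp add: pr_def)
      finally show ?thesis .
    qed
    moreover have "boundary r F n (pr n u) \<in> carrier ?C" unfolding boundary_def using dc by (rule C.finprod_closed)
    ultimately show ?thesis using bu unfolding carr by (intro PiE_ext)
  qed
qed

text \<open>Both the cycle condition and the relation between cycles hold only modulo the
  denominators of the coefficients. With homology groups as coefficients this is iterated homology,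
  which is how it meets the second page.\<close>

lemma presents_poset_homology:
  "presents {u\<in>coeff_chains Z n. bd r u \<in> coeff_chains B (n - 1)}
     {u\<in>coeff_chains Z n. bd r u \<in> coeff_chains B (n - 1) \<and> (\<exists>w\<in>coeff_chains Z (n + 1). u - bd r w \<in> coeff_chains B n)}
     (\<lambda>u. (boundary r F (n + 1) ` carrier (chain_grp r F (n + 1))) #>\<^bsub>chain_grp r F n\<^esub> pr n u)
     (poset_homology n r F)"
  unfolding poset_homology_def
proof (rule presents_homology_at[OF presents_chain_grp presents_chain_grp presents_chain_grp])
  fix u assume u: "u \<in> coeff_chains Z (n + 1)"
  show "bd r u \<in> coeff_chains Z n \<and> boundary r F (n + 1) (pr (n + 1) u) = pr n (bd r u)"
    using bd_coeff_chains[OF u] boundary_pr[OF u] by simp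
  have "u \<sigma> \<noteq> 0 \<Longrightarrow> \<sigma> \<in> Chains r" for \<sigma>
    using u by (cases "\<sigma> \<in> Ch r (n + 1)") (auto simp: coeff_chains_def Ch_iff)
  then have "bd r (bd r u) = 0" using bd_bd[of u] by (simp add: fun_eq_iff)
  then show "bd r (bd r u) \<in> coeff_chains B (n - 1)"
    using presents_subg[OF presents_chain_grp] by (simp add: subg_zero)
next
  fix u assume u: "u \<in> coeff_chains Z n"
  show "bd r u \<in> coeff_chains Z (n - 1) \<and> boundary r F n (pr n u) = pr (n - 1) (bd r u)"
    using bd_coeff_chains[OF u] boundary_pr[OF u] by simp
qed (simp_all add: bd_diff)

end

section \<open>The spectral sequence of a filtered complex\<close>

text \<open>\<open>K p n\<close> is the filtration step p in total degree n, and one operator on the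
  ambient type serves all degrees. The filtration starts at 0 and is exhausted at step n, whence
  first-quadrant pages and convergence at a finite stage.\<close>

locale filtered_complex =
  fixes K :: "int \<Rightarrow> int \<Rightarrow> 'b::ab_group_add set"
    and D :: "'b \<Rightarrow> 'b"
  assumes subg_K: "subg (K p n)"
    and K_mono: "p \<le> p' \<Longrightarrow> K p n \<subseteq> K p' n"
    and K_neg: "p < 0 \<Longrightarrow> K p n = {0}"
    and K_top: "n \<le> p \<Longrightarrow> K p n = K n n"
    and D_add: "D (x + y) = D x + D y"
    and D_K: "x \<in> K p n \<Longrightarrow> D x \<in> K p (n - 1)"
    and D_D: "x \<in> K p n \<Longrightarrow> D (D x) = 0"
begin

lemma D_0: "D 0 = 0"
  using D_add[of 0 0] by simp

lemma D_diff: "D (x - y) = D x - D y"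
  using D_add[of "x - y" y] by simp

lemma K_0: "0 \<in> K p n" and K_add: "x \<in> K p n \<Longrightarrow> y \<in> K p n \<Longrightarrow> x + y \<in> K p n"
  and K_diff: "x \<in> K p n \<Longrightarrow> y \<in> K p n \<Longrightarrow> x - y \<in> K p n"
  using subg_K subg_zero subg_add subg_diff by blast+

lemma K_le: "x \<in> K p n \<Longrightarrow> p \<le> p' \<Longrightarrow> x \<in> K p' n"
  using K_mono by blast

lemma K_all: "x \<in> K p n \<Longrightarrow> n \<le> p' \<Longrightarrow> x \<in> K p' n"
  by (metis K_top K_le linear)

text \<open>Approximate cycles of order r. The last index is the total degree p + q, not q.\<close>

definition Zr :: "int \<Rightarrow> int \<Rightarrow> int \<Rightarrow> 'b set" where
  "Zr r p n = {x \<in> K p n. D x \<in> K (p - r) (n - 1)}"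

text \<open>The whole denominator of the classical formula for the r-th page: the first summand
  kills what already lives in lower filtration, the second consists of boundaries from r - 1 steps
  higher.\<close>

definition Br :: "int \<Rightarrow> int \<Rightarrow> int \<Rightarrow> 'b set" where
  "Br r p n = {x + D y | x y. x \<in> Zr (r - 1) (p - 1) n \<and> y \<in> Zr (r - 1) (p + r - 1) (n + 1)}"

definition Er :: "nat \<Rightarrow> int \<Rightarrow> int \<Rightarrow> 'b set monoid" where
  "Er r p q = quot_group (Zr (int r) p (p + q)) (Br (int r) p (p + q))"

definition dr :: "nat \<Rightarrow> int \<Rightarrow> int \<Rightarrow> 'b set \<Rightarrow> 'b set" where
  "dr r p q = quot_map (Br (int r) (p - int r) (p + q - 1)) D"

lemma subg_Zr: "subg (Zr r p n)"
  by (auto simp: subg_def Zr_def K_0 K_diff D_0 D_diff)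

lemma subg_Br: "subg (Br r p n)"
  unfolding subg_def
proof (intro conjI ballI)
  show "0 \<in> Br r p n" unfolding Br_def using subg_zero[OF subg_Zr] D_0 by force
  fix a b assume "a \<in> Br r p n" "b \<in> Br r p n"
  then obtain x y x' y' where *: "a = x + D y" "b = x' + D y'" "x \<in> Zr (r - 1) (p - 1) n"
    "y \<in> Zr (r - 1) (p + r - 1) (n + 1)" "x' \<in> Zr (r - 1) (p - 1) n"
    "y' \<in> Zr (r - 1) (p + r - 1) (n + 1)" unfolding Br_def by blast
  have "a - b = (x - x') + D (y - y')" using * by (simp add: D_diff)
  then show "a - b \<in> Br r p n" unfolding Br_def using * subg_diff[OF subg_Zr] by blast
qed

lemma Br_subset: "r \<ge> 1 \<Longrightarrow> Br r p n \<subseteq> Zr r p n"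
proof
  fix a assume r: "r \<ge> 1" and "a \<in> Br r p n"
  then obtain x y where *: "a = x + D y" "x \<in> Zr (r - 1) (p - 1) n"
    "y \<in> Zr (r - 1) (p + r - 1) (n + 1)" unfolding Br_def by blast
  have "x \<in> K p n" "D y \<in> K p n" using * K_le[of x "p - 1" n p] by (auto simp: Zr_def)
  moreover have "D (D y) = 0" "D x \<in> K (p - r) (n - 1)" using * D_D by (auto simp: Zr_def)
  ultimately show "a \<in> Zr r p n" using * by (simp add: Zr_def K_add D_add)
qed

lemma presents_Er: "r \<ge> 1 \<Longrightarrow> presents (Zr (int r) p (p + q)) (Br (int r) p (p + q))
    (add_coset (Br (int r) p (p + q))) (Er r p q)"
  unfolding Er_def by (intro presents_quot_group subg_Zr subg_Br Br_subset) simp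

lemma D_Zr: "x \<in> Zr r p n \<Longrightarrow> D x \<in> Zr r (p - r) (n - 1)"
  by (auto simp: Zr_def D_D K_0)

text \<open>The summand \<open>D y\<close> dies, and x has exactly the filtration index required of
  a preimage in the second summand at p - r.\<close>

lemma D_Br: assumes "a \<in> Br r p n" shows "D a \<in> Br r (p - r) (n - 1)"
proof -
  obtain x y where *: "a = x + D y" "x \<in> Zr (r - 1) (p - 1) n"
    "y \<in> Zr (r - 1) (p + r - 1) (n + 1)" using assms unfolding Br_def by blast
  have "D a = 0 + D x" using * D_D by (auto simp: D_add Zr_def)
  moreover have "x \<in> Zr (r - 1) ((p - r) + r - 1) (n - 1 + 1)" using * by simp
  ultimately show ?thesis unfolding Br_def using subg_zero[OF subg_Zr] by blast
qed

lemma dr_coset: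
  assumes "r \<ge> 1" "x \<in> Zr (int r) p (p + q)"
  shows "dr r p q (add_coset (Br (int r) p (p + q)) x) = add_coset (Br (int r) (p - int r) (p + q - 1)) (D x)"
  unfolding dr_def
  by (rule quot_map_coset[OF subg_Br subg_Br assms(2)]) (use assms in \<open>auto simp: D_add D_Br Br_subset\<close>)

text \<open>The identity on representatives induces the isomorphism with the homology of the page. A
  cycle of the page need not lie in the next numerator, but it does after subtracting an element of
  the current denominator.\<close>

lemma presents_next_page:
  assumes r: "r \<ge> 1"
  shows "presents (Zr (int r + 1) p (p + q)) (Br (int r + 1) p (p + q))
    (\<lambda>x. (dr r (p + int r) (q - int r + 1) ` carrier (Er r (p + int r) (q - int r + 1)))
        #>\<^bsub>Er r p q\<^esub> add_coset (Br (int r) p (p + q)) x)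
    (homology_at (Er r (p + int r) (q - int r + 1)) (dr r (p + int r) (q - int r + 1))
                 (Er r p q) (dr r p q) (Er r (p - int r) (q + int r - 1)))"
proof -
  let ?r = "int r" and ?n = "p + q"
  have n: "p + ?r + (q - ?r + 1) = ?n + 1" "p - ?r + (q + ?r - 1) = ?n - 1" by simp_all
  note pr = presents_Er[OF r, of "p + ?r" "q - ?r + 1", unfolded n]
    presents_Er[OF r, of p q] presents_Er[OF r, of "p - ?r" "q + ?r - 1", unfolded n]
  have P: "presents {x\<in>Zr ?r p ?n. D x \<in> Br ?r (p - ?r) (?n - 1)}
     {x\<in>Zr ?r p ?n. D x \<in> Br ?r (p - ?r) (?n - 1) \<and> (\<exists>y\<in>Zr ?r (p + ?r) (?n + 1). x - D y \<in> Br ?r p ?n)}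
     (\<lambda>x. (dr r (p + int r) (q - int r + 1) ` carrier (Er r (p + int r) (q - int r + 1)))
        #>\<^bsub>Er r p q\<^esub> add_coset (Br (int r) p (p + q)) x)
    (homology_at (Er r (p + int r) (q - int r + 1)) (dr r (p + int r) (q - int r + 1))
                 (Er r p q) (dr r p q) (Er r (p - int r) (q + int r - 1)))"
  proof (rule presents_homology_at[OF pr])
    fix x assume x: "x \<in> Zr ?r (p + ?r) (?n + 1)"
    then have "D (D x) = 0" by (auto simp: Zr_def D_D)
    then show "D x \<in> Zr ?r p ?n \<and> dr r (p + ?r) (q - ?r + 1)
        (add_coset (Br ?r (p + ?r) (?n + 1)) x) = add_coset (Br ?r p ?n) (D x)"
      "D (D x) \<in> Br ?r (p - ?r) (?n - 1)"
      using D_Zr[OF x] dr_coset[OF r, of x "p + ?r" "q - ?r + 1", unfolded n, OF x]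
      by (simp_all add: subg_zero[OF subg_Br])
  next
    fix x assume "x \<in> Zr ?r p ?n"
    then show "D x \<in> Zr ?r (p - ?r) (?n - 1) \<and> dr r p q (add_coset (Br ?r p ?n) x) = add_coset (Br ?r (p - ?r) (?n - 1)) (D x)"
      using D_Zr dr_coset[OF r] by simp
  qed (simp_all add: D_diff)
  have BrI: "x \<in> Br r' p' n'" if "x \<in> Zr (r' - 1) (p' - 1) n'" for x r' p' n'
  proof -
    have "x + D 0 \<in> Br r' p' n'" using that subg_zero[OF subg_Zr] unfolding Br_def by blast
    then show ?thesis by (simp add: D_0)
  qed
  have BrD: "D x \<in> Br r' p' n'" if "x \<in> Zr (r' - 1) (p' + r' - 1) (n' + 1)" for x r' p' n'
  proof -
    have "0 + D x \<in> Br r' p' n'" using that subg_zero[OF subg_Zr] unfolding Br_def by blast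
    then show ?thesis by simp
  qed
  have down: "x \<in> Zr (r' - 1) p' n'" if "x \<in> Zr r' p' n'" for x r' p' n'
    using that K_le[of "D x" "p' - r'" "n' - 1" "p' - (r' - 1)"] by (auto simp: Zr_def)
  have up: "x \<in> Zr (r' + 1) (p' + 1) n'" if "x \<in> Zr r' p' n'" for x r' p' n'
    using that K_le[of x p' n' "p' + 1"] by (auto simp: Zr_def)
  have into: "x \<in> Zr ?r p ?n" "D x \<in> Br ?r (p - ?r) (?n - 1)" if x: "x \<in> Zr (?r + 1) p ?n" for x
  proof -
    show "x \<in> Zr ?r p ?n" using down[OF x] by simp
    have "D x \<in> Zr (?r - 1) (p - ?r - 1) (?n - 1)"
      using x by (auto simp: Zr_def D_D K_0 diff_diff_eq)
    then show "D x \<in> Br ?r (p - ?r) (?n - 1)" by (rule BrI)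
  qed
  show ?thesis
  proof (rule presents_pull[OF P subg_Zr, where \<alpha> = "\<lambda>x. x"])
    fix z assume "z \<in> {x\<in>Zr ?r p ?n. D x \<in> Br ?r (p - ?r) (?n - 1)}"
    then obtain a y where z: "z \<in> Zr ?r p ?n" "D z = a + D y" "a \<in> Zr (?r - 1) (p - ?r - 1) (?n - 1)"
      "y \<in> Zr (?r - 1) (p - 1) ?n" unfolding Br_def by auto
    \<comment> \<open>The boundary of z - y is the remainder a, one filtration step lower than
      \<open>D z\<close> was known to be. The class does not change, as y has filtration p - 1 and
      belongs to the denominator.\<close>
    have yZ: "y \<in> Zr ?r p ?n" using up[OF z(4)] by simp
    then have "z - y \<in> Zr (?r + 1) p ?n"
      using z(1,3) K_diff[of z p ?n y] by (auto simp: Zr_def D_diff z(2) diff_diff_eq)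
    moreover have "D y \<in> Br ?r (p - ?r) (?n - 1)" using z(4) by (intro BrD) simp
    moreover have "y - D 0 \<in> Br ?r p ?n" using BrI[OF z(4)] by (simp add: D_0)
    ultimately show "\<exists>x\<in>Zr (?r + 1) p ?n. z - x \<in> {x\<in>Zr ?r p ?n. D x \<in> Br ?r (p - ?r) (?n - 1) \<and> (\<exists>y\<in>Zr ?r (p + ?r) (?n + 1). x - D y \<in> Br ?r p ?n)}"
      using yZ subg_zero[OF subg_Zr] by (intro bexI[of _ "z - y"]) auto
  next
    fix x assume x: "x \<in> Zr (?r + 1) p ?n"
    have "x \<in> Br (?r + 1) p ?n" if y: "y \<in> Zr ?r (p + ?r) (?n + 1)" and xy: "x - D y \<in> Br ?r p ?n" for y
    proof -
      obtain z w where z: "x - D y = z + D w" "z \<in> Zr (?r - 1) (p - 1) ?n"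
        "w \<in> Zr (?r - 1) (p + ?r - 1) (?n + 1)" using xy unfolding Br_def by blast
      have xz: "x = z + D (y + w)" using z(1) by (simp add: D_add algebra_simps)
      have yw: "y + w \<in> Zr ?r (p + ?r) (?n + 1)"
        using y up[OF z(3)] by (simp add: subg_add[OF subg_Zr])
      then have "D (D (y + w)) = 0" by (auto simp: Zr_def D_D)
      \<comment> \<open>z differs from x by a boundary, so it inherits the sharper bound on
        \<open>D x\<close>.\<close>
      then have "D z = D x" by (simp add: xz D_add)
      then have "z \<in> Zr ?r (p - 1) ?n" using z(2) x by (simp add: Zr_def algebra_simps)
      then show ?thesis using xz yw unfolding Br_def by (auto simp: add.assoc)
    qed
    moreover have "\<exists>y\<in>Zr ?r (p + ?r) (?n + 1). x - D y \<in> Br ?r p ?n" if xB: "x \<in> Br (?r + 1) p ?n"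
    proof -
      obtain z y where z: "x = z + D y" "z \<in> Zr ?r (p - 1) ?n" "y \<in> Zr ?r (p + ?r) (?n + 1)"
        using xB unfolding Br_def by auto
      then show ?thesis using BrI[OF down[OF z(2)]] by (intro bexI[of _ y]) auto
    qed
    ultimately show "x \<in> {x\<in>Zr ?r p ?n. D x \<in> Br ?r (p - ?r) (?n - 1) \<and> (\<exists>y\<in>Zr ?r (p + ?r) (?n + 1). x - D y \<in> Br ?r p ?n)} \<longleftrightarrow> x \<in> Br (?r + 1) p ?n"
      using into[OF x] by blast
  qed (use into Br_subset[of "?r + 1"] in auto)
qed

lemma spectral_sequence_Er:
  assumes r0: "r0 \<ge> 1"
  shows "spectral_sequence r0 Er dr"
proof (rule spectral_sequence.intro)
  fix r :: nat and p q :: int assume "r0 \<le> r"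
  then have r: "r \<ge> 1" using r0 by simp
  let ?r = "int r" and ?n = "p + q"
  note pr = presents_Er[OF r]
  have n': "p - ?r + (q + ?r - 1) = ?n - 1" by simp
  note pr' = pr[of "p - ?r" "q + ?r - 1", unfolded n']
  show "comm_group (Er r p q)" by (rule presentsD(3)[OF pr])
  have lift: "\<exists>x. x \<in> Zr ?r p ?n \<and> a = add_coset (Br ?r p ?n) x" if "a \<in> carrier (Er r p q)" for a
  proof -
    have "a \<in> add_coset (Br ?r p ?n) ` Zr ?r p ?n" using that by (simp only: presentsD(5)[OF pr])
    then show ?thesis by (auto simp only: image_iff)
  qed
  show "dr r p q \<in> hom (Er r p q) (Er r (p - ?r) (q + ?r - 1))"
  proof (rule homI)
    fix a b assume "a \<in> carrier (Er r p q)" "b \<in> carrier (Er r p q)"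
    then obtain x y where x: "x \<in> Zr ?r p ?n" "a = add_coset (Br ?r p ?n) x"
      and y: "y \<in> Zr ?r p ?n" "b = add_coset (Br ?r p ?n) y" using lift by metis
    have xy: "x + y \<in> Zr ?r p ?n" using x y subg_add[OF subg_Zr] by blast
    note d = dr_coset[OF r]
    show "dr r p q a \<in> carrier (Er r (p - ?r) (q + ?r - 1))"
      unfolding x(2) d[OF x(1)] by (rule presentsD(6)[OF pr' D_Zr[OF x(1)]])
    show "dr r p q (a \<otimes>\<^bsub>Er r p q\<^esub> b) = dr r p q a \<otimes>\<^bsub>Er r (p - ?r) (q + ?r - 1)\<^esub> dr r p q b"
      unfolding x(2) y(2) presentsD(7)[OF pr x(1) y(1), symmetric] d[OF x(1)] d[OF y(1)] d[OF xy] D_add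
      by (rule presentsD(7)[OF pr' D_Zr[OF x(1)] D_Zr[OF y(1)]])
  qed
  show "dr r (p - ?r) (q + ?r - 1) (dr r p q a) = \<one>\<^bsub>Er r (p - 2 * ?r) (q + 2 * ?r - 2)\<^esub>"
    if a: "a \<in> carrier (Er r p q)" for a
  proof -
    obtain x where x: "x \<in> Zr ?r p ?n" "a = add_coset (Br ?r p ?n) x"
      using lift[OF a] by blast
    have e: "p - 2 * ?r = p - ?r - ?r" "q + 2 * ?r - 2 = q + ?r - 1 + ?r - 1" by simp_all
    have n'': "p - ?r - ?r + (q + ?r - 1 + ?r - 1) = ?n - 1 - 1" by simp
    have "D (D x) = 0" using x D_D by (auto simp: Zr_def)
    moreover have "dr r (p - ?r) (q + ?r - 1) (dr r p q a) = add_coset (Br ?r (p - ?r - ?r) (?n - 1 - 1)) (D (D x))"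
      using dr_coset[OF r x(1)] dr_coset[OF r, of "D x" "p - ?r" "q + ?r - 1", unfolded n'] D_Zr[OF x(1)] x(2)
      by simp
    ultimately show ?thesis unfolding e using presents_zero[OF pr[of "p - ?r - ?r" "q + ?r - 1 + ?r - 1", unfolded n'']]
      by simp
  qed
  show "Er (Suc r) p q \<cong> homology_at (Er r (p + ?r) (q - ?r + 1)) (dr r (p + ?r) (q - ?r + 1))
      (Er r p q) (dr r p q) (Er r (p - ?r) (q + ?r - 1))"
    using presents_Er[of "Suc r" p q] by (intro presents_iso[OF _ presents_next_page[OF r]]) (simp add: add.commute)
  show "trivial_group (Er r p q)" if "p < 0 \<or> q < 0"
  proof -
    have "x \<in> Br ?r p ?n" if x: "x \<in> Zr ?r p ?n" for x
    proof -
      \<comment> \<open>For q < 0 the total degree is at most p - 1, where the filtration has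
        already become stationary.\<close>
      have "x \<in> K (p - 1) ?n"
      proof (cases "p < 0")
        case True
        then show ?thesis using x K_neg K_0 by (auto simp: Zr_def)
      next
        case False
        then show ?thesis using x \<open>p < 0 \<or> q < 0\<close> by (auto simp: Zr_def intro!: K_all[of x p ?n "p - 1"])
      qed
      then have "x \<in> Zr (?r - 1) (p - 1) ?n" using x by (auto simp: Zr_def)
      then have "x + D 0 \<in> Br ?r p ?n" unfolding Br_def using subg_zero[OF subg_Zr] by blast
      then show ?thesis by (simp add: D_0)
    qed
    then have "carrier (Er r p q) \<subseteq> {\<one>\<^bsub>Er r p q\<^esub>}"
      unfolding presentsD(5)[OF pr[of p q], symmetric] using presentsD(8)[OF pr[of p q]] by blast
    then show ?thesis using presentsD(4)[OF pr[of p q]] by (simp add: group.trivial_group_subset)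
  qed
qed

text \<open>The group H n is filtered by the classes of cycles of filtration p. Once r exceeds p and
  q + 1, approximate cycles are cycles and every boundary of filtration p has a preimage among the
  allowed ones, so the page and the graded piece have equal numerators and equal
  denominators.\<close>

lemma converges_to_Er:
  assumes r0: "r0 \<ge> 1"
    and H: "\<And>n. presents {x \<in> K n n. D x = 0} (D ` K (n + 1) (n + 1)) (\<eta> n) (H n)"
  shows "converges_to r0 Er H"
  unfolding converges_to_def
proof (intro exI conjI allI impI)
  define cyc where "cyc p n = {x \<in> K p n. D x = 0}" for p n
  define Fil where "Fil n p = \<eta> n ` cyc p n" for n p
  have subg_cyc: "subg (cyc p n)" for p n by (auto simp: subg_def cyc_def K_0 K_diff D_0 D_diff)
  have cyc_mono: "cyc p n \<subseteq> cyc p' n" if "p \<le> p'" for p p' n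
    using K_mono[OF that] by (auto simp: cyc_def)
  have cyc_all: "cyc p n \<subseteq> cyc n n" for p n by (auto simp: cyc_def intro: K_all)
  note H' = H[folded cyc_def]
  show "subgroup (Fil n p) (H n)" for n p
    unfolding Fil_def by (rule presents_carrier_update(1)[OF H' subg_cyc cyc_all])
  show "Fil n p \<subseteq> Fil n (p + 1)" for n p
    unfolding Fil_def using cyc_mono[of p "p + 1"] by auto
  show "Fil n p = {\<one>\<^bsub>H n\<^esub>}" if "p < 0" for n p
    using that presents_zero[OF H] by (auto simp: Fil_def cyc_def K_neg D_0)
  show "Fil n p = carrier (H n)" if "n \<le> p" for n p
    using presentsD(5)[OF H'[of n]] cyc_all[of p n] cyc_mono[OF that, of n] unfolding Fil_def by blast
  show "Er r p q \<cong> H (p + q)\<lparr>carrier := Fil (p + q) p\<rparr> Mod Fil (p + q) (p - 1)"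
    if "r0 \<le> r \<and> p < int r \<and> q + 1 < int r" for r p q
  proof -
    have r1: "r \<ge> 1" using that r0 by simp
    let ?n = "p + q" and ?r = "int r"
    note p1 = presents_carrier_update(2)[OF H' subg_cyc cyc_all, of p ?n, folded Fil_def]
    have "subgroup (Fil ?n (p - 1)) (H ?n\<lparr>carrier := Fil ?n p\<rparr>)"
      unfolding Fil_def[of ?n "p - 1"]
      by (rule presents_carrier_update(1)[OF p1 subg_cyc]) (rule cyc_mono, simp)
    from presents_Mod[OF p1 this]
    have p2: "presents (cyc p ?n) {x \<in> cyc p ?n. \<eta> ?n x \<in> Fil ?n (p - 1)}
      (\<lambda>x. Fil ?n (p - 1) #>\<^bsub>H ?n\<lparr>carrier := Fil ?n p\<rparr>\<^esub> \<eta> ?n x)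
      (H ?n\<lparr>carrier := Fil ?n p\<rparr> Mod Fil ?n (p - 1))" .
    \<comment> \<open>As p < r, the boundary lies in a filtration step of negative index and is 0.
      The difference is the same for p - 1 and r - 1.\<close>
    have Z: "Zr ?r p ?n = cyc p ?n" using that by (auto simp: Zr_def cyc_def K_neg)
    have Z': "Zr (?r - 1) (p - 1) ?n = cyc (p - 1) ?n" using that by (auto simp: Zr_def cyc_def K_neg)
    have B: "Br ?r p ?n = {x \<in> cyc p ?n. \<eta> ?n x \<in> Fil ?n (p - 1)}"
    proof (intro equalityI subsetI)
      fix x assume x: "x \<in> Br ?r p ?n"
      then obtain z y where z: "x = z + D y" "z \<in> cyc (p - 1) ?n" "y \<in> Zr (?r - 1) (p + ?r - 1) (?n + 1)"
        unfolding Br_def Z' by blast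
      have xc: "x \<in> cyc p ?n" using x Br_subset[of ?r p ?n] r1 Z by auto
      have "D y \<in> D ` K (?n + 1) (?n + 1)" using z(3) by (auto simp: Zr_def intro: K_all)
      then have "\<eta> ?n x = \<eta> ?n z"
        using presents_eq_iff[OF H', of x ?n z] z(1,2) xc cyc_all by (auto simp: subset_iff)
      then show "x \<in> {x \<in> cyc p ?n. \<eta> ?n x \<in> Fil ?n (p - 1)}" using xc z(2) by (simp add: Fil_def)
    next
      fix x assume x: "x \<in> {x \<in> cyc p ?n. \<eta> ?n x \<in> Fil ?n (p - 1)}"
      then obtain z where z: "z \<in> cyc (p - 1) ?n" "\<eta> ?n x = \<eta> ?n z" by (auto simp: Fil_def)
      have "x - z \<in> D ` K (?n + 1) (?n + 1)"
        using presents_eq_iff[OF H', of x ?n z] z x cyc_all by (auto simp: subset_iff)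
      then obtain y where y: "y \<in> K (?n + 1) (?n + 1)" "x - z = D y" by blast
      have "D y \<in> K p ?n" unfolding y(2)[symmetric]
        using x z(1) cyc_mono[of "p - 1" p ?n] by (intro K_diff) (auto simp: cyc_def)
      \<comment> \<open>From q + 1 < r follows p + q + 1 \<le> p + r - 1, where the filtration in
        degree p + q + 1 is exhausted.\<close>
      moreover have "y \<in> K (p + ?r - 1) (?n + 1)" by (rule K_all[OF y(1)]) (use that in auto)
      ultimately have "y \<in> Zr (?r - 1) (p + ?r - 1) (?n + 1)" by (simp add: Zr_def)
      moreover have "x = z + D y" using y(2) by (simp add: algebra_simps)
      ultimately show "x \<in> Br ?r p ?n" using z(1) unfolding Br_def Z' by blast
    qed
    show ?thesis using presents_iso[OF presents_Er[OF r1] p2[folded Z B]] .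
  qed
qed

end

section \<open>The double complex of a cover\<close>

lemma aug_bd_nonzero: "aug_bd r u \<sigma> \<noteq> 0 \<Longrightarrow> \<exists>v. v \<in> Field r - \<sigma> \<and> u (insert v \<sigma>) \<noteq> 0"
  unfolding aug_bd_def by (metis (no_types, lifting) alt_simps(1) sum.neutral)

lemma bd_nonzero: "bd r u \<sigma> \<noteq> 0 \<Longrightarrow> \<sigma> \<noteq> {} \<and> (\<exists>v. v \<in> Field r - \<sigma> \<and> u (insert v \<sigma>) \<noteq> 0)"
  using aug_bd_nonzero[of r u \<sigma>] by (auto simp: bd_def split: if_splits)

section \<open>Maxima of chains and the contraction of a cone\<close>

context finite_poset
begin

lemma Chains_max:
  assumes "\<sigma> \<in> Chains r" "\<sigma> \<noteq> {}"
  shows "\<exists>t\<in>\<sigma>. \<forall>y\<in>\<sigma>. (y, t) \<in> r"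
proof -
  interpret op: finite_poset "r\<inverse>"
    by standard (use po in \<open>auto simp: partial_order_on_converse\<close>)
  have "\<sigma> \<in> Chains (r\<inverse>)" using assms by (auto simp: Chains_def)
  from op.vertex_0[OF this assms(2)] show ?thesis by auto
qed

text \<open>On basis elements this is the join with the apex m: a chain without m goes to its union
  with \<open>{m}\<close>, a chain containing m goes to 0. In particular \<open>{}\<close> goes to
  \<open>{m}\<close>.\<close>

definition cone :: "'a \<Rightarrow> ('a set \<Rightarrow> 'b::ab_group_add) \<Rightarrow> 'a set \<Rightarrow> 'b" where
  "cone m u \<sigma> = (if m \<in> \<sigma> then u (\<sigma> - {m}) else 0)"

text \<open>Deleting the apex, which has rank 0, returns \<open>u \<sigma>\<close> with sign +.
  Every other face keeps the apex below the deleted vertex, so its sign is reversed and it cancels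
  against the cone over the boundary. The empty chain is covered because the boundary is the
  augmented one.\<close>

lemma aug_bd_cone:
  assumes m: "m \<in> Field r" and \<sigma>: "\<sigma> \<in> Chains r" "\<And>v. v \<in> \<sigma> \<Longrightarrow> (m, v) \<in> r"
    and u: "\<And>\<sigma> v. u \<sigma> \<noteq> 0 \<Longrightarrow> v \<in> \<sigma> \<Longrightarrow> (m, v) \<in> r"
  shows "aug_bd r (cone m u) \<sigma> + cone m (aug_bd r u) \<sigma> = u \<sigma>"
proof -
  have f: "finite \<sigma>" using \<sigma>(1) by (rule finite_Chains)
  have "{y \<in> \<sigma> - {m}. y \<noteq> m \<and> (y, m) \<in> r} = {}" using \<sigma>(2) antisym by blast
  then have r0: "rank r (\<sigma> - {m}) m = 0" unfolding rank_def by (simp only: card.empty)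
  show ?thesis
  proof (cases "m \<in> \<sigma>")
    case True
    \<comment> \<open>m is among the vertices that can be inserted into \<sigma> - {m}; its term is
      \<open>u \<sigma>\<close>, and the remaining ones are to be cancelled.\<close>
    have "aug_bd r u (\<sigma> - {m}) = (\<Sum>v\<in>insert m (Field r - \<sigma>). alt (rank r (\<sigma> - {m}) v) (u (insert v (\<sigma> - {m}))))"
      unfolding aug_bd_def using True m by (intro sum.cong) auto
    also have "\<dots> = u \<sigma> + (\<Sum>v\<in>Field r - \<sigma>. alt (rank r (\<sigma> - {m}) v) (u (insert v (\<sigma> - {m}))))"
      using True by (subst sum.insert) (auto simp: r0 insert_absorb)
    finally have 1: "cone m (aug_bd r u) \<sigma> = \<dots>" using True by (simp add: cone_def)
    have "aug_bd r (cone m u) \<sigma> = (\<Sum>v\<in>Field r - \<sigma>. - alt (rank r (\<sigma> - {m}) v) (u (insert v (\<sigma> - {m}))))"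
      unfolding aug_bd_def
    proof (rule sum.cong)
      fix v assume v: "v \<in> Field r - \<sigma>"
      then have e: "insert v \<sigma> - {m} = insert v (\<sigma> - {m})" "v \<noteq> m" using True by auto
      have "rank r (insert m (\<sigma> - {m})) v = Suc (rank r (\<sigma> - {m}) v)" if "(m, v) \<in> r"
        using f e that by (subst rank_insert) auto
      moreover have "insert m (\<sigma> - {m}) = \<sigma>" using True by auto
      moreover have "u (insert v (\<sigma> - {m})) = 0" if "(m, v) \<notin> r" using u that by blast
      ultimately show "alt (rank r \<sigma> v) (cone m u (insert v \<sigma>)) = - alt (rank r (\<sigma> - {m}) v) (u (insert v (\<sigma> - {m})))"
        using True by (cases "(m, v) \<in> r") (simp_all add: cone_def e)
    qed simp
    then show ?thesis unfolding 1 by (simp add: sum_negf)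
  next
    case False
    have e: "\<sigma> - {m} = \<sigma>" using False by auto
    have "aug_bd r (cone m u) \<sigma> = (\<Sum>v\<in>Field r - \<sigma>. if v = m then u \<sigma> else 0)"
      unfolding aug_bd_def using False r0 by (intro sum.cong) (auto simp: cone_def e)
    also have "\<dots> = u \<sigma>" using m False by (subst sum.delta) auto
    finally show ?thesis using False by (simp add: cone_def)
  qed
qed

end

lemma finite_poset_inclusion_order: "finite \<V> \<Longrightarrow> finite_poset (inclusion_order \<V>)"
  and Field_inclusion_order: "Field (inclusion_order \<V>) = \<V>"
proof -
  show F: "Field (inclusion_order \<V>) = \<V>" by (auto simp: inclusion_order_def Field_def)
  assume "finite \<V>"
  then show "finite_poset (inclusion_order \<V>)"
    by unfold_locales
      (auto simp: F, auto simp: inclusion_order_def partial_order_on_def preorder_on_def refl_on_def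
        intro!: transI antisymI)
qed

locale cover_complex = finite_poset S for S :: "'a rel" +
  fixes \<V> :: "'a set set"
  assumes finite_\<V>: "finite \<V>"
    and down: "\<And>v x y. v \<in> \<V> \<Longrightarrow> y \<in> v \<Longrightarrow> (x, y) \<in> S \<Longrightarrow> x \<in> v"
    and cover: "\<Union>\<V> = Field S"
    and basis: "basis_like \<V>"
begin

abbreviation R :: "'a set rel" where "R \<equiv> inclusion_order \<V>"

sublocale R: finite_poset R
  using finite_\<V> by (rule finite_poset_inclusion_order)

lemma R_iff: "(v, w) \<in> R \<longleftrightarrow> v \<in> \<V> \<and> w \<in> \<V> \<and> v \<subseteq> w"
  by (auto simp: inclusion_order_def)

text \<open>\<sigma> may be empty: these pairs carry the augmentation, a copy of the chains of the
  whole space. \<tau> may not, so there is no augmentation in the other direction.\<close>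

definition valid :: "'a set set \<Rightarrow> 'a set \<Rightarrow> bool" where
  "valid \<sigma> \<tau> \<longleftrightarrow> \<sigma> \<in> Chains R \<and> \<tau> \<in> Chains S \<and> \<tau> \<noteq> {} \<and> (\<forall>v\<in>\<sigma>. \<tau> \<subseteq> v)"

lemma valid_finite: "valid \<sigma> \<tau> \<Longrightarrow> finite \<sigma>" "valid \<sigma> \<tau> \<Longrightarrow> finite \<tau>"
  using finite_Chains R.finite_Chains by (auto simp: valid_def)

lemma valid_face: "valid \<sigma> \<tau> \<Longrightarrow> \<sigma>' \<subseteq> \<sigma> \<Longrightarrow> \<tau>' \<subseteq> \<tau> \<Longrightarrow> \<tau>' \<noteq> {} \<Longrightarrow> valid \<sigma>' \<tau>'"
  using Chains_subset[of \<sigma>' \<sigma> R] Chains_subset[of \<tau>' \<tau> S] unfolding valid_def by blast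

definition d1 :: "('a set set \<times> 'a set \<Rightarrow> int) \<Rightarrow> 'a set set \<Rightarrow> 'a set \<Rightarrow> int" where
  "d1 x \<sigma> \<tau> = aug_bd R (\<lambda>\<sigma>. x (\<sigma>, \<tau>)) \<sigma>"

text \<open>The sign depends on \<open>card \<sigma>\<close> so that this operator anticommutes with
  \<open>d1\<close>, which changes that cardinality by one.\<close>

definition d2 :: "('a set set \<times> 'a set \<Rightarrow> int) \<Rightarrow> 'a set set \<Rightarrow> 'a set \<Rightarrow> int" where
  "d2 x \<sigma> \<tau> = alt (card \<sigma>) (bd S (\<lambda>\<tau>. x (\<sigma>, \<tau>)) \<tau>)"

definition Daug :: "('a set set \<times> 'a set \<Rightarrow> int) \<Rightarrow> 'a set set \<times> 'a set \<Rightarrow> int" where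
  "Daug x = (\<lambda>(\<sigma>, \<tau>). d1 x \<sigma> \<tau> + d2 x \<sigma> \<tau>)"

definition res :: "('a set set \<times> 'a set \<Rightarrow> int) \<Rightarrow> 'a set set \<times> 'a set \<Rightarrow> int" where
  "res x = (\<lambda>(\<sigma>, \<tau>). if \<sigma> = {} then 0 else x (\<sigma>, \<tau>))"

text \<open>The pairs with empty \<sigma> span a subcomplex for \<open>Daug\<close>. This is the
  differential of the quotient, realised on functions that vanish on those pairs.\<close>

definition D :: "('a set set \<times> 'a set \<Rightarrow> int) \<Rightarrow> 'a set set \<times> 'a set \<Rightarrow> int" where
  "D x = res (Daug x)"

text \<open>The 2 arises since both dimensions are cardinality minus one; empty \<sigma> counts as
  dimension -1.\<close>

definition aug :: "int \<Rightarrow> ('a set set \<times> 'a set \<Rightarrow> int) set" where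
  "aug n = {x. \<forall>\<sigma> \<tau>. x (\<sigma>, \<tau>) \<noteq> 0 \<longrightarrow> valid \<sigma> \<tau> \<and> int (card \<sigma>) + int (card \<tau>) = n + 2}"

definition K :: "int \<Rightarrow> int \<Rightarrow> ('a set set \<times> 'a set \<Rightarrow> int) set" where
  "K p n = {x \<in> aug n. \<forall>\<sigma> \<tau>. x (\<sigma>, \<tau>) \<noteq> 0 \<longrightarrow> \<sigma> \<noteq> {} \<and> int (card \<sigma>) \<le> p + 1}"

lemma augD: "x \<in> aug n \<Longrightarrow> x (\<sigma>, \<tau>) \<noteq> 0 \<Longrightarrow> valid \<sigma> \<tau> \<and> int (card \<sigma>) + int (card \<tau>) = n + 2"
  by (auto simp: aug_def)

lemma subg_support: "subg {x :: 'c \<times> 'd \<Rightarrow> int. \<forall>\<sigma> \<tau>. x (\<sigma>, \<tau>) \<noteq> 0 \<longrightarrow> P \<sigma> \<tau>}"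
  unfolding subg_def
proof (intro conjI ballI CollectI allI impI)
  fix x y :: "'c \<times> 'd \<Rightarrow> int" and \<sigma> \<tau>
  assume "x \<in> {x. \<forall>\<sigma> \<tau>. x (\<sigma>, \<tau>) \<noteq> 0 \<longrightarrow> P \<sigma> \<tau>}" "y \<in> {x. \<forall>\<sigma> \<tau>. x (\<sigma>, \<tau>) \<noteq> 0 \<longrightarrow> P \<sigma> \<tau>}"
    and "(x - y) (\<sigma>, \<tau>) \<noteq> 0"
  moreover from this have "x (\<sigma>, \<tau>) \<noteq> 0 \<or> y (\<sigma>, \<tau>) \<noteq> 0" by auto
  ultimately show "P \<sigma> \<tau>" by blast
qed simp

lemma subg_aug: "subg (aug n)"
  unfolding aug_def by (rule subg_support)

lemma K_eq: "K p n = {x. \<forall>\<sigma> \<tau>. x (\<sigma>, \<tau>) \<noteq> 0 \<longrightarrow>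
    valid \<sigma> \<tau> \<and> int (card \<sigma>) + int (card \<tau>) = n + 2 \<and> \<sigma> \<noteq> {} \<and> int (card \<sigma>) \<le> p + 1}"
  unfolding K_def aug_def by blast

lemma subg_K: "subg (K p n)"
  unfolding K_eq by (rule subg_support)

lemma d1_nonzero:
  assumes "x \<in> aug n" "d1 x \<sigma> \<tau> \<noteq> 0"
  shows "valid \<sigma> \<tau> \<and> int (card \<sigma>) + int (card \<tau>) = n + 1 \<and> (\<exists>v. v \<notin> \<sigma> \<and> x (insert v \<sigma>, \<tau>) \<noteq> 0)"
proof -
  obtain v where v: "v \<notin> \<sigma>" "x (insert v \<sigma>, \<tau>) \<noteq> 0"
    using aug_bd_nonzero[OF assms(2)[unfolded d1_def]] by blast
  note a = augD[OF assms(1) v(2)]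
  have "\<tau> \<noteq> {}" using a by (simp add: valid_def)
  then have vd: "valid \<sigma> \<tau>" using valid_face[OF conjunct1[OF a], of \<sigma> \<tau>] by blast
  have "card (insert v \<sigma>) = Suc (card \<sigma>)" using v(1) valid_finite(1)[OF vd] by simp
  then have "int (card \<sigma>) + int (card \<tau>) = n + 1" using a by simp
  then show ?thesis using vd v by blast
qed

lemma d2_nonzero:
  assumes "x \<in> aug n" "d2 x \<sigma> \<tau> \<noteq> 0"
  shows "valid \<sigma> \<tau> \<and> int (card \<sigma>) + int (card \<tau>) = n + 1 \<and> (\<exists>w. w \<notin> \<tau> \<and> x (\<sigma>, insert w \<tau>) \<noteq> 0)"
proof -
  have b: "bd S (\<lambda>\<tau>. x (\<sigma>, \<tau>)) \<tau> \<noteq> 0" using assms(2) by (simp add: d2_def)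
  obtain w where w: "\<tau> \<noteq> {}" "w \<notin> \<tau>" "x (\<sigma>, insert w \<tau>) \<noteq> 0"
    using bd_nonzero[OF b] by blast
  note a = augD[OF assms(1) w(3)]
  have vd: "valid \<sigma> \<tau>" using w(1) valid_face[OF conjunct1[OF a], of \<sigma> \<tau>] by blast
  have "card (insert w \<tau>) = Suc (card \<tau>)" using w(2) valid_finite(2)[OF vd] by simp
  then have "int (card \<sigma>) + int (card \<tau>) = n + 1" using a by simp
  then show ?thesis using vd w by blast
qed

lemma Daug_aug:
  assumes "x \<in> aug n"
  shows "Daug x \<in> aug (n - 1)"
  unfolding aug_def
proof clarify
  fix \<sigma> \<tau> assume "Daug x (\<sigma>, \<tau>) \<noteq> 0"
  then have "d1 x \<sigma> \<tau> \<noteq> 0 \<or> d2 x \<sigma> \<tau> \<noteq> 0" by (auto simp: Daug_def)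
  then show "valid \<sigma> \<tau> \<and> int (card \<sigma>) + int (card \<tau>) = n - 1 + 2"
    using d1_nonzero[OF assms] d2_nonzero[OF assms] by auto
qed

lemma d1_add: "d1 (x + y) \<sigma> \<tau> = d1 x \<sigma> \<tau> + d1 y \<sigma> \<tau>"
  by (simp add: d1_def aug_bd_def alt_add sum.distrib)

lemma d2_add: "d2 (x + y) \<sigma> \<tau> = d2 x \<sigma> \<tau> + d2 y \<sigma> \<tau>"
  by (simp add: d2_def bd_def aug_bd_def alt_add sum.distrib)

lemma Daug_add: "Daug (x + y) = Daug x + Daug y"
  by (auto simp: Daug_def fun_eq_iff d1_add d2_add)

lemma Daug_diff: "Daug (x - y) = Daug x - Daug y"
  using Daug_add[of "x - y" y] by (simp only: diff_add_cancel add_diff_cancel)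

lemma Daug_0 [simp]: "Daug 0 = 0"
  using Daug_add[of 0 0] by simp

lemma res_add: "res (x + y) = res x + res y"
  by (auto simp: res_def fun_eq_iff)

lemma D_add: "D (x + y) = D x + D y"
  by (simp only: D_def res_add Daug_add)

lemma Daug_Daug:
  assumes x: "x \<in> aug n"
  shows "Daug (Daug x) = 0"
proof (rule ext)
  fix a :: "'a set set \<times> 'a set"
  obtain \<sigma> \<tau> where a: "a = (\<sigma>, \<tau>)" by (cases a)
  show "Daug (Daug x) a = 0 a"
  proof (rule ccontr)
    assume "Daug (Daug x) a \<noteq> 0 a"
    then have "Daug (Daug x) (\<sigma>, \<tau>) \<noteq> 0" by (simp add: a)
    \<comment> \<open>A nonzero value makes \<sigma> finite, so that inserting a vertex really
      raises the cardinality in the sign of \<open>d2\<close>.\<close>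
    then have v: "valid \<sigma> \<tau>" using augD[OF Daug_aug[OF Daug_aug[OF x]]] by blast
    then have f: "finite \<sigma>" and t: "\<tau> \<noteq> {}" using valid_finite(1)[OF v] by (auto simp: valid_def)
    let ?d1 = "\<lambda>p. d1 x (fst p) (snd p)" and ?d2 = "\<lambda>p. d2 x (fst p) (snd p)"
    have D: "Daug x = ?d1 + ?d2" by (auto simp: Daug_def fun_eq_iff)
    have "d1 ?d1 \<sigma> \<tau> = aug_bd R (aug_bd R (\<lambda>\<sigma>. x (\<sigma>, \<tau>))) \<sigma>"
      by (simp add: d1_def)
    also have "\<dots> = 0" using augD[OF x] by (intro R.aug_bd_aug_bd) (auto simp: valid_def)
    finally have 11: "d1 ?d1 \<sigma> \<tau> = 0" .
    have "d2 ?d2 \<sigma> \<tau> = bd S (\<lambda>\<tau>. alt (card \<sigma>) (alt (card \<sigma>) (bd S (\<lambda>\<tau>. x (\<sigma>, \<tau>)) \<tau>))) \<tau>"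
      by (simp only: d2_def fst_conv snd_conv) (simp add: bd_def aug_bd_def alt_sum alt_commute)
    also have "\<dots> = bd S (bd S (\<lambda>\<tau>. x (\<sigma>, \<tau>))) \<tau>" by simp
    also have "\<dots> = 0" using augD[OF x] by (intro bd_bd) (auto simp: valid_def)
    finally have 22: "d2 ?d2 \<sigma> \<tau> = 0" .
    \<comment> \<open>Applied second, \<open>d1\<close> evaluates \<open>d2\<close> at
      \<open>insert v \<sigma>\<close>, one element larger. This produces the minus sign relative to
      the other order.\<close>
    have "d1 ?d2 \<sigma> \<tau> = (\<Sum>v\<in>Field R - \<sigma>. \<Sum>w\<in>Field S - \<tau>.
        - alt (card \<sigma>) (alt (rank R \<sigma> v) (alt (rank S \<tau> w) (x (insert v \<sigma>, insert w \<tau>)))))"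
      using f t by (simp add: d1_def d2_def aug_bd_def bd_def alt_sum card_insert_disjoint sum_negf alt_commute)
    also have "\<dots> = (\<Sum>w\<in>Field S - \<tau>. \<Sum>v\<in>Field R - \<sigma>.
        - alt (card \<sigma>) (alt (rank R \<sigma> v) (alt (rank S \<tau> w) (x (insert v \<sigma>, insert w \<tau>)))))"
      by (rule sum.swap)
    also have "\<dots> = - d2 ?d1 \<sigma> \<tau>"
      using t by (simp add: d1_def d2_def aug_bd_def bd_def alt_sum sum_negf alt_commute)
    finally have "d1 ?d2 \<sigma> \<tau> + d2 ?d1 \<sigma> \<tau> = 0" by simp
    moreover have "Daug (Daug x) a = d1 (Daug x) \<sigma> \<tau> + d2 (Daug x) \<sigma> \<tau>" by (simp add: a Daug_def[of "Daug x"])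
    ultimately have "Daug (Daug x) a = 0" using 11 22 unfolding D d1_add d2_add by simp
    then show False using \<open>Daug (Daug x) a \<noteq> 0 a\<close> by simp
  qed
qed

text \<open>At nonempty \<sigma> the operator only looks at nonempty chains, so the discarded values
  never feed back. Hence \<open>D\<close> inherits square zero from \<open>Daug\<close>.\<close>

lemma res_Daug_res: "res (Daug (res x)) = res (Daug x)"
proof -
  have "Daug (res x) (\<sigma>, \<tau>) = Daug x (\<sigma>, \<tau>)" if "\<sigma> \<noteq> {}" for \<sigma> \<tau>
    using that by (simp add: Daug_def d1_def d2_def res_def aug_bd_def)
  then show ?thesis by (auto simp: res_def fun_eq_iff)
qed

lemma K_aug: "x \<in> K p n \<Longrightarrow> x \<in> aug n"
  by (simp add: K_def)

text \<open>\<tau> has at least one vertex, so the dimension of \<sigma> is bounded by the total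
  degree and the filtration condition is automatic.\<close>

lemma res_K:
  assumes "x \<in> aug n" "n \<le> p"
  shows "res x \<in> K p n"
proof -
  have "valid \<sigma> \<tau> \<and> int (card \<sigma>) + int (card \<tau>) = n + 2 \<and> \<sigma> \<noteq> {} \<and> int (card \<sigma>) \<le> p + 1"
    if "res x (\<sigma>, \<tau>) \<noteq> 0" for \<sigma> \<tau>
  proof -
    have "x (\<sigma>, \<tau>) \<noteq> 0" "\<sigma> \<noteq> {}" using that by (auto simp: res_def split: if_splits)
    moreover note a = augD[OF assms(1) this(1)]
    moreover have "card \<tau> > 0" using a valid_finite(2)[of \<sigma> \<tau>] by (simp add: card_gt_0_iff valid_def)
    ultimately show ?thesis using assms(2) by auto
  qed
  then show ?thesis by (auto simp: K_def aug_def)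
qed

lemma res_id: "x \<in> K p n \<Longrightarrow> res x = x"
  by (auto simp: K_def res_def fun_eq_iff)

lemma D_K:
  assumes "x \<in> K p n"
  shows "D x \<in> K p (n - 1)"
proof -
  note x = K_aug[OF assms]
  have "valid \<sigma> \<tau> \<and> int (card \<sigma>) + int (card \<tau>) = n - 1 + 2 \<and> \<sigma> \<noteq> {} \<and> int (card \<sigma>) \<le> p + 1"
    if "D x (\<sigma>, \<tau>) \<noteq> 0" for \<sigma> \<tau>
  proof -
    have "d1 x \<sigma> \<tau> \<noteq> 0 \<or> d2 x \<sigma> \<tau> \<noteq> 0" and s: "\<sigma> \<noteq> {}"
      using that by (auto simp: D_def res_def Daug_def split: if_splits)
    then show ?thesis
    proof (elim disjE)
      assume "d1 x \<sigma> \<tau> \<noteq> 0"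
      from d1_nonzero[OF x this] obtain v where v: "valid \<sigma> \<tau>" "int (card \<sigma>) + int (card \<tau>) = n + 1"
        "v \<notin> \<sigma>" "x (insert v \<sigma>, \<tau>) \<noteq> 0" by blast
      then have "int (card (insert v \<sigma>)) \<le> p + 1" using assms by (auto simp: K_def)
      then show ?thesis using v s valid_finite by auto
    next
      assume "d2 x \<sigma> \<tau> \<noteq> 0"
      from d2_nonzero[OF x this] obtain w where w: "valid \<sigma> \<tau>" "int (card \<sigma>) + int (card \<tau>) = n + 1"
        "x (\<sigma>, insert w \<tau>) \<noteq> 0" by blast
      then have "int (card \<sigma>) \<le> p + 1" using assms by (auto simp: K_def)
      then show ?thesis using w s by auto
    qed
  qed
  then show ?thesis by (auto simp: K_def aug_def)
qed

sublocale filtered_complex K D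
proof
  show "D (x + y) = D x + D y" for x y by (rule D_add)
  show "subg (K p n)" for p n by (rule subg_K)
  show "D x \<in> K p (n - 1)" if "x \<in> K p n" for x p n using that by (rule D_K)
  show "K p n \<subseteq> K p' n" if "p \<le> p'" for p p' n using that by (force simp: K_def)
  show "K p n = {0}" if "p < 0" for p n
  proof (intro equalityI subsetI)
    fix x assume x: "x \<in> K p n"
    have "x (\<sigma>, \<tau>) = 0" for \<sigma> \<tau>
    proof (rule ccontr)
      assume a: "x (\<sigma>, \<tau>) \<noteq> 0"
      then have "valid \<sigma> \<tau>" "\<sigma> \<noteq> {}" "int (card \<sigma>) \<le> p + 1" using x by (auto simp: K_eq)
      moreover have "card \<sigma> > 0" using calculation valid_finite(1)[of \<sigma> \<tau>] by (simp add: card_gt_0_iff)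
      ultimately show False using that by simp
    qed
    then show "x \<in> {0}" by (auto simp: fun_eq_iff)
  qed (simp add: subg_zero[OF subg_K])
  show "K p n = K n n" if "n \<le> p" for p n
    using that by (intro equalityI subsetI) (metis K_aug res_K res_id order_refl)+
  show "D (D x) = 0" if "x \<in> K p n" for x p n
  proof -
    have "D (D x) = res (Daug (Daug x))" by (simp add: D_def res_Daug_res)
    also have "\<dots> = 0" using Daug_Daug[OF K_aug[OF that]] by (auto simp: res_def fun_eq_iff)
    finally show ?thesis .
  qed
qed

section \<open>Acyclicity of the augmented double complex\<close>

lemma ex_least_member:
  assumes "\<tau> \<in> Chains S" "\<tau> \<noteq> {}"
  shows "\<exists>m\<in>\<V>. \<tau> \<subseteq> m \<and> (\<forall>v\<in>\<V>. \<tau> \<subseteq> v \<longrightarrow> m \<subseteq> v)"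
proof -
  obtain t where t: "t \<in> \<tau>" "\<forall>y\<in>\<tau>. (y, t) \<in> S" using Chains_max[OF assms] by blast
  then have "t \<in> \<Union>\<V>" using cover Chains_Field[OF assms(1)] by auto
  then have "{v\<in>\<V>. t \<in> v} \<noteq> {}" "finite {v\<in>\<V>. t \<in> v}" using finite_\<V> by auto
  from finite_has_minimal[OF this(2,1)] obtain m where m0: "m \<in> {v\<in>\<V>. t \<in> v}"
    "\<forall>b\<in>{v\<in>\<V>. t \<in> v}. b \<subseteq> m \<longrightarrow> m = b" by blast
  then have m: "m \<in> \<V>" "t \<in> m" and m_min: "\<And>v. v \<in> \<V> \<Longrightarrow> t \<in> v \<Longrightarrow> v \<subseteq> m \<Longrightarrow> m = v" by blast+
  have "m \<subseteq> v" if v: "v \<in> \<V>" "\<tau> \<subseteq> v" for v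
  proof -
    \<comment> \<open>Minimality of m among the members around t forces W = m, and W lies in v: a
      minimal member is the least one.\<close>
    obtain W where "W \<in> \<V>" "t \<in> W" "W \<subseteq> m \<inter> v"
      using basis m v(1) subsetD[OF v(2) t(1)] unfolding basis_like_def by (metis IntI)
    then show ?thesis using m_min[of W] by blast
  qed
  moreover have "\<tau> \<subseteq> m" using t down[OF m(1,2)] by blast
  ultimately show ?thesis using m(1) by blast
qed

definition least_member :: "'a set \<Rightarrow> 'a set" where
  "least_member \<tau> = (SOME m. m \<in> \<V> \<and> \<tau> \<subseteq> m \<and> (\<forall>v\<in>\<V>. \<tau> \<subseteq> v \<longrightarrow> m \<subseteq> v))"

lemma least_member:
  assumes "\<tau> \<in> Chains S" "\<tau> \<noteq> {}"
  shows "least_member \<tau> \<in> \<V>" "\<tau> \<subseteq> least_member \<tau>" "\<And>v. v \<in> \<V> \<Longrightarrow> \<tau> \<subseteq> v \<Longrightarrow> least_member \<tau> \<subseteq> v"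
  using someI_ex[of "\<lambda>m. m \<in> \<V> \<and> \<tau> \<subseteq> m \<and> (\<forall>v\<in>\<V>. \<tau> \<subseteq> v \<longrightarrow> m \<subseteq> v)"] ex_least_member[OF assms]
  unfolding least_member_def by blast+

text \<open>For each \<tau> separately, the contraction with apex
  \<open>least_member \<tau>\<close>. The apex varies with \<tau>, which is what spoils
  compatibility with \<open>d2\<close>.\<close>

definition htpy :: "('a set set \<times> 'a set \<Rightarrow> int) \<Rightarrow> 'a set set \<times> 'a set \<Rightarrow> int" where
  "htpy x = (\<lambda>(\<sigma>, \<tau>). R.cone (least_member \<tau>) (\<lambda>\<sigma>. x (\<sigma>, \<tau>)) \<sigma>)"

lemma Chains_R_subset: "\<sigma> \<in> Chains R \<Longrightarrow> \<sigma> \<subseteq> \<V>"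
  using Chains_Field[of \<sigma> R] by (simp add: Field_inclusion_order)

lemma valid_least: "valid \<sigma> \<tau> \<Longrightarrow> v \<in> \<sigma> \<Longrightarrow> (least_member \<tau>, v) \<in> R"
  using least_member(1)[of \<tau>] least_member(3)[of \<tau> v] Chains_R_subset[of \<sigma>] unfolding valid_def R_iff by blast

lemma htpy_aug:
  assumes x: "x \<in> aug n"
  shows "htpy x \<in> aug (n + 1)"
  unfolding aug_def
proof clarify
  fix \<sigma> \<tau> assume "htpy x (\<sigma>, \<tau>) \<noteq> 0"
  then have m: "least_member \<tau> \<in> \<sigma>" "x (\<sigma> - {least_member \<tau>}, \<tau>) \<noteq> 0" by (auto simp: htpy_def R.cone_def split: if_splits)
  note a = augD[OF x m(2)]
  then have \<tau>: "\<tau> \<in> Chains S" "\<tau> \<noteq> {}" by (auto simp: valid_def)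
  note l = least_member[OF \<tau>]
  have c: "\<sigma> - {least_member \<tau>} \<in> Chains R" using a by (auto simp: valid_def)
  have "(least_member \<tau>, v) \<in> R" if "v \<in> \<sigma>" for v
    using valid_least[of "\<sigma> - {least_member \<tau>}" \<tau> v] a that l(1) by (cases "v = least_member \<tau>") (auto simp: R_iff)
  then have "\<sigma> \<in> Chains R" using c by (auto simp: Chains_def)
  then have vd: "valid \<sigma> \<tau>" using a l(2) by (auto simp: valid_def)
  then show "valid \<sigma> \<tau> \<and> int (card \<sigma>) + int (card \<tau>) = n + 1 + 2"
    using a card_Suc_Diff1[OF valid_finite(1)[OF vd] m(1)] by auto
qed

lemma d1_htpy:
  assumes x: "x \<in> aug n" and v: "valid \<sigma> \<tau>"
  shows "d1 (htpy x) \<sigma> \<tau> + (if least_member \<tau> \<in> \<sigma> then d1 x (\<sigma> - {least_member \<tau>}) \<tau> else 0) = x (\<sigma>, \<tau>)"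
proof -
  have "aug_bd R (R.cone (least_member \<tau>) (\<lambda>\<sigma>. x (\<sigma>, \<tau>))) \<sigma> + R.cone (least_member \<tau>) (aug_bd R (\<lambda>\<sigma>. x (\<sigma>, \<tau>))) \<sigma> = x (\<sigma>, \<tau>)"
  proof (rule R.aug_bd_cone)
    show "least_member \<tau> \<in> Field R" using v least_member(1)[of \<tau>] by (simp add: valid_def Field_inclusion_order)
    show "\<sigma> \<in> Chains R" using v by (simp add: valid_def)
    show "(least_member \<tau>, v) \<in> R" if "v \<in> \<sigma>" for v using valid_least[OF v that] .
    show "(least_member \<tau>, v) \<in> R" if "x (\<sigma>', \<tau>) \<noteq> 0" "v \<in> \<sigma>'" for \<sigma>' v
      using valid_least augD[OF x that(1)] that(2) by blast
  qed
  then show ?thesis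
    by (cases "least_member \<tau> \<in> \<sigma>")
      (simp_all add: d1_def htpy_def R.cone_def[of _ "aug_bd R (\<lambda>\<sigma>. x (\<sigma>, \<tau>))"])
qed

text \<open>\<open>D s + s D = id + N\<close> for the homotopy \<open>s\<close>, where \<open>N\<close> lowers the dimension of the chain of points.\<close>

lemma aug_acyclic_aux:
  assumes "x \<in> aug n" "Daug x = 0" "\<And>\<sigma> \<tau>. x (\<sigma>, \<tau>) \<noteq> 0 \<Longrightarrow> card \<tau> \<le> k"
  shows "\<exists>y\<in>aug (n + 1). Daug y = x"
  using assms
proof (induction k arbitrary: x)
  case 0
  have "x (\<sigma>, \<tau>) = 0" for \<sigma> \<tau>
  proof (rule ccontr)
    assume a: "x (\<sigma>, \<tau>) \<noteq> 0"
    then show False using 0(3)[OF a] augD[OF 0(1) a] valid_finite[of \<sigma> \<tau>] by (auto simp: valid_def)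
  qed
  then have "x = 0" by (auto simp: fun_eq_iff)
  then show ?case using Daug_0 subg_zero[OF subg_aug] by metis
next
  case (Suc k)
  note h = htpy_aug[OF Suc.prems(1)]
  \<comment> \<open>The error of the contraction. It is again a cycle, and it will be supported on
    \<tau> with at most k vertices, so the induction hypothesis fills it.\<close>
  define x' where "x' = Daug (htpy x) - x"
  have Dh: "Daug (htpy x) \<in> aug n" using Daug_aug[OF h] by simp
  have x': "x' \<in> aug n" unfolding x'_def using Dh Suc.prems(1) by (rule subg_diff[OF subg_aug])
  have "card \<tau> \<le> k" if "x' (\<sigma>, \<tau>) \<noteq> 0" for \<sigma> \<tau>
  proof (rule ccontr)
    assume k: "\<not> card \<tau> \<le> k"
    have v: "valid \<sigma> \<tau>" using augD[OF x' that] by simp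
    then have f: "finite \<tau>" using valid_finite by blast
    \<comment> \<open>\<tau> has more than k vertices, so x vanishes on all cofaces of \<tau>. Then
      \<open>d2 x\<close> is 0 at \<tau>, the cycle condition gives the same for
      \<open>d1 x\<close>, and the contraction reproduces x there without error.\<close>
    have big: "x (\<sigma>', insert w \<tau>) = 0" if "w \<notin> \<tau>" for \<sigma>' w
      using Suc.prems(3)[of \<sigma>' "insert w \<tau>"] f k that by auto
    have d2x: "d2 x \<sigma>' \<tau> = 0" for \<sigma>' using d2_nonzero[OF Suc.prems(1), of \<sigma>' \<tau>] big by blast
    have "d1 x \<sigma>' \<tau> = 0" for \<sigma>'
      using fun_cong[OF Suc.prems(2), of "(\<sigma>', \<tau>)"] d2x[of \<sigma>'] by (simp add: Daug_def)
    then have "d1 (htpy x) \<sigma> \<tau> = x (\<sigma>, \<tau>)" using d1_htpy[OF Suc.prems(1) v] by (simp split: if_splits)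
    moreover have "htpy x (\<sigma>, insert w \<tau>) = 0" if "w \<notin> \<tau>" for w
      using big[OF that] by (simp add: htpy_def R.cone_def)
    then have "d2 (htpy x) \<sigma> \<tau> = 0" using d2_nonzero[OF h, of \<sigma> \<tau>] by blast
    ultimately show False using that by (simp add: x'_def Daug_def)
  qed
  moreover have "Daug x' = 0" unfolding x'_def Daug_diff Daug_Daug[OF h] Suc.prems(2) by simp
  ultimately obtain y where y: "y \<in> aug (n + 1)" "Daug y = x'" using Suc.IH[OF x'] by blast
  have "Daug (htpy x - y) = x" using y(2) by (simp add: Daug_diff x'_def)
  then show ?case using subg_diff[OF subg_aug h y(1)] by blast
qed

lemma aug_acyclic:
  assumes "x \<in> aug n" "Daug x = 0"
  shows "\<exists>y\<in>aug (n + 1). Daug y = x"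
proof (rule aug_acyclic_aux[OF assms])
  fix \<sigma> \<tau> assume "x (\<sigma>, \<tau>) \<noteq> 0"
  then show "card \<tau> \<le> nat (n + 2)" using augD[OF assms(1)] by fastforce
qed

end

section \<open>Integral homology of posets\<close>

definition int_chains :: "'a rel \<Rightarrow> int \<Rightarrow> ('a set \<Rightarrow> int) set" where
  "int_chains r n = {u. \<forall>\<sigma>. u \<sigma> \<noteq> 0 \<longrightarrow> \<sigma> \<in> Ch r n}"

definition int_cycles :: "'a rel \<Rightarrow> int \<Rightarrow> ('a set \<Rightarrow> int) set" where
  "int_cycles r n = {u \<in> int_chains r n. bd r u = 0}"

definition hom_class :: "'a rel \<Rightarrow> int \<Rightarrow> ('a set \<Rightarrow> int) \<Rightarrow> ('a set \<Rightarrow> int) set" where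
  "hom_class r n u = (boundary r constant_Z (n + 1) ` carrier (chain_grp r constant_Z (n + 1)))
     #>\<^bsub>chain_grp r constant_Z n\<^esub> (\<lambda>\<sigma>\<in>Ch r n. u \<sigma>)"

lemma int_chainsD: "u \<in> int_chains r n \<Longrightarrow> \<sigma> \<notin> Ch r n \<Longrightarrow> u \<sigma> = 0"
  by (auto simp: int_chains_def)

lemma subg_int_chains: "subg (int_chains r n)"
  unfolding subg_def int_chains_def by (auto, (metis)+)

lemma presents_integer_group: "presents UNIV {0} id integer_group"
  by (auto simp: presents_def subg_def integer_group_def abelian_integer_group[unfolded integer_group_def])

context finite_poset
begin

lemma presented_constant_Z: "presented_functor r constant_Z (\<lambda>_. UNIV) (\<lambda>_. {0}) (\<lambda>_. id)"
  by unfold_locales (auto simp: constant_Z_def presents_integer_group[unfolded id_def] id_def)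

lemma chain_grp_constant_Z: "chain_grp r constant_Z n = sum_group (Ch r n) (\<lambda>_. integer_group)"
  by (simp add: chain_grp_def constant_Z_def)

lemma coeff_chains_int:
  "presented_functor.coeff_chains r (\<lambda>_. UNIV :: int set) n = int_chains r n"
  "presented_functor.coeff_chains r (\<lambda>_. {0 :: int}) n = {0}"
proof -
  interpret Z: presented_functor r constant_Z "\<lambda>_. UNIV" "\<lambda>_. {0}" "\<lambda>_. id" by (rule presented_constant_Z)
  show "Z.coeff_chains (\<lambda>_. UNIV :: int set) n = int_chains r n"
    by (auto simp: Z.coeff_chains_def int_chains_def)
  show "Z.coeff_chains (\<lambda>_. {0 :: int}) n = {0}"
    by (auto simp: Z.coeff_chains_def fun_eq_iff)
qed

lemma bd_int_chains: "u \<in> int_chains r n \<Longrightarrow> bd r u \<in> int_chains r (n - 1)"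
  using presented_functor.bd_coeff_chains[OF presented_constant_Z] by (simp add: coeff_chains_int)

lemma presents_int_homology:
  "presents (int_cycles r n) (bd r ` int_chains r (n + 1)) (hom_class r n) (poset_homology n r constant_Z)"
proof -
  interpret Z: presented_functor r constant_Z "\<lambda>_. UNIV" "\<lambda>_. {0}" "\<lambda>_. id" by (rule presented_constant_Z)
  have bb: "bd r (bd r w) = 0" if "w \<in> int_chains r (n + 1)" for w
    using that bd_bd[of w] by (auto simp: int_chains_def Ch_iff fun_eq_iff)
  have "bd r w \<in> int_chains r n" if "w \<in> int_chains r (n + 1)" for w using bd_int_chains[OF that] by simp
  then have "{u\<in>int_chains r n. bd r u = 0 \<and> (\<exists>w\<in>int_chains r (n + 1). u = bd r w)} = bd r ` int_chains r (n + 1)"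
    using bb by auto
  moreover have "Z.pr n u = (\<lambda>\<sigma>\<in>Ch r n. u \<sigma>)" for u by (simp add: Z.pr_def)
  ultimately show ?thesis using Z.presents_poset_homology[of n]
    by (simp add: coeff_chains_int int_cycles_def hom_class_def[abs_def])
qed

lemma boundary_image:
  "boundary r constant_Z (n + 1) ` carrier (chain_grp r constant_Z (n + 1)) =
     (\<lambda>w. \<lambda>\<sigma>\<in>Ch r n. bd r w \<sigma>) ` int_chains r (n + 1)"
proof -
  interpret Z: presented_functor r constant_Z "\<lambda>_. UNIV" "\<lambda>_. {0}" "\<lambda>_. id" by (rule presented_constant_Z)
  have "boundary r constant_Z (n + 1) ` carrier (chain_grp r constant_Z (n + 1)) =
      (\<lambda>w. boundary r constant_Z (n + 1) (Z.pr (n + 1) w)) ` int_chains r (n + 1)"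
    using presentsD(5)[OF Z.presents_chain_grp, of "n + 1"] by (simp add: coeff_chains_int image_image[symmetric])
  also have "\<dots> = (\<lambda>w. \<lambda>\<sigma>\<in>Ch r n. bd r w \<sigma>) ` int_chains r (n + 1)"
    using Z.boundary_pr[of _ "n + 1"] by (auto simp: coeff_chains_int Z.pr_def intro!: image_cong)
  finally show ?thesis .
qed

text \<open>\<open>inclusion_induced\<close> handles cosets as sets of restricted functions, so
  their elements have to be known explicitly.\<close>

lemma hom_class_eq:
  "hom_class r n u = (\<lambda>w. \<lambda>\<sigma>\<in>Ch r n. bd r w \<sigma> + u \<sigma>) ` int_chains r (n + 1)"
  unfolding hom_class_def boundary_image unfolding r_coset_def chain_grp_constant_Z mult_sum_group
  by (auto simp: restrict_def fun_eq_iff integer_group_def image_iff)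

section \<open>Homology of subposets and the maps induced by inclusions\<close>

lemma Restr_poset: "finite_poset (Restr r A)"
proof
  show "finite (Field (Restr r A))"
    by (rule finite_subset[OF _ finite_Field]) (auto simp: Field_def)
  show "Partial_order (Restr r A)" using po by (rule Partial_order_Restr)
qed

lemma Ch_Restr: "Ch (Restr r A) n = {\<sigma> \<in> Ch r n. \<sigma> \<subseteq> A}"
proof -
  have "\<sigma> \<in> Chains (Restr r A) \<longleftrightarrow> \<sigma> \<in> Chains r \<and> \<sigma> \<subseteq> A" for \<sigma> unfolding Chains_def by blast
  then show ?thesis by (auto simp: Ch_iff)
qed

lemma Field_Restr: "A \<subseteq> Field r \<Longrightarrow> Field (Restr r A) = A"
  using refl unfolding Field_def by blast

lemma int_chains_Restr: "u \<in> int_chains (Restr r A) n \<longleftrightarrow> u \<in> int_chains r n \<and> (\<forall>\<sigma>. u \<sigma> \<noteq> 0 \<longrightarrow> \<sigma> \<subseteq> A)"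
  by (auto simp: int_chains_def Ch_Restr)

text \<open>Ranks are computed inside \<sigma>, and inserting a vertex outside \<open>A\<close>
  meets a zero coefficient. So the boundary of the whole poset serves all subposets at once.\<close>

lemma bd_Restr:
  assumes A: "A \<subseteq> Field r" and u: "\<And>\<sigma>. u \<sigma> \<noteq> 0 \<Longrightarrow> \<sigma> \<subseteq> A"
  shows "bd (Restr r A) u = bd r u"
proof
  fix \<sigma>
  have "aug_bd (Restr r A) u \<sigma> = aug_bd r u \<sigma>"
  proof (cases "\<sigma> \<subseteq> A")
    case True
    have "aug_bd r u \<sigma> = (\<Sum>v\<in>A - \<sigma>. alt (rank r \<sigma> v) (u (insert v \<sigma>)))"
      unfolding aug_bd_def using A u by (intro sum.mono_neutral_right) auto
    also have "\<dots> = aug_bd (Restr r A) u \<sigma>"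
      unfolding aug_bd_def Field_Restr[OF A]
    proof (rule sum.cong)
      fix v assume "v \<in> A - \<sigma>"
      then have "{y \<in> \<sigma>. y \<noteq> v \<and> (y, v) \<in> r} = {y \<in> \<sigma>. y \<noteq> v \<and> (y, v) \<in> Restr r A}" using True by auto
      then show "alt (rank r \<sigma> v) (u (insert v \<sigma>)) = alt (rank (Restr r A) \<sigma> v) (u (insert v \<sigma>))"
        by (simp add: rank_def)
    qed simp
    finally show ?thesis by simp
  next
    case False
    then have "u (insert v \<sigma>) = 0" for v using u by blast
    then show ?thesis by (simp add: aug_bd_def)
  qed
  then show "bd (Restr r A) u \<sigma> = bd r u \<sigma>" by (simp add: bd_def)
qed

lemma int_cycles_Restr:
  assumes "A \<subseteq> Field r"
  shows "int_cycles (Restr r A) n = {u \<in> int_chains (Restr r A) n. bd r u = 0}"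
proof -
  have "bd (Restr r A) u = bd r u" if "u \<in> int_chains (Restr r A) n" for u
    using that by (intro bd_Restr[OF assms]) (simp add: int_chains_Restr)
  then show ?thesis unfolding int_cycles_def by (intro Collect_cong) auto
qed

text \<open>On representatives the induced map is the identity. Extending the coset by zero supplies
  only the boundaries of chains in \<open>A\<close>; saturation by all boundaries of r completes it
  to the coset of z.\<close>

lemma inclusion_induced_hom_class:
  assumes A: "A \<subseteq> Field r" and z: "z \<in> int_chains (Restr r A) n"
  shows "inclusion_induced n (Restr r A) r (hom_class (Restr r A) n z) = hom_class r n z"
proof -
  let ?s = "Restr r A"
  let ?cl = "\<lambda>w. \<lambda>\<sigma>\<in>Ch r n. bd r w \<sigma> + z \<sigma>"
  interpret s: finite_poset ?s by (rule Restr_poset)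
  have ext: "extend_chain n ?s r (\<lambda>\<sigma>\<in>Ch ?s n. bd ?s w \<sigma> + z \<sigma>) = ?cl w" if w: "w \<in> int_chains ?s (n + 1)" for w
  proof -
    have b: "bd ?s w \<in> int_chains ?s n" using s.bd_int_chains[OF w] by simp
    have "bd ?s w \<sigma> + z \<sigma> = 0" if "\<sigma> \<notin> Ch ?s n" for \<sigma> 
      by (simp add: int_chainsD[OF b that] int_chainsD[OF z that])
    moreover have "bd ?s w = bd r w" using w by (intro bd_Restr[OF A]) (auto simp: int_chains_Restr)
    ultimately show ?thesis by (auto simp: extend_chain_def fun_eq_iff restrict_def)
  qed
  have "extend_chain n ?s r ` hom_class ?s n z = ?cl ` int_chains ?s (n + 1)"
    unfolding s.hom_class_eq image_image using ext by (intro image_cong) auto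
  then have "inclusion_induced n ?s r (hom_class ?s n z) =
      (\<lambda>w. \<lambda>\<sigma>\<in>Ch r n. bd r w \<sigma>) ` int_chains r (n + 1) <#>\<^bsub>chain_grp r constant_Z n\<^esub> ?cl ` int_chains ?s (n + 1)"
    by (simp add: inclusion_induced_def boundary_image)
  also have "\<dots> = (\<Union>w'\<in>int_chains r (n + 1). \<Union>w\<in>int_chains ?s (n + 1). {?cl (w' + w)})"
  proof -
    have "(\<lambda>\<sigma>\<in>Ch r n. bd r w' \<sigma>) \<otimes>\<^bsub>chain_grp r constant_Z n\<^esub> ?cl w = ?cl (w' + w)" for w' w
      by (auto simp: chain_grp_constant_Z fun_eq_iff integer_group_def bd_add)
    then show ?thesis by (simp only: set_mult_def UN_simps)
  qed
  also have "\<dots> = ?cl ` int_chains r (n + 1)"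
  proof (intro equalityI subsetI)
    fix y assume "y \<in> (\<Union>w'\<in>int_chains r (n + 1). \<Union>w\<in>int_chains ?s (n + 1). {?cl (w' + w)})"
    then obtain w' w where w: "w' \<in> int_chains r (n + 1)" "w \<in> int_chains ?s (n + 1)" "y = ?cl (w' + w)" by blast
    have "w' + w \<in> int_chains r (n + 1)"
      using subg_add[OF subg_int_chains w(1)] w(2) int_chains_Restr by blast
    then show "y \<in> ?cl ` int_chains r (n + 1)" unfolding w(3) by (rule imageI)
  next
    fix y assume "y \<in> ?cl ` int_chains r (n + 1)"
    then obtain w where w: "w \<in> int_chains r (n + 1)" "y = ?cl (w + 0)" by auto
    then show "y \<in> (\<Union>w'\<in>int_chains r (n + 1). \<Union>w\<in>int_chains ?s (n + 1). {?cl (w' + w)})"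
      by (intro UN_I[OF w(1)] UN_I[OF subg_zero[OF subg_int_chains]]) simp
  qed
  also have "\<dots> = hom_class r n z" unfolding hom_class_eq ..
  finally show ?thesis .
qed

end

section \<open>Homology of the total complex\<close>

context cover_complex
begin

text \<open>The inclusion of the augmentation part. It lowers the degree by one, because the empty
  chain has dimension -1.\<close>

definition iota :: "('a set \<Rightarrow> int) \<Rightarrow> 'a set set \<times> 'a set \<Rightarrow> int" where
  "iota u = (\<lambda>(\<sigma>, \<tau>). if \<sigma> = {} then u \<tau> else 0)"

text \<open>The augmentation: the coefficient at \<tau> is the sum of the coefficients of x at the
  pairs ({v}, \<tau>), v a member of the cover.\<close>

definition eps :: "('a set set \<times> 'a set \<Rightarrow> int) \<Rightarrow> 'a set \<Rightarrow> int" where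
  "eps x \<tau> = d1 x {} \<tau>"

lemma valid_empty: "valid {} \<tau> \<and> int (card \<tau>) = n + 1 \<longleftrightarrow> \<tau> \<in> Ch S n"
proof -
  have "card \<tau> > 0 \<longleftrightarrow> \<tau> \<noteq> {}" if "\<tau> \<in> Chains S" for \<tau> using finite_Chains[OF that] by (simp add: card_gt_0_iff)
  then show ?thesis by (fastforce simp: valid_def Ch_iff Chains_def[of R])
qed

lemma iota_aug: "u \<in> int_chains S n \<Longrightarrow> iota u \<in> aug (n - 1)"
  unfolding aug_def
proof clarify
  fix \<sigma> \<tau> assume u: "u \<in> int_chains S n" "iota u (\<sigma>, \<tau>) \<noteq> 0"
  then have "\<sigma> = {}" "\<tau> \<in> Ch S n" by (auto simp: iota_def int_chains_def split: if_splits)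
  then show "valid \<sigma> \<tau> \<and> int (card \<sigma>) + int (card \<tau>) = n - 1 + 2" using valid_empty[of \<tau> n] by simp
qed

lemma aug_empty: "x \<in> aug n \<Longrightarrow> (\<lambda>\<tau>. x ({}, \<tau>)) \<in> int_chains S (n + 1)"
  using valid_empty[of _ "n + 1"] augD[of x n "{}"] by (fastforce simp: int_chains_def)

lemma iota_add: "iota (u + w) = iota u + iota w" and iota_diff: "iota (u - w) = iota u - iota w"
  and iota_0: "iota 0 = 0"
  by (auto simp: iota_def fun_eq_iff)

lemma iota_eq_0:
  assumes "iota u = 0"
  shows "u = 0"
proof
  fix \<tau> show "u \<tau> = 0 \<tau>" using fun_cong[OF assms, of "({}, \<tau>)"] by (simp add: iota_def)
qed

lemma bd_0: "bd r 0 = 0"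
  using bd_diff[of r 0 0] by simp

lemma Daug_iota: "Daug (iota u) = iota (bd S u)"
  by (auto simp: Daug_def iota_def fun_eq_iff d1_def d2_def aug_bd_def bd_def)

lemma res_iota: "x = res x + iota (\<lambda>\<tau>. x ({}, \<tau>))"
  by (auto simp: res_def iota_def fun_eq_iff)

lemma Daug_empty:
  assumes "x \<in> K p n"
  shows "(\<lambda>\<tau>. Daug x ({}, \<tau>)) = eps x"
proof -
  have "x ({}, \<tau>) = 0" for \<tau> using assms by (auto simp: K_def)
  then have "d2 x {} \<tau> = 0" for \<tau> by (simp add: d2_def bd_def aug_bd_def)
  then show ?thesis by (simp add: Daug_def eps_def fun_eq_iff)
qed

lemma Daug_K: "x \<in> K p n \<Longrightarrow> Daug x = D x + iota (eps x)"
  using res_iota[of "Daug x"] Daug_empty by (simp add: D_def)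

lemma eps_add: "eps (x + y) = eps x + eps y"
  by (auto simp: eps_def fun_eq_iff d1_add)

lemma eps_int_chains: "x \<in> K p n \<Longrightarrow> eps x \<in> int_chains S n"
  using aug_empty[OF Daug_aug[OF K_aug]] Daug_empty by fastforce

text \<open>The augmented complex is the mapping cone of \<^term>\<open>eps\<close>.\<close>

lemma presents_total_homology:
  "presents {x \<in> K n n. D x = 0} (D ` K (n + 1) (n + 1)) (\<lambda>x. hom_class S n (eps x))
     (poset_homology n S constant_Z)"
proof (rule presents_pull[OF presents_int_homology])
  show "subg {x \<in> K n n. D x = 0}" by (auto simp: subg_def K_0 K_diff D_0 D_diff)
  show "D ` K (n + 1) (n + 1) \<subseteq> {x \<in> K n n. D x = 0}"
  proof clarify
    fix y assume y: "y \<in> K (n + 1) (n + 1)"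
    then have "D y \<in> K (n + 1) n" using D_K[OF y] by simp
    then show "D y \<in> K n n \<and> D (D y) = 0" using D_D[OF y] K_all by blast
  qed
next
  fix x assume "x \<in> {x \<in> K n n. D x = 0}"
  then have x: "x \<in> K n n" "Daug x = iota (eps x)" using Daug_K by auto
  have "iota (bd S (eps x)) = Daug (Daug x)" by (simp add: x(2) Daug_iota)
  then have b: "bd S (eps x) = 0" using Daug_Daug[OF K_aug[OF x(1)]] iota_eq_0 by simp
  then show "eps x \<in> int_cycles S n" using eps_int_chains[OF x(1)] by (simp add: int_cycles_def)
  show "eps x \<in> bd S ` int_chains S (n + 1) \<longleftrightarrow> x \<in> D ` K (n + 1) (n + 1)"
  proof
    assume "eps x \<in> bd S ` int_chains S (n + 1)"
    then obtain w where w: "w \<in> int_chains S (n + 1)" "eps x = bd S w" by blast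
    \<comment> \<open>The correction by w turns x into a cycle of the augmented complex. A filling
      of it, truncated to nonempty \<sigma>, has boundary x.\<close>
    have "x - iota w \<in> aug n" using K_aug[OF x(1)] iota_aug[OF w(1)] subg_diff[OF subg_aug] by simp
    moreover have "Daug (x - iota w) = 0" by (simp only: Daug_diff x(2) Daug_iota w(2) diff_self)
    ultimately obtain y where y: "y \<in> aug (n + 1)" "Daug y = x - iota w" using aug_acyclic by blast
    have "D (res y) = res (x - iota w)" by (simp add: D_def res_Daug_res y(2))
    also have "\<dots> = res x" by (auto simp: res_def iota_def fun_eq_iff)
    finally have "D (res y) = x" using res_id[OF x(1)] by simp
    then show "x \<in> D ` K (n + 1) (n + 1)" using res_K[OF y(1)] by blast
  next
    assume "x \<in> D ` K (n + 1) (n + 1)"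
    then obtain y where y: "y \<in> K (n + 1) (n + 1)" "x = D y" by blast
    \<comment> \<open>At empty \<sigma>, \<open>Daug (Daug y) = 0\<close> says that
      \<open>eps\<close> anticommutes with the differentials; hence the negated witness.\<close>
    have "0 = Daug (x + iota (eps y))" using Daug_Daug[OF K_aug[OF y(1)]] Daug_K[OF y(1)] y(2) by simp
    also have "\<dots> = iota (eps x + bd S (eps y))" by (simp add: Daug_add x(2) Daug_iota iota_add)
    finally have "eps x + bd S (eps y) = 0" using iota_eq_0 by metis
    then have "eps x = bd S (0 - eps y)" by (simp only: bd_diff bd_0 eq_diff_eq)
    moreover have "0 - eps y \<in> int_chains S (n + 1)"
      using eps_int_chains[OF y(1)] subg_diff[OF subg_int_chains subg_zero[OF subg_int_chains]] by blast
    ultimately show "eps x \<in> bd S ` int_chains S (n + 1)" by blast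
  qed
next
  fix z assume z: "z \<in> int_cycles S n"
  then have "iota z \<in> aug (n - 1)" "Daug (iota z) = 0"
    by (auto simp: int_cycles_def iota_aug Daug_iota iota_0)
  \<comment> \<open>Viewed at empty \<sigma>, the cycle z has to bound. The truncation of a filling
    is a total cycle, and the rest of the filling shows that its augmentation is homologous to
    z.\<close>
  then obtain y where y: "y \<in> aug n" "Daug y = iota z" using aug_acyclic[of "iota z" "n - 1"] by auto
  let ?w = "\<lambda>\<tau>. y ({}, \<tau>)"
  have ry: "res y \<in> K n n" using y(1) by (rule res_K) simp
  have "D (res y) = res (iota z)" by (simp add: D_def res_Daug_res y(2))
  also have "\<dots> = 0" by (auto simp: res_def iota_def fun_eq_iff)
  finally have D0: "D (res y) = 0" .
  have "iota z = Daug (res y + iota ?w)" using y(2) res_iota[of y] by simp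
  also have "\<dots> = iota (eps (res y) + bd S ?w)"
    unfolding Daug_add Daug_iota Daug_K[OF ry] D0 iota_add by simp
  finally have "iota (z - (eps (res y) + bd S ?w)) = 0" by (simp add: iota_diff)
  then have "z - (eps (res y) + bd S ?w) = 0" by (rule iota_eq_0)
  then have "z - eps (res y) = bd S ?w" by (simp add: algebra_simps)
  then show "\<exists>x\<in>{x \<in> K n n. D x = 0}. z - eps x \<in> bd S ` int_chains S (n + 1)"
    using ry D0 aug_empty[OF y(1)] by (intro bexI[of _ "res y"]) auto
qed (rule eps_add)

section \<open>The bihomogeneous parts of the double complex as chains with coefficients\<close>

lemma member_subset: "V \<in> \<V> \<Longrightarrow> V \<subseteq> Field S"
  using cover by auto

lemma Restr_Restr: "V \<subseteq> W \<Longrightarrow> Restr (Restr S W) V = Restr S V"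
  by auto

lemma int_cycles_member:
  "V \<in> \<V> \<Longrightarrow> int_cycles (Restr S V) n = {u \<in> int_chains (Restr S V) n. bd S u = 0}"
  by (rule int_cycles_Restr[OF member_subset])

lemma bd_member:
  "V \<in> \<V> \<Longrightarrow> bd (Restr S V) ` int_chains (Restr S V) n = bd S ` int_chains (Restr S V) n"
  using bd_Restr[OF member_subset] by (intro image_cong) (auto simp: int_chains_Restr)

text \<open>Cycles of V, extended by zero, are cycles of every larger member, and all boundaries are
  computed by \<open>bd S\<close>; this puts all values of the functor inside one function
  type.\<close>

lemma presented_homology_functor:
  assumes obj: "\<And>V. V \<in> \<V> \<Longrightarrow> obj F V = poset_homology q (Restr S V) constant_Z"
    and mor: "\<And>V W. V \<in> \<V> \<Longrightarrow> W \<in> \<V> \<Longrightarrow> V \<subseteq> W \<Longrightarrow>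
      mor F V W = inclusion_induced q (Restr S V) (Restr S W)"
  shows "presented_functor R F (\<lambda>V. int_cycles (Restr S V) q)
    (\<lambda>V. bd S ` int_chains (Restr S V) (q + 1)) (\<lambda>V. hom_class (Restr S V) q)"
proof unfold_locales
  fix V assume "V \<in> Field R"
  then have V: "V \<in> \<V>" by (simp add: Field_inclusion_order)
  interpret V: finite_poset "Restr S V" by (rule Restr_poset)
  show "presents (int_cycles (Restr S V) q) (bd S ` int_chains (Restr S V) (q + 1)) (hom_class (Restr S V) q) (obj F V)"
    unfolding obj[OF V] bd_member[OF V, symmetric] by (rule V.presents_int_homology)
next
  fix V W assume "(V, W) \<in> R"
  then have VW: "V \<in> \<V>" "W \<in> \<V>" "V \<subseteq> W" by (auto simp: R_iff)
  interpret W: finite_poset "Restr S W" by (rule Restr_poset)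
  show "int_cycles (Restr S V) q \<subseteq> int_cycles (Restr S W) q"
    unfolding int_cycles_member[OF VW(1)] int_cycles_member[OF VW(2)] using VW(3) by (auto simp: int_chains_Restr)
  fix z assume "z \<in> int_cycles (Restr S V) q"
  then have "z \<in> int_chains (Restr S V) q" by (simp add: int_cycles_def)
  then show "mor F V W (hom_class (Restr S V) q z) = hom_class (Restr S W) q z"
    using W.inclusion_induced_hom_class[of V z q] Restr_Restr[OF VW(3)] VW(3) Field_Restr[OF member_subset[OF VW(2)]]
    by (simp add: mor[OF VW])
qed

text \<open>The part of bidegree (p, q) in curried form: a chain on the cover whose coefficients are
  functions of \<tau>, so that \<open>bd R\<close> applies to it directly.\<close>

definition Kpq :: "int \<Rightarrow> int \<Rightarrow> ('a set set \<Rightarrow> 'a set \<Rightarrow> int) set" where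
  "Kpq p q = {u. \<forall>\<sigma> \<tau>. u \<sigma> \<tau> \<noteq> 0 \<longrightarrow>
     valid \<sigma> \<tau> \<and> \<sigma> \<noteq> {} \<and> int (card \<sigma>) = p + 1 \<and> int (card \<tau>) = q + 1}"

text \<open>The minimum of \<sigma> is contained in all its members, so \<tau> lies in all of them
  as soon as it lies in the minimum. This is why the coefficients sit at
  \<open>vertex R \<sigma> 0\<close>.\<close>

lemma Ch_member:
  assumes \<sigma>: "\<sigma> \<in> Ch R p"
  shows "\<tau> \<in> Ch (Restr S (vertex R \<sigma> 0)) q \<longleftrightarrow> valid \<sigma> \<tau> \<and> int (card \<tau>) = q + 1"
proof -
  have c: "\<sigma> \<in> Chains R" "\<sigma> \<noteq> {}" using \<sigma> by (auto simp: Ch_iff)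
  note v = R.vertex_0[OF c]
  have "\<tau> \<subseteq> vertex R \<sigma> 0 \<longleftrightarrow> (\<forall>v\<in>\<sigma>. \<tau> \<subseteq> v)" using v by (auto simp: R_iff)
  moreover have "{} \<in> Chains R" by (simp add: Chains_def)
  ultimately show ?thesis using valid_empty[of \<tau> q] c unfolding Ch_Restr valid_def by blast
qed

lemma Ch_R_iff: "\<sigma> \<in> Ch R p \<longleftrightarrow> \<sigma> \<in> Chains R \<and> \<sigma> \<noteq> {} \<and> int (card \<sigma>) = p + 1"
proof (cases "\<sigma> \<in> Chains R")
  case True
  then have "card \<sigma> > 0 \<longleftrightarrow> \<sigma> \<noteq> {}" using R.finite_Chains by (simp add: card_gt_0_iff)
  then show ?thesis by (auto simp: Ch_iff)
qed (simp add: Ch_iff)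

lemma Kpq_eq: "u \<in> Kpq p q \<longleftrightarrow>
  (\<forall>\<sigma>. if \<sigma> \<in> Ch R p then u \<sigma> \<in> int_chains (Restr S (vertex R \<sigma> 0)) q else u \<sigma> = 0)"
proof
  assume u: "u \<in> Kpq p q"
  show "\<forall>\<sigma>. if \<sigma> \<in> Ch R p then u \<sigma> \<in> int_chains (Restr S (vertex R \<sigma> 0)) q else u \<sigma> = 0"
  proof
    fix \<sigma> show "if \<sigma> \<in> Ch R p then u \<sigma> \<in> int_chains (Restr S (vertex R \<sigma> 0)) q else u \<sigma> = 0"
    proof (cases "\<sigma> \<in> Ch R p")
      case True
      then show ?thesis using u Ch_member[OF True, of _ q] by (auto simp: Kpq_def int_chains_def)
    next
      case False
      have "u \<sigma> \<tau> = 0" for \<tau> using u False by (auto simp: Kpq_def Ch_R_iff valid_def)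
      then show ?thesis using False by auto
    qed
  qed
next
  assume u: "\<forall>\<sigma>. if \<sigma> \<in> Ch R p then u \<sigma> \<in> int_chains (Restr S (vertex R \<sigma> 0)) q else u \<sigma> = 0"
  show "u \<in> Kpq p q"
    unfolding Kpq_def
  proof clarify
    fix \<sigma> \<tau> assume n: "u \<sigma> \<tau> \<noteq> 0"
    then have s: "\<sigma> \<in> Ch R p" using u[rule_format, of \<sigma>] by (auto split: if_splits)
    then have "u \<sigma> \<in> int_chains (Restr S (vertex R \<sigma> 0)) q" using u[rule_format, of \<sigma>] by simp
    then have "\<tau> \<in> Ch (Restr S (vertex R \<sigma> 0)) q" using n int_chainsD by blast
    then show "valid \<sigma> \<tau> \<and> \<sigma> \<noteq> {} \<and> int (card \<sigma>) = p + 1 \<and> int (card \<tau>) = q + 1"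
      using Ch_member[OF s, of \<tau> q] s by (auto simp: Ch_R_iff)
  qed
qed

lemma vertex_member: "\<sigma> \<in> Ch R p \<Longrightarrow> vertex R \<sigma> 0 \<in> \<V>"
  using R.vertex_0(1)[of \<sigma>] Chains_R_subset[of \<sigma>] by (auto simp: Ch_R_iff)

lemma cycles_eq:
  "{u. \<forall>\<sigma>. if \<sigma> \<in> Ch R p then u \<sigma> \<in> int_cycles (Restr S (vertex R \<sigma> 0)) q else u \<sigma> = 0} =
   {u \<in> Kpq p q. \<forall>\<sigma>. bd S (u \<sigma>) = 0}"
proof (rule Collect_cong)
  fix u :: "'a set set \<Rightarrow> 'a set \<Rightarrow> int"
  have "(if \<sigma> \<in> Ch R p then u \<sigma> \<in> int_cycles (Restr S (vertex R \<sigma> 0)) q else u \<sigma> = 0) \<longleftrightarrow>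
    (if \<sigma> \<in> Ch R p then u \<sigma> \<in> int_chains (Restr S (vertex R \<sigma> 0)) q else u \<sigma> = 0) \<and> bd S (u \<sigma>) = 0" for \<sigma>
    using int_cycles_member[OF vertex_member, of \<sigma> p q] bd_0[of S] by (cases "\<sigma> \<in> Ch R p") auto
  then show "(\<forall>\<sigma>. if \<sigma> \<in> Ch R p then u \<sigma> \<in> int_cycles (Restr S (vertex R \<sigma> 0)) q else u \<sigma> = 0) \<longleftrightarrow>
      u \<in> Kpq p q \<and> (\<forall>\<sigma>. bd S (u \<sigma>) = 0)" unfolding Kpq_eq by blast
qed

lemma boundaries_eq:
  "{u. \<forall>\<sigma>. if \<sigma> \<in> Ch R p then u \<sigma> \<in> bd S ` int_chains (Restr S (vertex R \<sigma> 0)) (q + 1) else u \<sigma> = 0} =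
   (\<lambda>w \<sigma>. bd S (w \<sigma>)) ` Kpq p (q + 1)"
proof (intro equalityI subsetI)
  fix u assume u: "u \<in> {u. \<forall>\<sigma>. if \<sigma> \<in> Ch R p then u \<sigma> \<in> bd S ` int_chains (Restr S (vertex R \<sigma> 0)) (q + 1) else u \<sigma> = 0}"
  have b0: "bd S (0 :: 'a set \<Rightarrow> int) = 0" by (auto simp: bd_def aug_bd_def fun_eq_iff)
  have "\<exists>w. u \<sigma> = bd S w \<and> (if \<sigma> \<in> Ch R p then w \<in> int_chains (Restr S (vertex R \<sigma> 0)) (q + 1) else w = 0)" for \<sigma>
    using u[THEN CollectD, rule_format, of \<sigma>] b0 by (cases "\<sigma> \<in> Ch R p") auto
  then obtain w where w: "\<And>\<sigma>. u \<sigma> = bd S (w \<sigma>) \<and> (if \<sigma> \<in> Ch R p then w \<sigma> \<in> int_chains (Restr S (vertex R \<sigma> 0)) (q + 1) else w \<sigma> = 0)"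
    by metis
  then have "w \<in> Kpq p (q + 1)" "u = (\<lambda>\<sigma>. bd S (w \<sigma>))" by (auto simp: Kpq_eq)
  then show "u \<in> (\<lambda>w \<sigma>. bd S (w \<sigma>)) ` Kpq p (q + 1)" by blast
next
  fix u assume "u \<in> (\<lambda>w \<sigma>. bd S (w \<sigma>)) ` Kpq p (q + 1)"
  then obtain w where w: "w \<in> Kpq p (q + 1)" "u = (\<lambda>\<sigma>. bd S (w \<sigma>))" by blast
  have b0: "bd S (0 :: 'a set \<Rightarrow> int) = 0" by (auto simp: bd_def aug_bd_def fun_eq_iff)
  show "u \<in> {u. \<forall>\<sigma>. if \<sigma> \<in> Ch R p then u \<sigma> \<in> bd S ` int_chains (Restr S (vertex R \<sigma> 0)) (q + 1) else u \<sigma> = 0}"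
    using w(1) b0 unfolding Kpq_eq w(2) by auto
qed

definition component :: "int \<Rightarrow> ('a set set \<times> 'a set \<Rightarrow> int) \<Rightarrow> 'a set set \<Rightarrow> 'a set \<Rightarrow> int" where
  "component p x \<sigma> \<tau> = (if int (card \<sigma>) = p + 1 then x (\<sigma>, \<tau>) else 0)"

end

section \<open>The second page\<close>

context cover_complex
begin

definition uncurry :: "('a set set \<Rightarrow> 'a set \<Rightarrow> int) \<Rightarrow> 'a set set \<times> 'a set \<Rightarrow> int" where
  "uncurry u = (\<lambda>(\<sigma>, \<tau>). u \<sigma> \<tau>)"

text \<open>Cancels the sign built into \<open>d2\<close>; it is its own inverse.\<close>

definition twist :: "('a set set \<Rightarrow> 'a set \<Rightarrow> int) \<Rightarrow> 'a set set \<Rightarrow> 'a set \<Rightarrow> int" where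
  "twist u \<sigma> \<tau> = alt (card \<sigma>) (u \<sigma> \<tau>)"

lemma bd_alt: "bd r (\<lambda>\<tau>. alt k (u \<tau>)) \<tau> = alt k (bd r u \<tau>)"
  by (simp add: bd_def aug_bd_def alt_sum alt_commute)

lemma bd_twist: "bd S (twist u \<sigma>) \<tau> = alt (card \<sigma>) (bd S (u \<sigma>) \<tau>)"
  using bd_alt[of S "card \<sigma>" "u \<sigma>" \<tau>] by (simp add: twist_def[abs_def])

lemma bd_uminus: "bd r (- u) = - bd r u"
  using bd_diff[of r 0 u] by (simp add: bd_0)

lemma bd_R_apply: "bd R u \<sigma> \<tau> = (if \<sigma> = {} then 0 else aug_bd R (\<lambda>\<sigma>. u \<sigma> \<tau>) \<sigma>)"
  by (simp add: bd_def aug_bd_def sum_fun_apply)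

section \<open>Leading terms of the total differential and the second page\<close>

lemma D_apply:
  "\<sigma> \<noteq> {} \<Longrightarrow> D x (\<sigma>, \<tau>) = aug_bd R (\<lambda>\<sigma>. x (\<sigma>, \<tau>)) \<sigma> + alt (card \<sigma>) (bd S (\<lambda>\<tau>. x (\<sigma>, \<tau>)) \<tau>)"
  by (simp add: D_def res_def Daug_def d1_def d2_def)

lemma K_nonzero: "x \<in> K p n \<Longrightarrow> x (\<sigma>, \<tau>) \<noteq> 0 \<Longrightarrow>
  valid \<sigma> \<tau> \<and> int (card \<sigma>) + int (card \<tau>) = n + 2 \<and> \<sigma> \<noteq> {} \<and> int (card \<sigma>) \<le> p + 1"
  by (auto simp: K_eq)

lemma K_insert:
  assumes "x \<in> K p n" "x (insert v \<sigma>, \<tau>) \<noteq> 0" "v \<notin> \<sigma>"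
  shows "int (card (insert v \<sigma>)) = int (card \<sigma>) + 1" "int (card \<sigma>) \<le> p"
proof -
  note k = K_nonzero[OF assms(1,2)]
  then have "finite \<sigma>" using valid_finite(1)[of "insert v \<sigma>" \<tau>] by simp
  then show "int (card (insert v \<sigma>)) = int (card \<sigma>) + 1" using assms(3) by simp
  then show "int (card \<sigma>) \<le> p" using k by simp
qed

text \<open>At the maximal dimension of \<sigma> there are no cofaces in the cover direction, so
  only the boundary in \<tau> survives.\<close>

lemma D_top:
  assumes x: "x \<in> K p n" and \<sigma>: "\<sigma> \<noteq> {}" "int (card \<sigma>) = p + 1"
  shows "D x (\<sigma>, \<tau>) = alt (card \<sigma>) (bd S (component p x \<sigma>) \<tau>)"
proof -
  have "x (insert v \<sigma>, \<tau>) = 0" if "v \<notin> \<sigma>" for v using K_insert(2)[OF x _ that] \<sigma>(2) by fastforce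
  then have "aug_bd R (\<lambda>\<sigma>. x (\<sigma>, \<tau>)) \<sigma> = 0" by (simp add: aug_bd_def)
  then show ?thesis using \<sigma> by (simp add: D_apply component_def[abs_def])
qed

text \<open>One dimension lower, the cover direction sees only the top component. The second page
  depends on no further layers.\<close>

lemma D_next:
  assumes x: "x \<in> K p n" and \<sigma>: "\<sigma> \<noteq> {}" "int (card \<sigma>) = p"
  shows "D x (\<sigma>, \<tau>) = bd R (component p x) \<sigma> \<tau> + alt (card \<sigma>) (bd S (component (p - 1) x \<sigma>) \<tau>)"
proof -
  have "x (insert v \<sigma>, \<tau>) = component p x (insert v \<sigma>) \<tau>" if "v \<notin> \<sigma>" for v
    using K_insert(1)[OF x _ that] \<sigma>(2) unfolding component_def by fastforce
  then have "aug_bd R (\<lambda>\<sigma>. x (\<sigma>, \<tau>)) \<sigma> = aug_bd R (\<lambda>\<sigma>. component p x \<sigma> \<tau>) \<sigma>"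
    unfolding aug_bd_def by (intro sum.cong) auto
  then show ?thesis using \<sigma> by (simp add: D_apply bd_R_apply component_def[of "p - 1", abs_def])
qed

lemma bd_R_component:
  assumes x: "x \<in> K p' n" and \<sigma>: "int (card \<sigma>) \<noteq> p \<or> \<sigma> = {}"
  shows "bd R (component p x) \<sigma> \<tau> = 0"
proof (cases "\<sigma> = {}")
  case False
  have "component p x (insert v \<sigma>) \<tau> = 0" if v: "v \<notin> \<sigma>" for v
  proof (rule ccontr)
    assume "component p x (insert v \<sigma>) \<tau> \<noteq> 0"
    then have "int (card (insert v \<sigma>)) = p + 1" "x (insert v \<sigma>, \<tau>) \<noteq> 0"
      by (auto simp: component_def split: if_splits)
    then show False using K_insert(1)[OF x _ v, of \<tau>] \<sigma> False by simp
  qed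
  then show ?thesis by (simp add: bd_R_apply aug_bd_def)
qed (simp add: bd_R_apply)

lemma component_Kpq: "x \<in> K p' (p + q) \<Longrightarrow> component p x \<in> Kpq p q"
  using K_nonzero[of x p' "p + q"] unfolding Kpq_def component_def by (fastforce split: if_splits)

lemma uncurry_K: "u \<in> Kpq p q \<Longrightarrow> uncurry u \<in> K p (p + q)"
  unfolding Kpq_def uncurry_def K_eq by auto

lemma component_uncurry:
  assumes u: "u \<in> Kpq p q"
  shows "component p (uncurry u) = u" "p' \<noteq> p \<Longrightarrow> component p' (uncurry u) = 0"
proof -
  have "u \<sigma> \<tau> = 0" if "int (card \<sigma>) \<noteq> p + 1" for \<sigma> \<tau> 
    using u that unfolding Kpq_def by blast
  then show "component p (uncurry u) = u" "p' \<noteq> p \<Longrightarrow> component p' (uncurry u) = 0"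
    by (auto simp: component_def uncurry_def fun_eq_iff)
qed

lemma component_add: "component p (x + y) = component p x + component p y"
  and component_diff: "component p (x - y) = component p x - component p y"
  by (auto simp: component_def fun_eq_iff)

lemma component_eq_0: "x \<in> K p' n \<Longrightarrow> int (card \<sigma>) \<noteq> p + 1 \<or> \<sigma> = {} \<Longrightarrow> component p x \<sigma> = 0"
  by (auto simp: component_def K_eq fun_eq_iff)

lemma twist_Kpq: "u \<in> Kpq p q \<Longrightarrow> twist u \<in> Kpq p q"
  by (auto simp: Kpq_def twist_def)

lemma uminus_Kpq: "u \<in> Kpq p q \<Longrightarrow> - u \<in> Kpq p q"
  by (auto simp: Kpq_def)

lemma K_lower:
  assumes "x \<in> K p n" "\<And>\<sigma> \<tau>. \<sigma> \<noteq> {} \<Longrightarrow> int (card \<sigma>) = p + 1 \<Longrightarrow> x (\<sigma>, \<tau>) = 0"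
  shows "x \<in> K (p - 1) n"
proof -
  have "valid \<sigma> \<tau> \<and> int (card \<sigma>) + int (card \<tau>) = n + 2 \<and> \<sigma> \<noteq> {} \<and> int (card \<sigma>) \<le> p - 1 + 1"
    if "x (\<sigma>, \<tau>) \<noteq> 0" for \<sigma> \<tau>
    using K_nonzero[OF assms(1) that] assms(2)[of \<sigma> \<tau>] that by fastforce
  then show ?thesis unfolding K_eq by blast
qed

lemma K_top_zero: "x \<in> K p n \<Longrightarrow> p + 1 < int (card \<sigma>) \<Longrightarrow> x (\<sigma>, \<tau>) = 0"
  using K_nonzero by fastforce

text \<open>x is sent to its leading component, that is, its layer with \<sigma> of dimension p.
  Membership in \<open>Zr 2\<close> says that \<open>D x\<close> vanishes in layers p and p - 1: the
  first makes the component a cycle in \<tau>, the second makes its boundary in \<sigma> a boundary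
  in \<tau>. These are the cycles with coefficients in H_q, and the denominators match in the same
  way.\<close>

lemma presents_E2:
  assumes obj: "\<And>V. V \<in> \<V> \<Longrightarrow> obj F V = poset_homology q (Restr S V) constant_Z"
    and mor: "\<And>V W. V \<in> \<V> \<Longrightarrow> W \<in> \<V> \<Longrightarrow> V \<subseteq> W \<Longrightarrow>
      mor F V W = inclusion_induced q (Restr S V) (Restr S W)"
  shows "\<exists>\<pi>. presents (Zr 2 p (p + q)) (Br 2 p (p + q)) \<pi> (poset_homology p R F)"
proof -
  let ?n = "p + q"
  have e: "p + 2 - 1 = p + 1" "(2 :: int) - 1 = 1" by simp_all
  let ?C = "\<lambda>p. {u \<in> Kpq p q. \<forall>\<sigma>. bd S (u \<sigma>) = 0}"
  let ?B = "\<lambda>p. (\<lambda>w \<sigma>. bd S (w \<sigma>)) ` Kpq p (q + 1)"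
  let ?N = "{u \<in> ?C p. bd R u \<in> ?B (p - 1) \<and> (\<exists>w\<in>?C (p + 1). u - bd R w \<in> ?B p)}"
  interpret P: presented_functor R F "\<lambda>V. int_cycles (Restr S V) q"
    "\<lambda>V. bd S ` int_chains (Restr S V) (q + 1)" "\<lambda>V. hom_class (Restr S V) q"
    using obj mor by (rule presented_homology_functor)
  have C: "P.coeff_chains (\<lambda>V. int_cycles (Restr S V) q) m = ?C m" for m
    unfolding P.coeff_chains_def by (rule cycles_eq)
  have B: "P.coeff_chains (\<lambda>V. bd S ` int_chains (Restr S V) (q + 1)) m = ?B m" for m
    unfolding P.coeff_chains_def by (rule boundaries_eq)
  note pr = P.presents_poset_homology[of p, unfolded C B]
  have into: "component p x \<in> ?C p \<and> bd R (component p x) \<in> ?B (p - 1)" if "x \<in> Zr 2 p ?n" for x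
  proof -
    have x: "x \<in> K p ?n" and Dx: "D x \<in> K (p - 2) (?n - 1)" using that by (auto simp: Zr_def)
    have "bd S (component p x \<sigma>) \<tau> = 0" for \<sigma> \<tau>
    proof (cases "\<sigma> \<noteq> {} \<and> int (card \<sigma>) = p + 1")
      case True
      then have "D x (\<sigma>, \<tau>) = 0" using K_top_zero[OF Dx] by simp
      then show ?thesis using D_top[OF x] True by simp
    qed (use component_eq_0[OF x, of \<sigma> p] in \<open>auto simp: bd_0\<close>)
    then have 1: "component p x \<in> ?C p" using component_Kpq[OF x] by (auto simp: fun_eq_iff)
    \<comment> \<open>The vanishing of \<open>D x\<close> in layer p - 1, solved by
      \<open>D_next\<close> for the boundary in \<sigma>.\<close>
    let ?w = "- twist (component (p - 1) x)"
    have "bd R (component p x) \<sigma> \<tau> = bd S (?w \<sigma>) \<tau>" for \<sigma> \<tau>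
    proof (cases "\<sigma> \<noteq> {} \<and> int (card \<sigma>) = p")
      case True
      then have "D x (\<sigma>, \<tau>) = 0" using K_top_zero[OF Dx] by simp
      then show ?thesis using D_next[OF x, of \<sigma> \<tau>] True by (simp add: bd_uminus bd_twist)
    next
      case False
      then have "component (p - 1) x \<sigma> = 0" using component_eq_0[OF x, of \<sigma> "p - 1"] by auto
      then have "bd S (?w \<sigma>) \<tau> = 0" by (simp add: bd_uminus bd_twist bd_0)
      then show ?thesis using False bd_R_component[OF x, of \<sigma> p \<tau>] by auto
    qed
    then have "bd R (component p x) = (\<lambda>\<sigma>. bd S (?w \<sigma>))" by (simp add: fun_eq_iff)
    moreover have "?w \<in> Kpq (p - 1) (q + 1)"
      using x by (intro uminus_Kpq twist_Kpq component_Kpq[of x p]) simp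
    ultimately show ?thesis using 1 by blast
  qed
  have "presents (Zr 2 p ?n) (Br 2 p ?n)
    (\<lambda>x. (boundary R F (p + 1) ` carrier (chain_grp R F (p + 1))) #>\<^bsub>chain_grp R F p\<^esub> P.pr p (component p x))
    (poset_homology p R F)"
  proof (rule presents_pull[OF pr subg_Zr])
    show "Br 2 p ?n \<subseteq> Zr 2 p ?n" by (rule Br_subset) simp
    show "component p x \<in> {u \<in> ?C p. bd R u \<in> ?B (p - 1)}" if "x \<in> Zr 2 p ?n" for x
      using into[OF that] by blast
  next
    fix z assume "z \<in> {u \<in> ?C p. bd R u \<in> ?B (p - 1)}"
    then obtain w where z: "z \<in> Kpq p q" "\<And>\<sigma>. bd S (z \<sigma>) = 0"
      and w: "w \<in> Kpq (p - 1) (q + 1)" "bd R z = (\<lambda>\<sigma>. bd S (w \<sigma>))" by blast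
    \<comment> \<open>A lift of z with a correction one layer down. The sign makes the two
      contributions to layer p - 1 of \<open>D x\<close> cancel.\<close>
    define x where "x = uncurry z - uncurry (twist w)"
    note tw = twist_Kpq[OF w(1)]
    have xK: "x \<in> K p ?n" unfolding x_def
      using uncurry_K[OF z(1)] K_le[OF uncurry_K[OF tw], of p] by (intro K_diff) auto
    have cx: "component p x = z" "component (p - 1) x = - twist w"
      using component_uncurry[OF z(1)] component_uncurry[OF tw] by (simp_all add: x_def component_diff)
    have "D x \<in> K (p - 1) (?n - 1)"
      by (rule K_lower[OF D_K[OF xK]]) (simp add: D_top[OF xK] cx z(2))
    then have "D x \<in> K (p - 1 - 1) (?n - 1)"
      by (rule K_lower) (simp add: D_next[OF xK] cx w(2) bd_uminus bd_twist)
    then have "x \<in> Zr 2 p ?n" using xK by (simp add: Zr_def)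
    moreover have "z - component p x \<in> ?N" using subg_zero[OF presents_subg[OF pr]] by (simp add: cx)
    ultimately show "\<exists>x\<in>Zr 2 p ?n. z - component p x \<in> ?N" by blast
  next
    fix x assume xZ: "x \<in> Zr 2 p ?n"
    then have x: "x \<in> K p ?n" and Dx: "D x \<in> K (p - 2) (?n - 1)" by (auto simp: Zr_def)
    have "x \<in> Br 2 p ?n" if cw: "w \<in> ?C (p + 1)" "component p x - bd R w \<in> ?B p" for w
    proof -
      obtain v where v: "v \<in> Kpq p (q + 1)" "component p x - bd R w = (\<lambda>\<sigma>. bd S (v \<sigma>))" using cw(2) by blast
      have w: "w \<in> Kpq (p + 1) q" "\<And>\<sigma>. bd S (w \<sigma>) = 0" using cw(1) by auto
      \<comment> \<open>Chosen so that \<open>D y\<close> vanishes in layer p + 1 and equals the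
        leading component of x in layer p; hence x - D y drops to filtration p - 1.\<close>
      define y where "y = uncurry w + uncurry (twist v)"
      note tv = twist_Kpq[OF v(1)]
      have yK: "y \<in> K (p + 1) (?n + 1)" unfolding y_def
      proof (rule K_add)
        show "uncurry w \<in> K (p + 1) (?n + 1)" using uncurry_K[OF w(1)] by (simp add: add_ac)
        show "uncurry (twist v) \<in> K (p + 1) (?n + 1)"
          using K_le[OF uncurry_K[OF tv], of "p + 1"] by (simp add: add_ac)
      qed
      have cy: "component (p + 1) y = w" "component p y = twist v"
        using component_uncurry[OF w(1)] component_uncurry[OF tv] by (simp_all add: y_def component_add)
      have DyK: "D y \<in> K (p + 1) ?n" using D_K[OF yK] by simp
      then have "D y \<in> K (p + 1 - 1) ?n"
        by (rule K_lower) (simp add: D_top[OF yK] cy w(2))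
      then have Dy: "D y \<in> K p ?n" by simp
      have "x - D y \<in> K (p - 1) ?n"
      proof (rule K_lower[OF K_diff[OF x Dy]])
        fix \<sigma> :: "'a set set" and \<tau> assume s: "\<sigma> \<noteq> {}" "int (card \<sigma>) = p + 1"
        have "D y (\<sigma>, \<tau>) = bd R w \<sigma> \<tau> + bd S (v \<sigma>) \<tau>"
          using D_next[OF yK s] by (simp add: cy bd_twist)
        also have "\<dots> = component p x \<sigma> \<tau>" using fun_cong[OF fun_cong[OF v(2), of \<sigma>], of \<tau>] by simp
        finally show "(x - D y) (\<sigma>, \<tau>) = 0" using s by (simp add: component_def)
      qed
      moreover have "D (x - D y) \<in> K (p - 1 - 1) (?n - 1)" using Dx D_D[OF yK] by (simp add: D_diff)
      ultimately have "x - D y \<in> Zr (2 - 1) (p - 1) ?n" by (simp add: Zr_def)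
      moreover have "y \<in> Zr (2 - 1) (p + 2 - 1) (?n + 1)" unfolding e using yK Dy by (simp add: Zr_def)
      ultimately have "(x - D y) + D y \<in> Br 2 p ?n" unfolding Br_def by blast
      then show ?thesis by simp
    qed
    moreover have "\<exists>w\<in>?C (p + 1). component p x - bd R w \<in> ?B p" if xB: "x \<in> Br 2 p ?n"
    proof -
      obtain z y where "x = z + D y" "z \<in> Zr (2 - 1) (p - 1) ?n" "y \<in> Zr (2 - 1) (p + 2 - 1) (?n + 1)"
        using xB unfolding Br_def by blast
      then have z: "x = z + D y" "z \<in> K (p - 1) ?n" and y: "y \<in> K (p + 1) (?n + 1)" "D y \<in> K p ?n"
        unfolding e by (simp_all add: Zr_def)
      \<comment> \<open>The two leading components of y are the witnesses; z has filtration p - 1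
        and does not reach layer p.\<close>
      let ?w = "component (p + 1) y" and ?v = "twist (component p y)"
      have "bd S (?w \<sigma>) \<tau> = 0" for \<sigma> \<tau>
      proof (cases "\<sigma> \<noteq> {} \<and> int (card \<sigma>) = p + 1 + 1")
        case True
        then have "D y (\<sigma>, \<tau>) = 0" using K_top_zero[OF y(2)] by simp
        then show ?thesis using D_top[OF y(1)] True by simp
      qed (use component_eq_0[OF y(1), of \<sigma> "p + 1"] in \<open>auto simp: bd_0\<close>)
      moreover have "?w \<in> Kpq (p + 1) q" using y(1) by (intro component_Kpq[of y "p + 1"]) (simp add: add_ac)
      ultimately have w: "?w \<in> ?C (p + 1)" by (auto simp: fun_eq_iff)
      have v: "?v \<in> Kpq p (q + 1)" using y(1) by (intro twist_Kpq component_Kpq[of y "p + 1"]) (simp add: add_ac)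
      have "component p x \<sigma> \<tau> - bd R ?w \<sigma> \<tau> = bd S (?v \<sigma>) \<tau>" for \<sigma> \<tau>
      proof (cases "\<sigma> \<noteq> {} \<and> int (card \<sigma>) = p + 1")
        case True
        then have "z (\<sigma>, \<tau>) = 0" using K_top_zero[OF z(2)] by simp
        then have "component p x \<sigma> \<tau> = D y (\<sigma>, \<tau>)" using True z(1) by (simp add: component_def)
        then show ?thesis using D_next[OF y(1), of \<sigma> \<tau>] True by (simp add: bd_twist)
      next
        case False
        then have "component p x \<sigma> = 0" "component p y \<sigma> = 0"
          using component_eq_0[OF x, of \<sigma> p] component_eq_0[OF y(1), of \<sigma> p] by auto
        moreover have "bd R ?w \<sigma> \<tau> = 0" using False bd_R_component[OF y(1), of \<sigma> "p + 1" \<tau>] by auto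
        ultimately show ?thesis by (simp add: bd_twist bd_0)
      qed
      then have "component p x - bd R ?w = (\<lambda>\<sigma>. bd S (?v \<sigma>))" by (simp add: fun_eq_iff)
      then show ?thesis using w v by blast
    qed
    ultimately show "component p x \<in> ?N \<longleftrightarrow> x \<in> Br 2 p ?n" using into[OF xZ] by blast
  qed (rule component_add)
  then show ?thesis by blast
qed

end

section \<open>Finite T0-spaces as posets, and the theorem\<close>

lemma space_order_iff:
  "(x, y) \<in> space_order X \<longleftrightarrow> y \<in> topspace X \<and> (\<forall>U. openin X U \<longrightarrow> y \<in> U \<longrightarrow> x \<in> U)"
  by (auto simp: space_order_def minimal_open_def)

lemma Field_space_order: "Field (space_order X) = topspace X"
  by (auto simp: Field_def space_order_iff)

lemma finite_poset_space_order:
  assumes "finite (topspace X)" "t0_space X"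
  shows "finite_poset (space_order X)"
proof
  show "finite (Field (space_order X))" using assms(1) by (simp add: Field_space_order)
  have "x = y" if "(x, y) \<in> space_order X" "(y, x) \<in> space_order X" for x y
  proof (rule ccontr)
    assume "x \<noteq> y"
    moreover have "x \<in> topspace X" "y \<in> topspace X" using that by (auto simp: space_order_iff)
    ultimately obtain U where "openin X U" "x \<notin> U \<longleftrightarrow> y \<in> U" using assms(2) unfolding t0_space_def by metis
    then show False using that unfolding space_order_iff by metis
  qed
  then have "antisym (space_order X)" by (rule antisymI)
  moreover have "trans (space_order X)"
    by (rule transI) (auto simp: space_order_iff)
  moreover have "refl_on (topspace X) (space_order X)"
    by (auto simp: refl_on_def space_order_iff)
  moreover have "space_order X \<subseteq> topspace X \<times> topspace X" by (auto simp: space_order_iff)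
  ultimately show "Partial_order (space_order X)"
    unfolding Field_space_order by (simp add: partial_order_on_def preorder_on_def)
qed

text \<open>Since V is open, the minimal open set of a point of V is the same in V as in X. For this
  reason each member of the cover is a subposet with the restricted order.\<close>

lemma space_order_subtopology:
  assumes "openin X V"
  shows "space_order (subtopology X V) = Restr (space_order X) V"
proof -
  have V: "V \<subseteq> topspace X" using assms by (rule openin_subset)
  have "(x, y) \<in> space_order (subtopology X V) \<longleftrightarrow> (x, y) \<in> Restr (space_order X) V" for x y
    using V assms by (auto simp: space_order_iff openin_subtopology)
  then show ?thesis by auto
qed

theorem proposition3p8:
  fixes X :: "'a topology" and \<V> :: "'a set set"
  assumes "finite (topspace X)" and "t0_space X"
    and "finite \<V>" and "open_cover X \<V>" and "basis_like \<V>"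
  shows "(\<forall>q. is_functor (inclusion_order \<V>) (homology_functor X q)) \<and>
    (\<exists>(E :: nat \<Rightarrow> int \<Rightarrow> int \<Rightarrow> ('a set set \<times> 'a set \<Rightarrow> int) set monoid) d.
       spectral_sequence 2 E d \<and>
       (\<forall>p q. E 2 p q \<cong> poset_homology p (inclusion_order \<V>) (homology_functor X q)) \<and>
       converges_to 2 E (\<lambda>n. space_homology n X))"
proof -
  let ?S = "space_order X"
  have op: "openin X V" if "V \<in> \<V>" for V using assms(4) that by (auto simp: open_cover_def)
  interpret S: finite_poset ?S using assms(1,2) by (rule finite_poset_space_order)
  interpret cover_complex ?S \<V>
  proof
    show "x \<in> v" if "v \<in> \<V>" "y \<in> v" "(x, y) \<in> ?S" for v x y
      using op[OF that(1)] that(2,3) by (auto simp: space_order_iff)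
    show "\<Union>\<V> = Field ?S" using assms(4) by (simp add: open_cover_def Field_space_order)
  qed (fact assms)+
  have obj: "obj (homology_functor X q) V = poset_homology q (Restr ?S V) constant_Z" if "V \<in> \<V>" for q V
    by (simp add: homology_functor_def space_homology_def space_order_subtopology[OF op[OF that]])
  have mor: "mor (homology_functor X q) V W = inclusion_induced q (Restr ?S V) (Restr ?S W)"
    if "V \<in> \<V>" "W \<in> \<V>" for q V W
    by (simp add: homology_functor_def space_order_subtopology[OF op[OF that(1)]] space_order_subtopology[OF op[OF that(2)]])
  have "is_functor R (homology_functor X q)" for q
  proof -
    interpret P: presented_functor R "homology_functor X q" "\<lambda>V. int_cycles (Restr ?S V) q"
      "\<lambda>V. bd ?S ` int_chains (Restr ?S V) (q + 1)" "\<lambda>V. hom_class (Restr ?S V) q"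
      using obj mor by (rule presented_homology_functor)
    show ?thesis by (rule is_functor_presented[OF P.pres P.Z_mono P.mor R.po])
  qed
  moreover have "Er 2 p q \<cong> poset_homology p R (homology_functor X q)" for p q
  proof -
    obtain \<pi> where "presents (Zr 2 p (p + q)) (Br 2 p (p + q)) \<pi> (poset_homology p R (homology_functor X q))"
      using presents_E2[OF obj mor] by blast
    moreover have "presents (Zr 2 p (p + q)) (Br 2 p (p + q)) (add_coset (Br 2 p (p + q))) (Er 2 p q)"
      using presents_Er[of 2 p q] by simp
    ultimately show ?thesis using presents_iso by blast
  qed
  moreover have "spectral_sequence 2 Er dr" by (rule spectral_sequence_Er) simp
  moreover have "converges_to 2 Er (\<lambda>n. space_homology n X)"
    unfolding space_homology_def
    by (rule converges_to_Er[where \<eta> = "\<lambda>n x. hom_class ?S n (eps x)"]) (simp, rule presents_total_homology)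
  ultimately show ?thesis by blast
qed

end
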